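(* With $z_2$, $z_{\mathrm{SL}}$, $z_{\mathrm{RL}}$ the second-order, signed and recursive-line Zarankiewicz parameters, $$z_2(7,4)=z_{\mathrm{SL}}(7,4)=z_{\mathrm{RL}}(7,4)=19.$$
   Context: Configurations. Fix $m,n\ge1$. Identify the cell $(i,j)$ (row $i$, column $j$) of the $m\times n$ grid with the monomial $u_{ij}=x_iy_j$ in real variables $x_1,\dots,x_m,y_1,\dots,y_n$. A bilinear form is a real linear combination of the $u_{ij}$. If $P$ is a sum of squares of real bilinear forms, $\mathrm{SOS}(P)$ is the least number of squares in such a representation. A one-edge is a single cell; a two-edge is an unordered pair of two distinct cells (possibly in a common row or column). An augmented configuration $G$ consists of a set $E_1$ of one-edges and a set $E_2$ of two-edges, together called the selected edges; $G$ is simple if distinct selected edges have disjoint supports (sets of cells). Put $P_G=\sum_{(i,j)\in E_1}u_{ij}^2+\sum_{\{(i,j),(k,\ell)\}\in E_2}(u_{ij}+u_{k\ell})^2$ and $R(G)=|E_1|+|E_2|$ (number of displayed squares). $G$ is irreducible if $\mathrm{SOS}(P_G)=R(G)$. $z(m,n)$ is the maximum number of edges of a $C_4$-free bipartite graph with parts $[m]$ (rows) and $[n]$ (columns), i.e. of a set of cells containing no four corners of two rows and two columns. $G$ is limited if it is simple, $E_1$ is $C_4$-free and $|E_1|=z(m,n)$. $z_2(m,n)$ is the maximum of $R(G)$ over irreducible limited $m\times n$ configurations. The condition $(RW3^+)$. For a simple $G$ let $\Omega$ be the set of cells occupied by selected edges, and for distinct cells let $\delta(p,q)=1$ if $\{p,q\}\in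 E_2$ and $0$ otherwise. A genuine rectangle is given by two distinct rows and two distinct columns; its two diagonals are the two pairs of opposite corners. Let $\sim$ (an equivalence relation on $\Omega$) and $\perp_R$ (a symmetric relation on $\Omega$) be the least relations closed under: (1) Line rule: if distinct $p,q\in\Omega$ lie in a common row or column, then $p\sim q$ if $\delta(p,q)=1$ and $p\perp_R q$ if $\delta(p,q)=0$. (2) Saturation: if $p\sim p'$, $q\sim q'$, $p'\perp_R q'$ then $p\perp_R q$. (3) Rectangle transfer: let $\{p,q\},\{r,s\}$ be the two diagonals of a genuine rectangle and suppose $\{r,s\}$ is certified, meaning: if $\delta(r,s)=0$, then at least one of $r,s$ is unoccupied or ($r,s\in\Omega$ and $r\perp_R s$); if $\delta(r,s)=1$, then $r\sim s$. Then: if $p,q\in\Omega$ and $\delta(p,q)=0$, $p\perp_R q$; if $\delta(p,q)=1$, $p\sim q$. (4) Complementary pair: if both diagonals $\{p,q\},\{r,s\}$ of a genuine rectangle are in $E_2$, then $p\sim q$ and $r\sim s$. $G$ is $(RW3^+)$-admissible if the two halves of every selected two-edge are $\sim$-equivalent, distinct selected edges lie in distinct $\sim$-classes, and every two distinct selected edges have representatives $p,q$ with $p\perp_R q$. $z_{\mathrm{RL}}(m,n)$ is the maximum of $R(G)$ over limited $(RW3^+)$-admissible $m\times n$ configurations. The parameter $z_{\mathrm{SL}}(m,n)$ is defined analogously to $z_{\mathrm{RL}}$ with a signed condition $(RW3^{\pm})$ from the literature (Löfberg–Qi) in place of $(RW3^+)$; the only property of it to be used is the established hierarchy $z_2(m,n)\ge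 z_{\mathrm{SL}}(m,n)\ge z_{\mathrm{RL}}(m,n)$, so it may be treated as any integer satisfying these inequalities. *)

theory Defs
  imports Complex_Main
begin

text \<open>Rows and columns are numbered from 1; the cell \<open>(i, j)\<close> stands for the monomial
  \<open>x\<^sub>i y\<^sub>j\<close>.\<close>

type_synonym cell = "nat \<times> nat"

definition cells :: "nat \<Rightarrow> nat \<Rightarrow> cell set" where
  "cells m n = {1..m} \<times> {1..n}"

text \<open>Polynomials in \<open>x\<^sub>1, \<dots>, x\<^sub>m, y\<^sub>1, \<dots>, y\<^sub>n\<close> are represented by their polynomial functions,
  which is faithful over the infinite field of real numbers.  The arguments are sequences, of which
  only the entries \<open>x 1, \<dots>, x m\<close> and \<open>y 1, \<dots>, y n\<close> matter.\<close>

type_synonym form = "(nat \<Rightarrow> real) \<Rightarrow> (nat \<Rightarrow> real) \<Rightarrow> real"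

definition bilinear_form :: "nat \<Rightarrow> nat \<Rightarrow> form \<Rightarrow> bool" where
  "bilinear_form m n B \<longleftrightarrow>
     (\<exists>c :: cell \<Rightarrow> real. B = (\<lambda>x y. \<Sum>(i, j)\<in>cells m n. c (i, j) * (x i * y j)))"

definition sos_representable :: "nat \<Rightarrow> nat \<Rightarrow> form \<Rightarrow> nat \<Rightarrow> bool" where
  "sos_representable m n P r \<longleftrightarrow>
     (\<exists>B :: nat \<Rightarrow> form. (\<forall>k<r. bilinear_form m n (B k)) \<and> P = (\<lambda>x y. \<Sum>k<r. (B k x y)\<^sup>2))"

definition SOS :: "nat \<Rightarrow> nat \<Rightarrow> form \<Rightarrow> nat" where
  "SOS m n P = (LEAST r. sos_representable m n P r)"

text \<open>A two-edge is given by its two-element set of cells.\<close>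

record configuration =
  one_edges :: "cell set"
  two_edges :: "cell set set"

definition is_configuration :: "nat \<Rightarrow> nat \<Rightarrow> configuration \<Rightarrow> bool" where
  "is_configuration m n G \<longleftrightarrow>
     one_edges G \<subseteq> cells m n \<and> (\<forall>e\<in>two_edges G. e \<subseteq> cells m n \<and> card e = 2)"

text \<open>Selected edges are identified with their supports.  No two edges are conflated by this: a
  one-edge has a one-element support and a two-edge a two-element one.\<close>

definition selected_edges :: "configuration \<Rightarrow> cell set set" where
  "selected_edges G = (\<lambda>p. {p}) ` one_edges G \<union> two_edges G"

definition simple :: "configuration \<Rightarrow> bool" where
  "simple G \<longleftrightarrow> (\<forall>e\<in>selected_edges G. \<forall>f\<in>selected_edges G. e \<noteq> f \<longrightarrow> e \<inter> f = {})"

definition config_form :: "configuration \<Rightarrow> form" where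
  "config_form G = (\<lambda>x y. (\<Sum>(i, j)\<in>one_edges G. (x i * y j)\<^sup>2) +
                          (\<Sum>e\<in>two_edges G. (\<Sum>(i, j)\<in>e. x i * y j)\<^sup>2))"

definition num_squares :: "configuration \<Rightarrow> nat" where
  "num_squares G = card (one_edges G) + card (two_edges G)"

definition irreducible_config :: "nat \<Rightarrow> nat \<Rightarrow> configuration \<Rightarrow> bool" where
  "irreducible_config m n G \<longleftrightarrow> SOS m n (config_form G) = num_squares G"

definition C4_free :: "cell set \<Rightarrow> bool" where
  "C4_free E \<longleftrightarrow>
     \<not> (\<exists>i k j l. i \<noteq> k \<and> j \<noteq> l \<and> (i, j) \<in> E \<and> (i, l) \<in> E \<and> (k, j) \<in> E \<and> (k, l) \<in> E)"

definition zarankiewicz :: "nat \<Rightarrow> nat \<Rightarrow> nat" where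
  "zarankiewicz m n = Max {card E |E. E \<subseteq> cells m n \<and> C4_free E}"

definition limited :: "nat \<Rightarrow> nat \<Rightarrow> configuration \<Rightarrow> bool" where
  "limited m n G \<longleftrightarrow> is_configuration m n G \<and> simple G \<and>
     C4_free (one_edges G) \<and> card (one_edges G) = zarankiewicz m n"

definition z2 :: "nat \<Rightarrow> nat \<Rightarrow> nat" where
  "z2 m n = Max {num_squares G |G. limited m n G \<and> irreducible_config m n G}"

definition occupied :: "configuration \<Rightarrow> cell set" where
  "occupied G = \<Union> (selected_edges G)"

definition same_line :: "cell \<Rightarrow> cell \<Rightarrow> bool" where
  "same_line p q \<longleftrightarrow> fst p = fst q \<or> snd p = snd q"

text \<open>\<open>{p, q}\<close> and \<open>{r, s}\<close> are the two diagonals of a genuine rectangle.\<close>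

definition rect_diagonals :: "cell \<Rightarrow> cell \<Rightarrow> cell \<Rightarrow> cell \<Rightarrow> bool" where
  "rect_diagonals p q r s \<longleftrightarrow>
     (\<exists>i k j l. i \<noteq> k \<and> j \<noteq> l \<and> p = (i, j) \<and> q = (k, l) \<and> {r, s} = {(i, l), (k, j)})"

text \<open>\<open>rw_eq G\<close> is \<open>\<sim>\<close> and \<open>rw_perp G\<close> is \<open>\<perp>\<^sub>R\<close>; \<open>\<delta>(p, q) = 1\<close> is written \<open>{p, q} \<in> two_edges G\<close>.
  The disjunctive premise of the two transfer rules says that the diagonal \<open>{r, s}\<close> is certified.\<close>

inductive rw_eq :: "configuration \<Rightarrow> cell \<Rightarrow> cell \<Rightarrow> bool"
  and rw_perp :: "configuration \<Rightarrow> cell \<Rightarrow> cell \<Rightarrow> bool"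
  for G :: configuration
where
  eq_refl: "p \<in> occupied G \<Longrightarrow> rw_eq G p p"
| eq_sym: "rw_eq G p q \<Longrightarrow> rw_eq G q p"
| eq_trans: "rw_eq G p q \<Longrightarrow> rw_eq G q r \<Longrightarrow> rw_eq G p r"
| perp_sym: "rw_perp G p q \<Longrightarrow> rw_perp G q p"
| line_eq: "p \<in> occupied G \<Longrightarrow> q \<in> occupied G \<Longrightarrow> p \<noteq> q \<Longrightarrow> same_line p q \<Longrightarrow>
    {p, q} \<in> two_edges G \<Longrightarrow> rw_eq G p q"
| line_perp: "p \<in> occupied G \<Longrightarrow> q \<in> occupied G \<Longrightarrow> p \<noteq> q \<Longrightarrow> same_line p q \<Longrightarrow>
    {p, q} \<notin> two_edges G \<Longrightarrow> rw_perp G p q"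
| saturation: "rw_eq G p p' \<Longrightarrow> rw_eq G q q' \<Longrightarrow> rw_perp G p' q' \<Longrightarrow> rw_perp G p q"
| transfer_perp: "rect_diagonals p q r s \<Longrightarrow>
    ({r, s} \<notin> two_edges G \<and>
       (r \<notin> occupied G \<or> s \<notin> occupied G \<or>
        r \<in> occupied G \<and> s \<in> occupied G \<and> rw_perp G r s)) \<or>
    ({r, s} \<in> two_edges G \<and> rw_eq G r s) \<Longrightarrow>
    p \<in> occupied G \<Longrightarrow> q \<in> occupied G \<Longrightarrow> {p, q} \<notin> two_edges G \<Longrightarrow> rw_perp G p q"
| transfer_eq: "rect_diagonals p q r s \<Longrightarrow>
    ({r, s} \<notin> two_edges G \<and>
       (r \<notin> occupied G \<or> s \<notin> occupied G \<or>
        r \<in> occupied G \<and> s \<in> occupied G \<and> rw_perp G r s)) \<or>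
    ({r, s} \<in> two_edges G \<and> rw_eq G r s) \<Longrightarrow>
    p \<in> occupied G \<Longrightarrow> q \<in> occupied G \<Longrightarrow> {p, q} \<in> two_edges G \<Longrightarrow> rw_eq G p q"
| complementary: "rect_diagonals p q r s \<Longrightarrow>
    {p, q} \<in> two_edges G \<Longrightarrow> {r, s} \<in> two_edges G \<Longrightarrow> rw_eq G p q"

text \<open>Rule \<open>complementary\<close> also yields \<open>rw_eq G r s\<close>, since the two diagonals may be exchanged.\<close>

definition RW3_plus_admissible :: "configuration \<Rightarrow> bool" where
  "RW3_plus_admissible G \<longleftrightarrow>
     (\<forall>e\<in>two_edges G. \<forall>p\<in>e. \<forall>q\<in>e. rw_eq G p q) \<and>
     (\<forall>e\<in>selected_edges G. \<forall>f\<in>selected_edges G. e \<noteq> f \<longrightarrow>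
        (\<forall>p\<in>e. \<forall>q\<in>f. \<not> rw_eq G p q) \<and> (\<exists>p\<in>e. \<exists>q\<in>f. rw_perp G p q))"

definition z_RL :: "nat \<Rightarrow> nat \<Rightarrow> nat" where
  "z_RL m n = Max {num_squares G |G. limited m n G \<and> RW3_plus_admissible G}"

end

theory Submission
  imports Defs "HOL-Analysis.Analysis"
begin

text \<open>
  A representation of \<open>P\<^sub>G\<close> by \<open>r\<close> squares attaches to every cell a vector in \<open>\<real>\<^sup>r\<close>, namely the
  coefficients of its monomial in the squares.  Comparing coefficients prescribes the inner products
  of these vectors along lines, but only the sum of the two inner products over the diagonals of a
  rectangle.  The rules defining \<open>\<sim>\<close> and \<open>\<perp>\<^sub>R\<close> draw conclusions that hold for every such family of
  vectors, so an admissible configuration yields \<open>R(G)\<close> orthonormal vectors and is irreducible.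
  An explicit admissible configuration with six two-edges gives the lower bound 19.

  For the upper bound, counting pairs of columns shows that 13 one-edges in the \<open>7 \<times> 4\<close> grid form, up
  to relabelling, a single configuration: six rows realise the six pairs of columns, and the seventh
  row has one cell.  The remaining 15 cells admit at most seven two-edges, and if there are seven, then
  some of the displayed squares can be replaced by fewer.  Indeed, a case distinction on the partners
  of suitable cells always ends with one of 85 patterns of two-edges (up to permutations of the last
  three columns), of three kinds: the cells involved can be regrouped with signs into fewer squares;
  or the products of the displayed forms satisfy a nontrivial linear relation, so that the Gram matrix
  can be moved along a line to the boundary of the positive semidefinite cone, where a square is lost;
  or the two-edges form a path between two columns (or two rows), and the subform on these two lines
  has a shorter representation with irrational coefficients.
\<close>


subsection \<open>Rank reduction for sums of squares\<close>

text \<open>The lower bound has to hold against every representation, the upper bound against every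
  configuration with 20 squares. Seven two-edges can be placed on the 15 free cells in 15 * 13 * 11
  * 9 * 7 * 5 * 3 = 2027025 ways. What keeps this checkable is locality: squares outside a pattern
  are kept unchanged, so a few two-edges and some one-edges already refute every placement
  containing them. Only the six permutations of the last three columns are available as symmetries,
  because the cell of the seventh row singles out the first column. The three kinds of patterns
  differ in what can be evaluated. Regroupings and relations have integer coefficients, so
  collecting monomials verifies them. A relation moreover hides its shorter representation behind an
  extremal value obtained by compactness, so no algebraic numbers have to be written down. The
  chains need \<open>sqrt 2\<close> and the golden ratio in an explicit form; they are therefore
  proved by hand, once for each of the three lengths that occur.\<close>

definition quad :: "'a set \<Rightarrow> ('a \<Rightarrow> 'a \<Rightarrow> real) \<Rightarrow> ('a \<Rightarrow> real) \<Rightarrow> real" where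
  "quad A M v = (\<Sum>i\<in>A. \<Sum>j\<in>A. M i j * v i * v j)"

lemma quad_insert:
  assumes "finite A" "a \<notin> A" "\<And>i j. M i j = M j i"
  shows "quad (insert a A) M v = M a a * (v a)\<^sup>2 + 2 * v a * (\<Sum>i\<in>A. M a i * v i) + quad A M v"
proof -
  have "quad (insert a A) M v = M a a * v a * v a + (\<Sum>j\<in>A. M a j * v a * v j) + (\<Sum>i\<in>A. M i a * v i * v a) + quad A M v"
    using assms(1,2) by (simp add: quad_def sum.distrib)
  moreover have "(\<Sum>j\<in>A. M a j * v a * v j) = v a * (\<Sum>i\<in>A. M a i * v i)"
    by (simp add: sum_distrib_left mult_ac)
  moreover have "(\<Sum>i\<in>A. M i a * v i * v a) = v a * (\<Sum>i\<in>A. M a i * v i)"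
    using assms(3)[of _ a] by (simp add: sum_distrib_left mult_ac)
  ultimately show ?thesis by (simp add: power2_eq_square)
qed

lemma quad_cong: "(\<And>i. i \<in> A \<Longrightarrow> v i = w i) \<Longrightarrow> quad A M v = quad A M w"
  unfolding quad_def by (intro sum.cong) auto

text \<open>Used for a zero diagonal entry of a positive semidefinite matrix: the form is then
  affine in that variable, which forces the whole row to vanish.\<close>

lemma linear_bounded_below_imp_0:
  fixes b c :: real
  assumes "\<And>t. 0 \<le> 2 * t * b + c"
  shows "b = 0"
proof (rule ccontr)
  assume "b \<noteq> 0"
  with assms[of "- (c + 1) / (2 * b)"] show False by (simp add: field_simps)
qed

text \<open>Completing the square in one variable splits off one square and leaves a positive
  semidefinite form in the remaining variables.\<close>

lemma psd_sum_of_squares: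
  assumes "finite A" "\<And>i j. M i j = M j i" "\<And>v. 0 \<le> quad A M v"
  shows "\<exists>C :: nat \<Rightarrow> 'a \<Rightarrow> real. \<forall>v. quad A M v = (\<Sum>k<card A. (\<Sum>i\<in>A. C k i * v i)\<^sup>2)"
  using assms
proof (induction A arbitrary: M rule: finite_induct)
  case empty
  then show ?case by (simp add: quad_def)
next
  case (insert a A)
  define b where "b v = (\<Sum>i\<in>A. M a i * v i)" for v
  \<comment> \<open>The Schur complement of the entry \<open>M a a\<close>. Since division by 0
    gives 0, it is \<open>M\<close> itself if \<open>M a a = 0\<close>, and \<open>b\<close> is then
    0 by positivity, so one formula serves both cases.\<close>
  define N where "N i j = M i j - M a i * M a j / M a a" for i j
  have sym: "N i j = N j i" for i j
    using insert.prems(1)[of i j] by (simp add: N_def)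
  have ins: "quad (insert a A) M v = M a a * (v a)\<^sup>2 + 2 * v a * b v + quad A M v" for v
    unfolding b_def by (rule quad_insert) (use insert in auto)
  have upd: "quad (insert a A) M (v(a := t)) = M a a * t\<^sup>2 + 2 * t * b v + quad A M v" for v t
  proof -
    have "quad A M (v(a := t)) = quad A M v" "b (v(a := t)) = b v"
      using insert.hyps by (auto simp: b_def intro!: quad_cong sum.cong)
    then show ?thesis by (simp add: ins)
  qed
  have N: "quad A N v = quad A M v - (b v)\<^sup>2 / M a a" for v
  proof -
    have "quad A N v = quad A M v - (\<Sum>i\<in>A. \<Sum>j\<in>A. (M a i * v i) * (M a j * v j) / M a a)"
      by (simp add: quad_def N_def algebra_simps sum_subtractf)
    also have "(\<Sum>i\<in>A. \<Sum>j\<in>A. (M a i * v i) * (M a j * v j) / M a a) = b v * b v / M a a"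
      by (simp add: b_def sum_product sum_divide_distrib)
    finally show ?thesis by (simp add: power2_eq_square)
  qed
  have Maa: "M a a \<ge> 0"
  proof -
    have "quad (insert a A) M ((\<lambda>_. 0)(a := 1)) = M a a"
      unfolding upd by (simp add: b_def quad_def)
    then show ?thesis using insert.prems(2) by metis
  qed
  have b0: "b v = 0" if "M a a = 0" for v
  proof (rule linear_bounded_below_imp_0[where c = "quad A M v"])
    show "0 \<le> 2 * t * b v + quad A M v" for t
      using insert.prems(2)[of "v(a := t)"] unfolding upd that by simp
  qed
  have "0 \<le> quad A N v" for v
  proof (cases "M a a = 0")
    case True
    then show ?thesis using insert.prems(2)[of "v(a := 0)"] unfolding N upd by simp
  next
    case False
    \<comment> \<open>This value of the variable \<open>a\<close> minimises the form, and the
      minimum is the Schur complement.\<close>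
    then have "quad (insert a A) M (v(a := - b v / M a a)) = quad A N v"
      unfolding upd N by (simp add: field_simps power2_eq_square)
    then show ?thesis using insert.prems(2) by metis
  qed
  from insert.IH[OF sym this] obtain C :: "nat \<Rightarrow> 'a \<Rightarrow> real"
    where C: "quad A N v = (\<Sum>k<card A. (\<Sum>i\<in>A. C k i * v i)\<^sup>2)" for v by blast
  \<comment> \<open>The last index carries the completed square; if \<open>M a a = 0\<close>, its
    coefficients are 0 by the convention for division.\<close>
  define D where "D k i = (if k < card A then if i = a then 0 else C k i else M a i / sqrt (M a a))" for k i
  have "quad (insert a A) M v = (\<Sum>k<card (insert a A). (\<Sum>i\<in>insert a A. D k i * v i)\<^sup>2)" for v
  proof -
    have 1: "(\<Sum>i\<in>insert a A. D k i * v i) = (\<Sum>i\<in>A. C k i * v i)" if "k < card A" for k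
      using insert.hyps that by (auto simp: D_def intro!: sum.cong)
    have 2: "(\<Sum>i\<in>insert a A. D (card A) i * v i) = (M a a * v a + b v) / sqrt (M a a)"
      using insert.hyps by (simp add: D_def b_def sum_divide_distrib add_divide_distrib)
    have "(\<Sum>k<card A. (\<Sum>i\<in>insert a A. D k i * v i)\<^sup>2) = quad A N v"
      unfolding C by (rule sum.cong) (simp_all only: lessThan_iff 1)
    moreover have "card (insert a A) = Suc (card A)"
      using insert.hyps by simp
    ultimately have "(\<Sum>k<card (insert a A). (\<Sum>i\<in>insert a A. D k i * v i)\<^sup>2) = quad A N v + (M a a * v a + b v)\<^sup>2 / M a a"
      using Maa by (simp only: sum.lessThan_Suc 2 power_divide real_sqrt_pow2)
    also have "\<dots> = quad (insert a A) M v"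
    proof (cases "M a a = 0")
      case True
      then show ?thesis using b0 by (simp add: N ins)
    next
      case False
      then show ?thesis by (simp add: N ins field_simps power2_eq_square)
    qed
    finally show ?thesis by simp
  qed
  then show ?case by blast
qed

lemma quad_attains_max:
  assumes "finite A" "A \<noteq> {}"
  obtains u where "(\<Sum>i\<in>A. (u i)\<^sup>2) = 1" "\<And>v. (\<Sum>i\<in>A. (v i)\<^sup>2) = 1 \<Longrightarrow> quad A S v \<le> quad A S u"
proof -
  \<comment> \<open>The variables are functions on a whole type. Entries outside \<open>A\<close>
    are merely confined to [-1,1], which makes \<open>K\<close> compact by Tychonoff's
    theorem.\<close>
  define K :: "('a \<Rightarrow> real) set" where "K = (\<Pi>\<^sub>E i\<in>UNIV. {-1..1}) \<inter> {v. (\<Sum>i\<in>A. (v i)\<^sup>2) = 1}"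
  have "compactin (product_topology (\<lambda>i. euclidean) UNIV) (\<Pi>\<^sub>E i\<in>(UNIV :: 'a set). {-1..1::real})"
    by (simp add: compactin_PiE)
  then have "compact (\<Pi>\<^sub>E i\<in>(UNIV :: 'a set). {-1..1::real})"
    by (simp add: euclidean_product_topology)
  moreover have "closed {v :: 'a \<Rightarrow> real. (\<Sum>i\<in>A. (v i)\<^sup>2) = 1}"
    by (intro closed_Collect_eq continuous_intros continuous_on_product_coordinates)
  ultimately have "compact K" unfolding K_def by (rule compact_Int_closed)
  obtain a where "a \<in> A" using assms by auto
  have "(\<lambda>i. if i = a then 1 else 0) \<in> K"
    using \<open>a \<in> A\<close> assms by (simp add: K_def PiE_iff if_distrib[of "\<lambda>x. x\<^sup>2"] sum.delta cong: if_cong)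
  then have "K \<noteq> {}" by blast
  have "continuous_on K (quad A S)"
    unfolding quad_def
    by (intro continuous_intros continuous_on_subset[OF continuous_on_product_coordinates] subset_UNIV)
  from continuous_attains_sup[OF \<open>compact K\<close> \<open>K \<noteq> {}\<close> this]
  obtain u where u: "u \<in> K" "\<And>v. v \<in> K \<Longrightarrow> quad A S v \<le> quad A S u" by blast
  show ?thesis
  proof (rule that)
    show "(\<Sum>i\<in>A. (u i)\<^sup>2) = 1" using u by (simp add: K_def)
    fix v :: "'a \<Rightarrow> real" assume v: "(\<Sum>i\<in>A. (v i)\<^sup>2) = 1"
    \<comment> \<open>Outside \<open>A\<close> the entries of \<open>v\<close> may leave [-1,1];
      setting them to 0 changes neither the norm over \<open>A\<close> nor the form.\<close>
    define w where "w i = (if i \<in> A then v i else 0)" for i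
    have "(v i)\<^sup>2 \<le> 1" if "i \<in> A" for i
      using member_le_sum[of i A "\<lambda>i. (v i)\<^sup>2"] that assms v by simp
    then have "w \<in> K"
      using v by (auto simp: K_def w_def abs_le_iff abs_square_le_1 cong: sum.cong)
    then show "quad A S v \<le> quad A S u"
      using u(2) quad_cong[of A v w S] by (simp add: w_def)
  qed
qed

lemma quad_scale: "quad A S (\<lambda>i. c * v i) = c\<^sup>2 * quad A S v"
  by (simp add: quad_def sum_distrib_left power2_eq_square mult_ac)

text \<open>If \<open>l\<close> is the largest value of the form \<open>S\<close> on the unit sphere, then \<open>|v|\<^sup>2 - S(v) / l\<close> is positive
  semidefinite and singular, and it agrees with \<open>|v|\<^sup>2\<close> on the zero set of \<open>S\<close>.\<close>

theorem sum_of_squares_rank_drop: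
  fixes S :: "'a \<Rightarrow> 'a \<Rightarrow> real"
  assumes fin: "finite A" and sym: "\<And>i j. S i j = S j i" and nz: "quad A S w \<noteq> 0"
  shows "\<exists>C :: nat \<Rightarrow> 'a \<Rightarrow> real. \<forall>v. quad A S v = 0 \<longrightarrow>
           (\<Sum>i\<in>A. (v i)\<^sup>2) = (\<Sum>k<card A - 1. (\<Sum>i\<in>A. C k i * v i)\<^sup>2)"
proof -
  \<comment> \<open>The sign is chosen such that \<open>T\<close> is positive at \<open>w\<close>;
    its maximum on the sphere is then positive and may be divided by.\<close>
  define T where "T i j = sgn (quad A S w) * S i j" for i j
  have T: "quad A T v = sgn (quad A S w) * quad A S v" for v
    by (simp add: T_def quad_def sum_distrib_left mult.assoc)
  have Tw: "quad A T w > 0"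
    using nz by (simp add: T sgn_if)
  have "A \<noteq> {}"
    using nz by (auto simp: quad_def)
  then obtain u where u1: "(\<Sum>i\<in>A. (u i)\<^sup>2) = 1"
    and umax: "\<And>v. (\<Sum>i\<in>A. (v i)\<^sup>2) = 1 \<Longrightarrow> quad A T v \<le> quad A T u"
    using quad_attains_max[OF fin] by blast
  have bound: "quad A T v \<le> quad A T u * (\<Sum>i\<in>A. (v i)\<^sup>2)" for v
  proof (cases "(\<Sum>i\<in>A. (v i)\<^sup>2) = 0")
    case True
    then have "\<forall>i\<in>A. v i = 0"
      using fin by (simp add: sum_nonneg_eq_0_iff)
    then show ?thesis using quad_cong[of A v "\<lambda>_. 0" T] True by (simp add: quad_def)
  next
    case False
    define s where "s = (\<Sum>i\<in>A. (v i)\<^sup>2)"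
    have s: "s > 0" using False by (simp add: s_def sum_nonneg order_less_le)
    have "(\<Sum>i\<in>A. (1 / sqrt s * v i)\<^sup>2) = (\<Sum>i\<in>A. (v i)\<^sup>2) / s"
      using s by (simp add: power_mult_distrib power_divide sum_divide_distrib)
    then have "(\<Sum>i\<in>A. (1 / sqrt s * v i)\<^sup>2) = 1"
      using s by (simp add: s_def[symmetric])
    from umax[OF this] have "quad A T v / s \<le> quad A T u"
      using s by (simp only: quad_scale) (simp add: power_divide)
    then show ?thesis using s by (simp add: field_simps s_def[symmetric])
  qed
  define l where "l = quad A T u"
  have "0 < l * (\<Sum>i\<in>A. (w i)\<^sup>2)"
    using Tw bound[of w] by (simp add: l_def)
  moreover have "0 \<le> (\<Sum>i\<in>A. (w i)\<^sup>2)" by (simp add: sum_nonneg)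
  ultimately have l: "l > 0" by (simp add: zero_less_mult_iff)
  define M where "M i j = (if i = j then 1 else 0) - T i j / l" for i j
  have Msym: "M i j = M j i" for i j
    using sym[of i j] by (simp add: M_def T_def)
  have M: "quad A M v = (\<Sum>i\<in>A. (v i)\<^sup>2) - quad A T v / l" for v
  proof -
    have "quad A M v = (\<Sum>i\<in>A. \<Sum>j\<in>A. (if i = j then v i * v j else 0)) - (\<Sum>i\<in>A. \<Sum>j\<in>A. T i j * v i * v j / l)"
      unfolding quad_def sum_subtractf[symmetric] by (intro sum.cong refl) (auto simp: M_def algebra_simps)
    also have "(\<Sum>i\<in>A. \<Sum>j\<in>A. (if i = j then v i * v j else 0)) = (\<Sum>i\<in>A. (v i)\<^sup>2)"
      using fin by (simp add: sum.delta power2_eq_square)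
    finally show ?thesis by (simp add: quad_def sum_divide_distrib)
  qed
  have psd: "0 \<le> quad A M v" for v
    using bound[of v] l by (simp add: M l_def[symmetric] field_simps)
  have Mu: "quad A M u = 0"
    using l u1 by (simp add: M l_def)
  define mu where "mu i = (\<Sum>j\<in>A. M i j * u j)" for i
  have polar: "quad A M (\<lambda>i. v i + t * z i) =
      quad A M v + 2 * t * (\<Sum>i\<in>A. z i * (\<Sum>j\<in>A. M i j * v j)) + t\<^sup>2 * quad A M z" for v z t
  proof -
    have "quad A M (\<lambda>i. v i + t * z i) = quad A M v + t * (\<Sum>i\<in>A. \<Sum>j\<in>A. M i j * z i * v j)
        + t * (\<Sum>i\<in>A. \<Sum>j\<in>A. M i j * v i * z j) + t\<^sup>2 * quad A M z"
      by (simp add: quad_def algebra_simps sum.distrib sum_distrib_left power2_eq_square)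
    moreover have "(\<Sum>i\<in>A. z i * (\<Sum>j\<in>A. M i j * v j)) = (\<Sum>i\<in>A. \<Sum>j\<in>A. M i j * z i * v j)"
      by (simp add: sum_distrib_left mult_ac)
    moreover have "(\<Sum>i\<in>A. \<Sum>j\<in>A. M i j * v i * z j) = (\<Sum>i\<in>A. \<Sum>j\<in>A. M i j * z i * v j)"
      by (subst sum.swap) (simp add: Msym mult_ac)
    ultimately show ?thesis by simp
  qed
  have mu0: "mu i = 0" if "i \<in> A" for i
  proof -
    define e where "e j = (if j = i then 1 else 0 :: real)" for j
    have e: "(\<Sum>j\<in>A. e j * mu j) = mu i"
      using that fin by (simp add: e_def if_distrib[of "\<lambda>x. x * _"] sum.delta cong: if_cong)
    have p: "quad A M (\<lambda>i. u i + t * e i) = 2 * t * mu i + t\<^sup>2 * quad A M e" for t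
      using polar[of u t e] unfolding Mu mu_def[symmetric] e by simp
    show ?thesis
    proof (rule ccontr)
      assume "mu i \<noteq> 0"
      \<comment> \<open>At the minimum \<open>u\<close> of a nonnegative form the gradient vanishes:
        otherwise this step against it reaches the value
        \<open>- t\<^sup>2 * (quad A M e + 2)\<close>, which is negative.\<close>
      define t where "t = - mu i / (quad A M e + 1)"
      have q: "quad A M e \<ge> 0" by (rule psd)
      have t: "t * (quad A M e + 1) = - mu i" using q by (simp add: t_def)
      have "t \<noteq> 0" using q \<open>mu i \<noteq> 0\<close> by (simp add: t_def)
      have "2 * t * mu i + t\<^sup>2 * quad A M e = - t\<^sup>2 * (quad A M e + 2)"
        using t by algebra
      then have "2 * t * mu i + t\<^sup>2 * quad A M e < 0"
        using q \<open>t \<noteq> 0\<close> by (simp add: mult_neg_pos)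
      then show False using psd[of "\<lambda>i. u i + t * e i"] by (simp only: p)
    qed
  qed
  have shift: "quad A M (\<lambda>i. v i + t * u i) = quad A M v" for v t
  proof -
    have "(\<Sum>i\<in>A. u i * (\<Sum>j\<in>A. M i j * v j)) = (\<Sum>j\<in>A. v j * mu j)"
      unfolding mu_def sum_distrib_left by (subst sum.swap) (simp add: Msym mult_ac)
    then show ?thesis using polar[of v t u] by (simp add: mu0 Mu)
  qed
  obtain a where a: "a \<in> A" "u a \<noteq> 0"
    using u1 by (metis (no_types, lifting) power_zero_numeral sum.neutral zero_neq_one)
  define B where "B = A - {a}"
  have AB: "A = insert a B" "a \<notin> B" "finite B" using a fin by (auto simp: B_def)
  \<comment> \<open>As \<open>u\<close> lies in the kernel of \<open>M\<close>, every
    \<open>v\<close> can be shifted along \<open>u\<close> until its coordinate \<open>a\<close> is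
    0. The form thus depends on one coordinate fewer.\<close>
  have drop: "quad A M v = quad B M (\<lambda>i. v i - v a / u a * u i)" for v
  proof -
    have "quad A M v = quad A M (\<lambda>i. v i - v a / u a * u i)"
      using shift[of v "- v a / u a"] by (simp add: algebra_simps)
    also have "\<dots> = quad B M (\<lambda>i. v i - v a / u a * u i)"
      using a by (subst AB(1), subst quad_insert[OF AB(3,2) Msym]) simp
    finally show ?thesis .
  qed
  have "0 \<le> quad B M v" for v
  proof -
    have "quad B M v = quad B M (v(a := 0))"
      by (rule quad_cong) (use AB(2) in auto)
    also have "\<dots> = quad A M (v(a := 0))"
      by (subst AB(1), subst quad_insert[OF AB(3,2) Msym]) simp
    finally have "quad B M v = quad A M (v(a := 0))" .
    then show ?thesis using psd by simp
  qed
  from psd_sum_of_squares[OF AB(3) Msym this]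
  obtain C :: "nat \<Rightarrow> 'a \<Rightarrow> real"
    where C: "\<And>v. quad B M v = (\<Sum>k<card B. (\<Sum>i\<in>B. C k i * v i)\<^sup>2)" by blast
  define D where "D k i = (if i = a then - (\<Sum>i\<in>B. C k i * u i) / u a else C k i)" for k i
  have D: "(\<Sum>i\<in>A. D k i * v i) = (\<Sum>i\<in>B. C k i * (v i - v a / u a * u i))" for k v
  proof -
    have "(\<Sum>i\<in>A. D k i * v i) = - (\<Sum>i\<in>B. C k i * u i) / u a * v a + (\<Sum>i\<in>B. C k i * v i)"
      using AB by (auto simp: D_def intro!: sum.cong)
    also have "\<dots> = (\<Sum>i\<in>B. C k i * (v i - v a / u a * u i))"
      by (simp add: right_diff_distrib sum_subtractf sum_distrib_left sum_divide_distrib sum_negf mult_ac)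
    finally show ?thesis .
  qed
  show ?thesis
  proof (intro exI allI impI)
    fix v :: "'a \<Rightarrow> real" assume "quad A S v = 0"
    then have "(\<Sum>i\<in>A. (v i)\<^sup>2) = quad A M v" by (simp add: M T)
    then show "(\<Sum>i\<in>A. (v i)\<^sup>2) = (\<Sum>k<card A - 1. (\<Sum>i\<in>A. D k i * v i)\<^sup>2)"
      unfolding D drop C using AB by simp
  qed
qed

subsection \<open>Sums of squares of bilinear forms\<close>

definition edge_form :: "cell set \<Rightarrow> form" where
  "edge_form e = (\<lambda>x y. \<Sum>(i, j)\<in>e. x i * y j)"

lemma finite_cells [simp]: "finite (cells m n)"
  by (simp add: cells_def)

lemma bilinear_form_0: "bilinear_form m n (\<lambda>x y. 0)"
  unfolding bilinear_form_def by (rule exI[of _ "\<lambda>_. 0"]) (simp add: case_prod_beta)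

lemma bilinear_form_add:
  assumes "bilinear_form m n B" "bilinear_form m n C"
  shows "bilinear_form m n (\<lambda>x y. B x y + C x y)"
proof -
  from assms obtain b c where
    "B = (\<lambda>x y. \<Sum>(i, j)\<in>cells m n. b (i, j) * (x i * y j))"
    "C = (\<lambda>x y. \<Sum>(i, j)\<in>cells m n. c (i, j) * (x i * y j))"
    unfolding bilinear_form_def by blast
  then show ?thesis unfolding bilinear_form_def
    by (intro exI[of _ "\<lambda>p. b p + c p"]) (simp add: case_prod_beta distrib_right sum.distrib)
qed

lemma bilinear_form_scale:
  assumes "bilinear_form m n B"
  shows "bilinear_form m n (\<lambda>x y. a * B x y)"
proof -
  from assms obtain b where "B = (\<lambda>x y. \<Sum>(i, j)\<in>cells m n. b (i, j) * (x i * y j))"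
    unfolding bilinear_form_def by blast
  then show ?thesis unfolding bilinear_form_def
    by (intro exI[of _ "\<lambda>p. a * b p"]) (simp add: case_prod_beta sum_distrib_left mult.assoc)
qed

lemma bilinear_form_cell:
  assumes "(i, j) \<in> cells m n"
  shows "bilinear_form m n (\<lambda>x y. x i * y j)"
proof -
  have "(\<Sum>(k, l)\<in>cells m n. (if (k, l) = (i, j) then 1 else 0) * (x k * y l)) = x i * y j"
    for x y :: "nat \<Rightarrow> real"
  proof -
    have "(\<lambda>(k, l). (if (k, l) = (i, j) then 1 else 0) * (x k * y l)) = (\<lambda>p. if p = (i, j) then x i * y j else 0)"
      by auto
    then show ?thesis using assms by simp
  qed
  then show ?thesis unfolding bilinear_form_def
    by (intro exI[of _ "\<lambda>p. if p = (i, j) then 1 else 0"]) simp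
qed

lemma bilinear_form_sum:
  assumes "\<And>a. a \<in> A \<Longrightarrow> bilinear_form m n (B a)"
  shows "bilinear_form m n (\<lambda>x y. \<Sum>a\<in>A. B a x y)"
  using assms
proof (induction A rule: infinite_finite_induct)
  case (insert a A)
  then show ?case by (simp add: bilinear_form_add)
qed (simp_all add: bilinear_form_0)

lemma bilinear_edge_form:
  assumes "e \<subseteq> cells m n"
  shows "bilinear_form m n (edge_form e)"
  unfolding edge_form_def case_prod_beta
  by (rule bilinear_form_sum) (use assms in \<open>auto intro!: bilinear_form_cell\<close>)

lemma bilinear_form_permute:
  assumes B: "bilinear_form m n B" and r: "r ` {1..m} \<subseteq> {1..m}" and s: "s ` {1..n} \<subseteq> {1..n}"
  shows "bilinear_form m n (\<lambda>x y. B (x \<circ> r) (y \<circ> s))"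
proof -
  obtain b where b: "B = (\<lambda>x y. \<Sum>(i, j)\<in>cells m n. b (i, j) * (x i * y j))"
    using B unfolding bilinear_form_def by blast
  show ?thesis
    unfolding b case_prod_beta o_def
    by (intro bilinear_form_sum bilinear_form_scale bilinear_form_cell)
       (use r s in \<open>auto simp: cells_def\<close>)
qed

lemma sos_representable_sum:
  assumes "finite A" "\<And>a. a \<in> A \<Longrightarrow> bilinear_form m n (B a)" "P = (\<lambda>x y. \<Sum>a\<in>A. (B a x y)\<^sup>2)"
  shows "sos_representable m n P (card A)"
proof -
  obtain h where h: "bij_betw h {..<card A} A"
    using ex_bij_betw_nat_finite[OF assms(1)] by (auto simp: atLeast0LessThan)
  have "(\<Sum>k<card A. (B (h k) x y)\<^sup>2) = (\<Sum>a\<in>A. (B a x y)\<^sup>2)" for x y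
    using sum.reindex_bij_betw[OF h, of "\<lambda>a. (B a x y)\<^sup>2"] .
  then show ?thesis
    unfolding sos_representable_def using assms h
    by (intro exI[of _ "\<lambda>k. B (h k)"]) (auto dest: bij_betwE)
qed

lemma sos_representable_mono:
  assumes "sos_representable m n P r" "r \<le> s"
  shows "sos_representable m n P s"
proof -
  obtain B where B: "\<forall>k<r. bilinear_form m n (B k)" "P = (\<lambda>x y. \<Sum>k<r. (B k x y)\<^sup>2)"
    using assms(1) unfolding sos_representable_def by blast
  have "(\<Sum>k<s. (if k < r then B k x y else 0)\<^sup>2) = (\<Sum>k<r. (B k x y)\<^sup>2)" for x y
    using assms(2) by (intro sum.mono_neutral_cong_right) auto
  then show ?thesis unfolding sos_representable_def
    using B by (intro exI[of _ "\<lambda>k. if k < r then B k else (\<lambda>x y. 0)"])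
      (auto simp: bilinear_form_0 if_distrib[of "\<lambda>f. f _ _"])
qed

lemma sos_representable_add:
  assumes "sos_representable m n P r" "sos_representable m n Q s"
  shows "sos_representable m n (\<lambda>x y. P x y + Q x y) (r + s)"
proof -
  obtain B C where B: "\<forall>k<r. bilinear_form m n (B k)" "P = (\<lambda>x y. \<Sum>k<r. (B k x y)\<^sup>2)"
    and C: "\<forall>k<s. bilinear_form m n (C k)" "Q = (\<lambda>x y. \<Sum>k<s. (C k x y)\<^sup>2)"
    using assms unfolding sos_representable_def by blast
  define D where "D k = (if k < r then B k else C (k - r))" for k
  have "(\<Sum>k<r + s. (D k x y)\<^sup>2) = (\<Sum>k<r. (B k x y)\<^sup>2) + (\<Sum>k<s. (C k x y)\<^sup>2)" for x y
    by (induction s) (simp_all add: D_def)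
  moreover have "\<forall>k<r + s. bilinear_form m n (D k)"
    using B C by (auto simp: D_def)
  ultimately show ?thesis unfolding sos_representable_def
    using B C by (intro exI[of _ D]) auto
qed

lemma sos_representable_permute:
  assumes "sos_representable m n P k" and r: "r ` {1..m} \<subseteq> {1..m}" and s: "s ` {1..n} \<subseteq> {1..n}"
  shows "sos_representable m n (\<lambda>x y. P (x \<circ> r) (y \<circ> s)) k"
proof -
  obtain B where B: "\<forall>i<k. bilinear_form m n (B i)" "P = (\<lambda>x y. \<Sum>i<k. (B i x y)\<^sup>2)"
    using assms(1) unfolding sos_representable_def by blast
  show ?thesis unfolding sos_representable_def B(2)
    using B(1) bilinear_form_permute[OF _ r s]
    by (intro exI[of _ "\<lambda>i x y. B i (x \<circ> r) (y \<circ> s)"]) auto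
qed

lemma SOS_le: "sos_representable m n P r \<Longrightarrow> SOS m n P \<le> r"
  unfolding SOS_def by (rule Least_le)

subsection \<open>Configurations\<close>

lemma finite_configuration:
  assumes "is_configuration m n G"
  shows "finite (one_edges G)" "finite (two_edges G)" "finite (selected_edges G)"
proof -
  show 1: "finite (one_edges G)"
    using assms finite_subset[OF _ finite_cells] by (auto simp: is_configuration_def)
  have "two_edges G \<subseteq> Pow (cells m n)"
    using assms by (auto simp: is_configuration_def)
  then show 2: "finite (two_edges G)"
    using finite_subset finite_Pow_iff finite_cells by metis
  show "finite (selected_edges G)"
    using 1 2 by (simp add: selected_edges_def)
qed

lemma ones_twos_disjoint:
  assumes "is_configuration m n G"
  shows "(\<lambda>p. {p}) ` one_edges G \<inter> two_edges G = {}"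
  using assms by (auto simp: is_configuration_def)

lemma num_squares_eq_card:
  assumes "is_configuration m n G"
  shows "num_squares G = card (selected_edges G)"
  using ones_twos_disjoint[OF assms] finite_configuration[OF assms]
  by (simp add: num_squares_def selected_edges_def card_Un_disjoint card_image)

lemma config_form_eq_sum:
  assumes "is_configuration m n G"
  shows "config_form G = (\<lambda>x y. \<Sum>e\<in>selected_edges G. (edge_form e x y)\<^sup>2)"
proof (intro ext)
  fix x y
  have "(\<Sum>e\<in>selected_edges G. (edge_form e x y)\<^sup>2) =
      (\<Sum>e\<in>(\<lambda>p. {p}) ` one_edges G. (edge_form e x y)\<^sup>2) + (\<Sum>e\<in>two_edges G. (edge_form e x y)\<^sup>2)"
    unfolding selected_edges_def
    using ones_twos_disjoint[OF assms] finite_configuration[OF assms] by (intro sum.union_disjoint) auto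
  also have "(\<Sum>e\<in>(\<lambda>p. {p}) ` one_edges G. (edge_form e x y)\<^sup>2) = (\<Sum>(i, j)\<in>one_edges G. (x i * y j)\<^sup>2)"
    by (subst sum.reindex) (auto simp: edge_form_def case_prod_beta)
  finally show "config_form G x y = (\<Sum>e\<in>selected_edges G. (edge_form e x y)\<^sup>2)"
    by (simp add: config_form_def edge_form_def)
qed

lemma selected_edges_subset:
  assumes "is_configuration m n G" "e \<in> selected_edges G"
  shows "e \<subseteq> cells m n"
  using assms by (auto simp: is_configuration_def selected_edges_def)

lemma sos_representable_config:
  assumes "is_configuration m n G"
  shows "sos_representable m n (config_form G) (num_squares G)"
  unfolding num_squares_eq_card[OF assms] config_form_eq_sum[OF assms]
  by (rule sos_representable_sum)
     (use assms finite_configuration selected_edges_subset bilinear_edge_form in auto)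

text \<open>The squares outside \<open>H\<close> are kept, so a saving in any part of the
  configuration is a saving for the whole form.\<close>

lemma sos_representable_replace:
  assumes G: "is_configuration m n G" and H: "H \<subseteq> selected_edges G"
    and sos: "sos_representable m n (\<lambda>x y. \<Sum>e\<in>H. (edge_form e x y)\<^sup>2) r" and less: "r < card H"
  shows "sos_representable m n (config_form G) (num_squares G - 1)"
proof -
  let ?S = "selected_edges G"
  have fin: "finite ?S" "finite H" using finite_configuration[OF G] H finite_subset by auto
  have "sos_representable m n (\<lambda>x y. \<Sum>e\<in>?S - H. (edge_form e x y)\<^sup>2) (card (?S - H))"
    by (rule sos_representable_sum) (use fin G selected_edges_subset bilinear_edge_form in auto)
  from sos_representable_add[OF sos this]
  have "sos_representable m n (config_form G) (r + card (?S - H))"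
    unfolding config_form_eq_sum[OF G] sum.subset_diff[OF H fin(1)] by (simp add: add.commute)
  moreover have "r + card (?S - H) \<le> num_squares G - 1"
    using less card_Diff_subset[OF fin(2) H] card_mono[OF fin(1) H] by (simp add: num_squares_eq_card[OF G])
  ultimately show ?thesis by (rule sos_representable_mono)
qed

text \<open>The displayed forms always take values in the zero set of \<open>S\<close>, where their
  sum of squares has an expression with one square fewer. The new squares are linear in the
  displayed forms, hence bilinear.\<close>

lemma sos_representable_relation:
  assumes G: "is_configuration m n G"
    and sym: "\<And>e f. S e f = S f e" and nz: "quad (selected_edges G) S w \<noteq> 0"
    and rel: "\<And>x y. quad (selected_edges G) S (\<lambda>e. edge_form e x y) = 0"
  shows "sos_representable m n (config_form G) (num_squares G - 1)"
proof -
  let ?A = "selected_edges G"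
  have fin: "finite ?A" using finite_configuration[OF G] by simp
  obtain C where C: "quad ?A S v = 0 \<Longrightarrow> (\<Sum>e\<in>?A. (v e)\<^sup>2) = (\<Sum>k<card ?A - 1. (\<Sum>e\<in>?A. C k e * v e)\<^sup>2)" for v
    using sum_of_squares_rank_drop[OF fin sym nz] by blast
  have "bilinear_form m n (\<lambda>x y. \<Sum>e\<in>?A. C k e * edge_form e x y)" for k :: nat
    by (intro bilinear_form_sum bilinear_form_scale bilinear_edge_form) (use G selected_edges_subset in auto)
  then show ?thesis
    unfolding sos_representable_def config_form_eq_sum[OF G] num_squares_eq_card[OF G] C[OF rel]
    by (intro exI[of _ "\<lambda>k x y. \<Sum>e\<in>selected_edges G. C k e * edge_form e x y"]) simp
qed

subsection \<open>Gram vectors\<close>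

text \<open>The \<open>k\<close>-th coordinate of the vector attached to the cell \<open>p\<close> is \<open>c k p\<close>.\<close>

definition gram :: "(nat \<Rightarrow> cell \<Rightarrow> real) \<Rightarrow> nat \<Rightarrow> cell \<Rightarrow> cell \<Rightarrow> real" where
  "gram c r p q = (\<Sum>k<r. c k p * c k q)"

lemma gram_commute: "gram c r p q = gram c r q p"
  by (simp add: gram_def mult.commute)

definition unit_vec :: "nat \<Rightarrow> nat \<Rightarrow> real" where
  "unit_vec i = (\<lambda>k. if k = i then 1 else 0)"

definition combo :: "(nat \<Rightarrow> cell \<Rightarrow> real) \<Rightarrow> nat \<Rightarrow> nat \<Rightarrow> nat \<Rightarrow> form" where
  "combo c m n k = (\<lambda>x y. \<Sum>(i, j)\<in>cells m n. c k (i, j) * (x i * y j))"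

section \<open>Comparing coefficients of two representations\<close>

lemma combo_two_by_two:
  assumes "i \<in> {1..m}" "k \<in> {1..m}" "j \<in> {1..n}" "l \<in> {1..n}" "i \<noteq> k" "j \<noteq> l"
  shows "combo c m n t (\<lambda>a. s * unit_vec i a + s' * unit_vec k a) (\<lambda>b. u * unit_vec j b + u' * unit_vec l b) =
     s * u * c t (i, j) + s * u' * c t (i, l) + s' * u * c t (k, j) + s' * u' * c t (k, l)"
proof -
  let ?f = "\<lambda>(a, b). c t (a, b) * ((s * unit_vec i a + s' * unit_vec k a) * (u * unit_vec j b + u' * unit_vec l b))"
  have "sum ?f (cells m n) = sum ?f {(i, j), (i, l), (k, j), (k, l)}"
  proof (rule sum.mono_neutral_right)
    show "\<forall>p\<in>cells m n - {(i, j), (i, l), (k, j), (k, l)}. ?f p = 0"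
    proof
      fix p assume p: "p \<in> cells m n - {(i, j), (i, l), (k, j), (k, l)}"
      obtain a b where ab: "p = (a, b)" by (cases p)
      have "(a \<noteq> i \<and> a \<noteq> k) \<or> (b \<noteq> j \<and> b \<noteq> l)" using p ab by blast
      then show "?f p = 0" unfolding ab by (elim disjE) (simp_all add: unit_vec_def)
    qed
  qed (use assms in \<open>auto simp: cells_def\<close>)
  also have "\<dots> = s * u * c t (i, j) + s * u' * c t (i, l) + s' * u * c t (k, j) + s' * u' * c t (k, l)"
    using assms by (simp add: unit_vec_def)
  finally show ?thesis by (simp add: combo_def)
qed

text \<open>Later \<open>d\<close> belongs to the displayed squares, whose inner products are known.
  With two rows and two columns at hand, every cell can be completed to a rectangle, so evaluation
  on rectangles with suitable weights extracts all coefficients.\<close>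

locale two_representations =
  fixes m n r r' :: nat and c d :: "nat \<Rightarrow> cell \<Rightarrow> real"
  assumes eq: "\<And>x y. (\<Sum>t<r. (combo c m n t x y)\<^sup>2) = (\<Sum>t<r'. (combo d m n t x y)\<^sup>2)"
    and mn: "m \<ge> 2" "n \<ge> 2"
begin

lemma two_by_two:
  assumes "i \<in> {1..m}" "k \<in> {1..m}" "j \<in> {1..n}" "l \<in> {1..n}" "i \<noteq> k" "j \<noteq> l"
  shows "(\<Sum>t<r. (s * u * c t (i, j) + s * u' * c t (i, l) + s' * u * c t (k, j) + s' * u' * c t (k, l))\<^sup>2) =
         (\<Sum>t<r'. (s * u * d t (i, j) + s * u' * d t (i, l) + s' * u * d t (k, j) + s' * u' * d t (k, l))\<^sup>2)"
  using eq[of "\<lambda>a. s * unit_vec i a + s' * unit_vec k a" "\<lambda>b. u * unit_vec j b + u' * unit_vec l b"]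
  by (simp only: combo_two_by_two[OF assms])

lemma other_row: 
  assumes "i \<in> {1..m}" obtains k where "k \<in> {1..m}" "i \<noteq> k"
  using that[of 1] that[of 2] assms mn by (cases "i = 1") auto

lemma other_col: 
  assumes "i \<in> {1..n}" obtains k where "k \<in> {1..n}" "i \<noteq> k"
  using that[of 1] that[of 2] assms mn by (cases "i = 1") auto

lemma gram_diag:
  assumes "p \<in> cells m n"
  shows "gram c r p p = gram d r' p p"
proof -
  obtain i j where p: "p = (i, j)" "i \<in> {1..m}" "j \<in> {1..n}" using assms by (auto simp: cells_def)
  obtain k where k: "k \<in> {1..m}" "i \<noteq> k" using other_row[OF p(2)] .
  obtain l where l: "l \<in> {1..n}" "j \<noteq> l" using other_col[OF p(3)] .
  show ?thesis using two_by_two[OF p(2) k(1) p(3) l(1) k(2) l(2), of 1 1 0 0]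
    by (simp add: gram_def p power2_eq_square)
qed

lemma gram_add_sq: "(\<Sum>t<(s::nat). (b t p + b t q)\<^sup>2) = gram b s p p + gram b s q q + 2 * gram b s p q"
  unfolding gram_def sum_distrib_left sum.distrib[symmetric]
  by (intro sum.cong refl) (simp add: power2_eq_square algebra_simps)

lemma gram_line:
  assumes "p \<in> cells m n" "q \<in> cells m n" "p \<noteq> q" "same_line p q"
  shows "gram c r p q = gram d r' p q"
proof -
  obtain i j k l where pq: "p = (i, j)" "q = (k, l)" by (cases p, cases q)
  have ij: "i \<in> {1..m}" "j \<in> {1..n}" "k \<in> {1..m}" "l \<in> {1..n}" using assms pq by (auto simp: cells_def)
  have "(\<Sum>t<r. (c t p + c t q)\<^sup>2) = (\<Sum>t<r'. (d t p + d t q)\<^sup>2)"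
  proof (cases "i = k")
    case True
    then have "j \<noteq> l" using assms pq by auto
    obtain k' where k: "k' \<in> {1..m}" "i \<noteq> k'" using other_row[OF ij(1)] .
    show ?thesis using two_by_two[OF ij(1) k(1) ij(2,4) k(2) \<open>j \<noteq> l\<close>, of 1 1 1 0] True pq by simp
  next
    case False
    then have "j = l" using assms pq by (auto simp: same_line_def)
    obtain l' where l: "l' \<in> {1..n}" "j \<noteq> l'" using other_col[OF ij(2)] .
    show ?thesis using two_by_two[OF ij(1,3,2) l(1) False l(2), of 1 1 0 1] \<open>j = l\<close> pq by simp
  qed
  then show ?thesis using gram_diag[OF assms(1)] gram_diag[OF assms(2)] by (simp add: gram_add_sq)
qed

text \<open>The products of the monomials on the two diagonals coincide: both are
  \<open>x i * x k * (y j * y l)\<close>. Evaluation at 1 on the whole rectangle therefore sees the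
  sum of the two diagonals; all other terms are settled by \<open>gram_diag\<close> and
  \<open>gram_line\<close>.\<close>

lemma gram_rect:
  assumes "rect_diagonals p q a b" "p \<in> cells m n" "q \<in> cells m n"
  shows "a \<in> cells m n" "b \<in> cells m n" "gram c r p q + gram c r a b = gram d r' p q + gram d r' a b"
proof -
  obtain i k j l where R: "i \<noteq> k" "j \<noteq> l" "p = (i, j)" "q = (k, l)" "{a, b} = {(i, l), (k, j)}"
    using assms(1) by (auto simp: rect_diagonals_def)
  have ij: "i \<in> {1..m}" "j \<in> {1..n}" "k \<in> {1..m}" "l \<in> {1..n}" using assms R by (auto simp: cells_def)
  show "a \<in> cells m n" "b \<in> cells m n" using R ij by (auto simp: cells_def doubleton_eq_iff)
  have ab: "gram e s a b = gram e s (i, l) (k, j)" for e s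
    using R(5) gram_commute by (auto simp: doubleton_eq_iff)
  have exp: "(\<Sum>t<(s::nat). (e t (i, j) + e t (i, l) + e t (k, j) + e t (k, l))\<^sup>2) =
     gram e s (i,j) (i,j) + gram e s (i,l) (i,l) + gram e s (k,j) (k,j) + gram e s (k,l) (k,l) +
     2 * (gram e s (i,j) (i,l) + gram e s (i,j) (k,j) + gram e s (i,l) (k,l) + gram e s (k,j) (k,l)) +
     2 * (gram e s (i,j) (k,l) + gram e s (i,l) (k,j))" for e s
    unfolding gram_def sum_distrib_left sum.distrib[symmetric]
    by (intro sum.cong refl) (simp add: power2_eq_square algebra_simps)
  have C: "(i,j) \<in> cells m n" "(i,l) \<in> cells m n" "(k,j) \<in> cells m n" "(k,l) \<in> cells m n"
    using ij by (auto simp: cells_def)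
  show "gram c r p q + gram c r a b = gram d r' p q + gram d r' a b"
  proof -
    have "gram c r u u = gram d r' u u" if "u \<in> {(i,j), (i,l), (k,j), (k,l)}" for u
      by (rule gram_diag) (use that C in auto)
    moreover have "gram c r (i,j) (i,l) = gram d r' (i,j) (i,l)" "gram c r (i,j) (k,j) = gram d r' (i,j) (k,j)"
      "gram c r (i,l) (k,l) = gram d r' (i,l) (k,l)" "gram c r (k,j) (k,l) = gram d r' (k,j) (k,l)"
      by (rule gram_line; use C R(1,2) in \<open>simp add: same_line_def\<close>)+
    moreover note two_by_two[OF ij(1,3,2,4) R(1,2), of 1 1 1 1, unfolded mult_1 exp]
    ultimately show ?thesis unfolding ab R(3,4) by simp
  qed
qed

end

text \<open>Bessel's inequality bounds the squared \<open>k\<close>-th coordinates of an orthonormal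
  family by 1 in total; summing over the \<open>r\<close> coordinates bounds the number of
  vectors.\<close>

lemma orthonormal_le:
  fixes v :: "'a \<Rightarrow> nat \<Rightarrow> real"
  assumes fin: "finite A" and orth: "\<And>e f. e \<in> A \<Longrightarrow> f \<in> A \<Longrightarrow> (\<Sum>k<r. v e k * v f k) = (if e = f then 1 else 0)"
  shows "card A \<le> r"
proof -
  have bessel: "(\<Sum>e\<in>A. (v e k)\<^sup>2) \<le> 1" if k: "k < r" for k
  proof -
    \<comment> \<open>The vector \<open>w\<close> is the projection of the \<open>k\<close>-th unit
      vector onto the span of the family. Its \<open>k\<close>-th coordinate and its squared length
      are both \<open>s\<close>, hence \<open>s\<^sup>2 \<le> s\<close>.\<close>
    define s where "s = (\<Sum>e\<in>A. (v e k)\<^sup>2)"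
    define w where "w l = (\<Sum>e\<in>A. v e k * v e l)" for l
    have "(\<Sum>l<r. (w l)\<^sup>2) = (\<Sum>l<r. \<Sum>e\<in>A. \<Sum>f\<in>A. v e k * v f k * (v e l * v f l))"
      unfolding w_def power2_eq_square sum_product by (intro sum.cong refl) (simp only: mult_ac)
    also have "\<dots> = (\<Sum>e\<in>A. \<Sum>l<r. \<Sum>f\<in>A. v e k * v f k * (v e l * v f l))"
      by (rule sum.swap)
    also have "\<dots> = (\<Sum>e\<in>A. \<Sum>f\<in>A. \<Sum>l<r. v e k * v f k * (v e l * v f l))"
      by (intro sum.cong refl sum.swap)
    also have "\<dots> = (\<Sum>e\<in>A. \<Sum>f\<in>A. v e k * v f k * (\<Sum>l<r. v e l * v f l))"
      by (simp add: sum_distrib_left)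
    also have "\<dots> = (\<Sum>e\<in>A. \<Sum>f\<in>A. if f = e then v e k * v e k else 0)"
      using orth by (intro sum.cong refl) auto
    also have "\<dots> = s"
      using fin by (simp add: s_def power2_eq_square)
    finally have ww: "(\<Sum>l<r. (w l)\<^sup>2) = s" .
    have "s\<^sup>2 = (w k)\<^sup>2" by (simp add: s_def w_def power2_eq_square)
    also have "\<dots> \<le> (\<Sum>l<r. (w l)\<^sup>2)"
      using k by (intro member_le_sum) auto
    finally have "s * s \<le> s * 1" unfolding ww by (simp add: power2_eq_square)
    moreover have "s \<ge> 0" by (simp add: s_def sum_nonneg)
    ultimately have "s \<le> 1" by (cases "s = 0") auto
    then show ?thesis by (simp add: s_def)
  qed
  have "real (card A) = (\<Sum>e\<in>A. \<Sum>k<r. (v e k)\<^sup>2)"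
  proof -
    have "(\<Sum>k<r. (v e k)\<^sup>2) = 1" if "e \<in> A" for e
      using orth[OF that that] by (simp add: power2_eq_square)
    then show ?thesis by simp
  qed
  also have "\<dots> = (\<Sum>k<r. \<Sum>e\<in>A. (v e k)\<^sup>2)" by (rule sum.swap)
  also have "\<dots> \<le> (\<Sum>k<r. 1)" by (intro sum_mono) (use bessel in auto)
  finally show ?thesis by simp
qed

subsection \<open>Soundness of the recursive rules\<close>

lemma rect_diagonals_distinct:
  assumes "rect_diagonals p q r s"
  shows "p \<noteq> q" "r \<noteq> s"
  using assms by (auto simp: rect_diagonals_def doubleton_eq_iff)

lemma simple_edge_unique:
  assumes "simple G" "e \<in> selected_edges G" "f \<in> selected_edges G" "p \<in> e" "p \<in> f"
  shows "e = f"
  using assms by (auto simp: simple_def)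

lemma selected_pair_iff:
  assumes "is_configuration m n G" "p \<noteq> q"
  shows "(\<exists>e\<in>selected_edges G. p \<in> e \<and> q \<in> e) \<longleftrightarrow> {p, q} \<in> two_edges G"
proof
  assume "\<exists>e\<in>selected_edges G. p \<in> e \<and> q \<in> e"
  then obtain e where e: "e \<in> selected_edges G" "p \<in> e" "q \<in> e" by blast
  then have "e \<in> two_edges G" using assms(2) by (auto simp: selected_edges_def)
  then have "card e = 2" using assms(1) by (auto simp: is_configuration_def)
  then have "e = {p, q}" using e assms(2) by (auto simp: card_2_iff)
  then show "{p, q} \<in> two_edges G" using \<open>e \<in> two_edges G\<close> by simp
qed (auto simp: selected_edges_def)

locale representation =
  fixes m n r :: nat and G :: configuration and c :: "nat \<Rightarrow> cell \<Rightarrow> real"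
  assumes conf: "is_configuration m n G" and simple: "simple G" and mn: "m \<ge> 2" "n \<ge> 2"
    and rep: "config_form G = (\<lambda>x y. \<Sum>t<r. (combo c m n t x y)\<^sup>2)"
begin

text \<open>Membership in a common edge makes sense for equal cells too, where it means being
  occupied. In this form it is the complete Gram matrix of the displayed squares.\<close>

definition delta :: "cell \<Rightarrow> cell \<Rightarrow> real" where
  "delta p q = (if \<exists>e\<in>selected_edges G. p \<in> e \<and> q \<in> e then 1 else 0)"

lemma delta_eq: "p \<noteq> q \<Longrightarrow> delta p q = (if {p, q} \<in> two_edges G then 1 else 0)"
  unfolding delta_def by (subst selected_pair_iff[OF conf]) auto

lemma occupied_cells: "occupied G \<subseteq> cells m n"
  using selected_edges_subset[OF conf] by (auto simp: occupied_def)

text \<open>The displayed squares are a representation by incidence vectors of edges. In a simple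
  configuration two cells share at most one edge, so the inner products are 0 or 1 as
  stated.\<close>

lemma displayed:
  obtains d r' where "two_representations m n r r' c d" "\<And>p q. gram d r' p q = delta p q"
proof -
  let ?S = "selected_edges G"
  have fin: "finite ?S" using finite_configuration[OF conf] by simp
  obtain h where h: "bij_betw h {..<card ?S} ?S"
    using ex_bij_betw_nat_finite[OF fin] by (auto simp: atLeast0LessThan)
  define d where "d k p = (if p \<in> h k then 1 else 0 :: real)" for k p
  have edge: "combo d m n k x y = edge_form (h k) x y" if "k < card ?S" for k x y
  proof -
    have sub: "h k \<subseteq> cells m n" using h that selected_edges_subset[OF conf] by (auto dest: bij_betwE)
    have "combo d m n k x y = (\<Sum>p\<in>cells m n. if p \<in> h k then x (fst p) * y (snd p) else 0)"
      unfolding combo_def by (intro sum.cong refl) (auto simp: d_def)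
    also have "\<dots> = (\<Sum>p\<in>h k. x (fst p) * y (snd p))"
      using sub by (simp add: sum.inter_restrict[symmetric] Int_absorb1)
    finally show ?thesis by (simp add: edge_form_def case_prod_beta)
  qed
  have "(\<Sum>t<r. (combo c m n t x y)\<^sup>2) = (\<Sum>t<card ?S. (combo d m n t x y)\<^sup>2)" for x y
  proof -
    have "(\<Sum>t<card ?S. (combo d m n t x y)\<^sup>2) = (\<Sum>t<card ?S. (edge_form (h t) x y)\<^sup>2)"
      by (intro sum.cong) (auto simp: edge)
    also have "\<dots> = config_form G x y"
      unfolding config_form_eq_sum[OF conf] by (rule sum.reindex_bij_betw[OF h])
    finally show ?thesis by (simp add: rep)
  qed
  moreover have "gram d (card ?S) p q = delta p q" for p q
  proof -
    have "gram d (card ?S) p q = (\<Sum>t<card ?S. (if p \<in> h t \<and> q \<in> h t then 1 else 0))"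
      unfolding gram_def by (intro sum.cong refl) (auto simp: d_def)
    also have "\<dots> = (\<Sum>e\<in>?S. (if p \<in> e \<and> q \<in> e then 1 else 0))"
      by (rule sum.reindex_bij_betw[OF h])
    also have "\<dots> = delta p q"
    proof (cases "\<exists>e\<in>?S. p \<in> e \<and> q \<in> e")
      case True
      then obtain e where e: "e \<in> ?S" "p \<in> e" "q \<in> e" by blast
      have "(\<Sum>e\<in>?S. (if p \<in> e \<and> q \<in> e then 1 else 0)) = (\<Sum>f\<in>?S. (if f = e then 1 else 0 :: real))"
        by (intro sum.cong refl if_cong) (metis e simple_edge_unique[OF simple])
      then show ?thesis using True e fin by (simp add: delta_def)
    next
      case False
      then have "(\<Sum>e\<in>?S. (if p \<in> e \<and> q \<in> e then 1 else 0)) = (0 :: real)"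
        by (intro sum.neutral) auto
      then show ?thesis using False by (auto simp: delta_def)
    qed
    finally show ?thesis .
  qed
  ultimately show ?thesis using that[of "card ?S" d] mn by (simp add: two_representations_def)
qed

lemma gram_diag: "p \<in> cells m n \<Longrightarrow> gram c r p p = delta p p"
  by (metis displayed two_representations.gram_diag)

lemma gram_line: "p \<in> cells m n \<Longrightarrow> q \<in> cells m n \<Longrightarrow> p \<noteq> q \<Longrightarrow> same_line p q \<Longrightarrow> gram c r p q = delta p q"
  by (metis displayed two_representations.gram_line)

lemma gram_rect:
  assumes "rect_diagonals p q a b" "p \<in> cells m n" "q \<in> cells m n"
  shows "a \<in> cells m n" "b \<in> cells m n" "gram c r p q + gram c r a b = delta p q + delta a b"
proof -
  obtain d r' where "two_representations m n r r' c d" "\<And>p q. gram d r' p q = delta p q"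
    using displayed by metis
  then show "a \<in> cells m n" "b \<in> cells m n" "gram c r p q + gram c r a b = delta p q + delta a b"
    using two_representations.gram_rect[OF _ assms] by auto
qed

lemma gram_occupied: "p \<in> occupied G \<Longrightarrow> gram c r p p = 1"
  using gram_diag[of p] occupied_cells by (auto simp: delta_def occupied_def)

text \<open>The vector of an unoccupied cell has squared length 0, hence it vanishes.\<close>

lemma gram_unoccupied:
  assumes "p \<in> cells m n" "p \<notin> occupied G"
  shows "gram c r p q = 0" "delta p q = 0"
proof -
  have "gram c r p p = 0" "delta p q = 0" using assms gram_diag by (auto simp: delta_def occupied_def)
  then show "delta p q = 0" "gram c r p q = 0"
    by (simp_all add: gram_def sum_nonneg_eq_0_iff)
qed

lemma gram_distance:
  assumes "p \<in> occupied G" "q \<in> occupied G"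
  shows "(\<Sum>t<r. (c t p - c t q)\<^sup>2) = 2 - 2 * gram c r p q"
proof -
  have "(\<Sum>t<r. (c t p - c t q)\<^sup>2) = gram c r p p + gram c r q q - 2 * gram c r p q"
    unfolding gram_def sum_distrib_left sum.distrib[symmetric] sum_subtractf[symmetric]
    by (intro sum.cong refl) (simp add: power2_eq_square algebra_simps)
  then show ?thesis using assms by (simp add: gram_occupied)
qed

lemma gram_le_1: "p \<in> occupied G \<Longrightarrow> q \<in> occupied G \<Longrightarrow> gram c r p q \<le> 1"
  using gram_distance[of p q] sum_nonneg[of "{..<r}" "\<lambda>t. (c t p - c t q)\<^sup>2"] by simp

text \<open>The equality case of the Cauchy-Schwarz inequality for unit vectors.\<close>

lemma gram_1_imp_eq:
  assumes "p \<in> occupied G" "q \<in> occupied G" "gram c r p q = 1" "t < r"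
  shows "c t p = c t q"
  using gram_distance[OF assms(1,2)] assms(3,4) by (simp add: sum_nonneg_eq_0_iff)

text \<open>What \<open>\<sim>\<close> and \<open>\<perp>\<^sub>R\<close> assert about the vectors
  of a representation: they are equal, respectively orthogonal. Only the coordinates below
  \<open>r\<close> belong to the representation.\<close>

definition same where "same p q \<longleftrightarrow> p \<in> occupied G \<and> q \<in> occupied G \<and> (\<forall>t<r. c t p = c t q)"
definition orth where "orth p q \<longleftrightarrow> p \<in> occupied G \<and> q \<in> occupied G \<and> gram c r p q = 0"

lemma sameI: "p \<in> occupied G \<Longrightarrow> q \<in> occupied G \<Longrightarrow> gram c r p q = 1 \<Longrightarrow> same p q"
  using gram_1_imp_eq by (auto simp: same_def)

lemma gram_same:
  assumes "same p p'" "same q q'"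
  shows "gram c r p q = gram c r p' q'"
  using assms unfolding gram_def same_def by (intro sum.cong) auto

lemma same_gram_1: "same p q \<Longrightarrow> gram c r p q = 1"
  using gram_same[of p q q q] gram_occupied by (auto simp: same_def)

text \<open>A certified diagonal has the same inner product as in the displayed representation. The
  sum over both diagonals is fixed, so the opposite diagonal agrees with it as well.\<close>

lemma gram_transfer:
  assumes R: "rect_diagonals p q a b" and p: "p \<in> occupied G" and q: "q \<in> occupied G"
    and cert: "{a, b} \<notin> two_edges G \<and> (a \<notin> occupied G \<or> b \<notin> occupied G \<or> orth a b) \<or> {a, b} \<in> two_edges G \<and> same a b"
  shows "gram c r p q = (if {p, q} \<in> two_edges G then 1 else 0)"
proof -
  have pq: "p \<in> cells m n" "q \<in> cells m n" using p q occupied_cells by auto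
  note ab = gram_rect[OF R pq]
  have "gram c r a b = delta a b"
    using cert
  proof (elim disjE conjE)
    assume "a \<notin> occupied G"
    then show ?thesis using gram_unoccupied[OF ab(1)] by simp
  next
    assume "b \<notin> occupied G"
    moreover have "delta a b = delta b a" by (auto simp: delta_def)
    ultimately show ?thesis using gram_unoccupied[OF ab(2)] by (simp add: gram_commute[of c r a b])
  next
    assume "{a, b} \<notin> two_edges G" "orth a b"
    then show ?thesis using rect_diagonals_distinct[OF R] by (simp add: delta_eq orth_def)
  next
    assume "{a, b} \<in> two_edges G" "same a b"
    then show ?thesis using rect_diagonals_distinct[OF R] by (simp add: delta_eq same_gram_1)
  qed
  then show ?thesis using ab(3) rect_diagonals_distinct[OF R] by (simp add: delta_eq)
qed

lemma two_edge_occupied: "{p, q} \<in> two_edges G \<Longrightarrow> p \<in> occupied G \<and> q \<in> occupied G"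
  by (auto simp: occupied_def selected_edges_def)

lemma rw_sound: "rw_eq G p q \<Longrightarrow> same p q" "rw_perp G p q \<Longrightarrow> orth p q"
proof (induction rule: rw_eq_rw_perp.inducts)
  case (line_eq p q)
  then show ?case using gram_line[of p q] occupied_cells by (intro sameI) (auto simp: delta_eq)
next
  case (line_perp p q)
  then show ?case using gram_line[of p q] occupied_cells by (auto simp: delta_eq orth_def)
next
  case (saturation p p' q q')
  then show ?case using gram_same[of p p' q q'] by (auto simp: orth_def same_def)
next
  case (transfer_perp p q a b)
  then have "gram c r p q = 0" using gram_transfer[of p q a b] by auto
  then show ?case using transfer_perp by (simp add: orth_def)
next
  case (transfer_eq p q a b)
  then have "gram c r p q = 1" using gram_transfer[of p q a b] by auto
  then show ?case using transfer_eq by (intro sameI) auto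
next
  \<comment> \<open>Neither diagonal need be certified here. Both inner products are at most 1,
    since occupied cells carry unit vectors, and their sum is 2.\<close>
  case (complementary p q a b)
  then have occ: "p \<in> occupied G" "q \<in> occupied G" "a \<in> occupied G" "b \<in> occupied G"
    using two_edge_occupied by blast+
  then have "gram c r p q + gram c r a b = 2"
    using gram_rect(3)[OF complementary(1)] occupied_cells rect_diagonals_distinct[OF complementary(1)] complementary
    by (auto simp: delta_eq)
  then have "gram c r p q = 1" using gram_le_1[OF occ(1,2)] gram_le_1[OF occ(3,4)] by simp
  then show ?case using occ by (intro sameI) auto
qed (auto simp: same_def orth_def gram_commute)

lemma admissible_bound:
  assumes "RW3_plus_admissible G"
  shows "num_squares G \<le> r"
proof -
  let ?S = "selected_edges G"
  have ne: "e \<noteq> {}" if "e \<in> ?S" for e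
    using that conf by (auto simp: selected_edges_def is_configuration_def)
  define a where "a e = (SOME p. p \<in> e)" for e :: "cell set"
  have a: "a e \<in> e" if "e \<in> ?S" for e
    using ne[OF that] by (auto simp: a_def some_in_eq)
  have a_same: "same (a e) p" if "e \<in> ?S" "p \<in> e" for e p
  proof (cases "e \<in> two_edges G")
    case True
    then show ?thesis using assms that a[OF that(1)] rw_sound(1) unfolding RW3_plus_admissible_def by blast
  next
    case False
    then have "a e = p" using that a[OF that(1)] by (auto simp: selected_edges_def)
    then show ?thesis using that by (auto simp: same_def occupied_def)
  qed
  have "card ?S \<le> r"
  proof (rule orthonormal_le[where v = "\<lambda>e t. c t (a e)"])
    show "finite ?S" using finite_configuration[OF conf] by simp
    fix e f assume ef: "e \<in> ?S" "f \<in> ?S"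
    show "(\<Sum>k<r. c k (a e) * c k (a f)) = (if e = f then 1 else 0)"
    proof (cases "e = f")
      case True
      have "a e \<in> occupied G" using ef a by (auto simp: occupied_def)
      then have "gram c r (a e) (a e) = 1" by (rule gram_occupied)
      then show ?thesis using True by (simp add: gram_def)
    next
      case False
      then obtain p q where pq: "p \<in> e" "q \<in> f" "rw_perp G p q"
        using assms ef False unfolding RW3_plus_admissible_def by metis
      have "gram c r (a e) (a f) = gram c r p q"
        by (rule gram_same) (use a_same ef pq in auto)
      then show ?thesis using rw_sound(2)[OF pq(3)] False by (simp add: orth_def gram_def)
    qed
  qed
  then show ?thesis by (simp add: num_squares_eq_card[OF conf])
qed

end

theorem RW3_plus_admissible_imp_irreducible:
  assumes G: "is_configuration m n G" "simple G" and mn: "m \<ge> 2" "n \<ge> 2" and adm: "RW3_plus_admissible G"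
  shows "irreducible_config m n G"
proof -
  define r where "r = SOS m n (config_form G)"
  note rep = sos_representable_config[OF G(1)]
  have "sos_representable m n (config_form G) r"
    unfolding r_def SOS_def using rep by (rule LeastI)
  then obtain B where B: "\<forall>k<r. bilinear_form m n (B k)" "config_form G = (\<lambda>x y. \<Sum>k<r. (B k x y)\<^sup>2)"
    unfolding sos_representable_def by blast
  have "\<forall>k. \<exists>c. k < r \<longrightarrow> B k = (\<lambda>x y. \<Sum>(i, j)\<in>cells m n. c (i, j) * (x i * y j))"
    using B(1) unfolding bilinear_form_def by blast
  from choice[OF this] obtain c where "\<forall>k. k < r \<longrightarrow> B k = (\<lambda>x y. \<Sum>(i, j)\<in>cells m n. c k (i, j) * (x i * y j))" ..
  then have c: "B k = combo c m n k" if "k < r" for k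
    using that unfolding combo_def by blast
  have "representation m n r G c"
  proof
    show "config_form G = (\<lambda>x y. \<Sum>t<r. (combo c m n t x y)\<^sup>2)"
      unfolding B(2) by (simp add: c)
  qed (use G mn in auto)
  from representation.admissible_bound[OF this adm] SOS_le[OF rep]
  show ?thesis by (simp add: irreducible_config_def r_def)
qed

text \<open>Every rule that creates an instance of \<open>\<sim>\<close> between different cells
  relates the two halves of a two-edge, and disjoint supports keep transitivity inside one edge.
  This supplies the clause of admissibility that separates the classes of distinct edges.\<close>

lemma rw_same_edge:
  assumes "simple G" "rw_eq G p q"
  shows "\<exists>e\<in>selected_edges G. p \<in> e \<and> q \<in> e"
proof -
  have two: "\<exists>e\<in>selected_edges G. p \<in> e \<and> q \<in> e" if "{p, q} \<in> two_edges G" for p q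
    using that unfolding selected_edges_def by blast
  have "rw_eq G p q \<Longrightarrow> \<exists>e\<in>selected_edges G. p \<in> e \<and> q \<in> e" "rw_perp G p q \<Longrightarrow> True" for p q
  proof (induction rule: rw_eq_rw_perp.inducts)
    case (eq_refl p)
    then show ?case by (auto simp: occupied_def)
  next
    case (eq_sym p q)
    then show ?case by blast
  next
    case (eq_trans p q r)
    then obtain e f where "e \<in> selected_edges G" "p \<in> e" "q \<in> e" "f \<in> selected_edges G" "q \<in> f" "r \<in> f"
      by blast
    then show ?case using simple_edge_unique[OF assms(1), of e f q] by blast
  qed (simp_all only: two)
  then show ?thesis using assms(2) by blast
qed

subsection \<open>Certified derivations\<close>

text \<open>Rows 1 to 6 run through the six pairs of columns in lexicographic order; row 7 has its
  cell in column 1.\<close>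

definition std_ones :: "cell list" where
  "std_ones =
    [(1,1), (1,2), (2,1), (2,3), (3,1), (3,4), (4,2), (4,3), (5,2), (5,4), (6,3), (6,4), (7,1)]"

definition flat_pairs :: "('a \<times> 'a) list \<Rightarrow> 'a list" where
  "flat_pairs K = concat (map (\<lambda>(p, q). [p, q]) K)"

definition std_config :: "(cell \<times> cell) list \<Rightarrow> configuration" where
  "std_config T = \<lparr>one_edges = set std_ones, two_edges = (\<lambda>(p, q). {p, q}) ` set T\<rparr>"

definition paired :: "(cell \<times> cell) list \<Rightarrow> cell \<Rightarrow> cell \<Rightarrow> bool" where
  "paired T p q \<longleftrightarrow> (p, q) \<in> set T \<or> (q, p) \<in> set T"

definition occ :: "(cell \<times> cell) list \<Rightarrow> cell \<Rightarrow> bool" where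
  "occ T p \<longleftrightarrow> p \<in> set std_ones \<or> p \<in> set (flat_pairs T)"

text \<open>In the following, \<open>T\<close> lists the two-edges, while \<open>E\<close> and \<open>Q\<close> list the instances of \<open>\<sim>\<close> and \<open>\<perp>\<^sub>R\<close>
  derived so far from the rectangle rules; the line rule and saturation are built in.\<close>

definition eqv :: "(cell \<times> cell) list \<Rightarrow> (cell \<times> cell) list \<Rightarrow> cell \<Rightarrow> cell \<Rightarrow> bool" where
  "eqv T E p q \<longleftrightarrow> p = q \<or> paired T p q \<and> (same_line p q \<or> paired E p q)"

text \<open>A class lies inside one edge, so besides \<open>p\<close> only its partner is a
  candidate. The filter makes membership imply \<open>eqv\<close> by construction.\<close>

definition eq_class :: "(cell \<times> cell) list \<Rightarrow> (cell \<times> cell) list \<Rightarrow> cell \<Rightarrow> cell list" where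
  "eq_class T E p = filter (eqv T E p) (p # concat (map (\<lambda>(a, b). if p = a then [b] else if p = b then [a] else []) T))"

definition knows_perp :: "(cell \<times> cell) list \<Rightarrow> (cell \<times> cell) list \<Rightarrow> (cell \<times> cell) list \<Rightarrow> cell \<Rightarrow> cell \<Rightarrow> bool" where
  "knows_perp T E Q p q \<longleftrightarrow> list_ex (\<lambda>a. list_ex (\<lambda>b. a \<noteq> b \<and> same_line a b \<and> \<not> paired T a b \<or> paired Q a b)
     (eq_class T E q)) (eq_class T E p)"

text \<open>Each pair in the last argument is a diagonal to which one of the rectangle rules applies.\<close>

fun derivation :: "(cell \<times> cell) list \<Rightarrow> (cell \<times> cell) list \<Rightarrow> (cell \<times> cell) list \<Rightarrow> (cell \<times> cell) list \<Rightarrow> bool" where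
  "derivation T E Q [] \<longleftrightarrow> list_all (\<lambda>(a, b). eqv T E a b) T \<and>
     sorted_wrt (knows_perp T E Q) (std_ones @ map fst T)"
| "derivation T E Q ((p, q) # S) \<longleftrightarrow>
     (let r = (fst p, snd q); s = (fst q, snd p) in
      fst p \<noteq> fst q \<and> snd p \<noteq> snd q \<and> occ T p \<and> occ T q \<and>
      (if paired T r s then eqv T E r s \<or> paired T p q else \<not> occ T r \<or> \<not> occ T s \<or> knows_perp T E Q r s) \<and>
      (if paired T p q then derivation T ((p, q) # E) Q S else derivation T E ((p, q) # Q) S))"

definition well_formed :: "(cell \<times> cell) list \<Rightarrow> bool" where
  "well_formed T \<longleftrightarrow> distinct (std_ones @ flat_pairs T) \<and>
     list_all (\<lambda>(i, j). 1 \<le> i \<and> i \<le> 7 \<and> 1 \<le> j \<and> j \<le> 4) (std_ones @ flat_pairs T)"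

lemma paired_iff: "paired T p q \<longleftrightarrow> {p, q} \<in> two_edges (std_config T)"
  by (auto simp: paired_def std_config_def doubleton_eq_iff)

lemma set_flat_pairs: "set (flat_pairs T) = \<Union> ((\<lambda>(p, q). {p, q}) ` set T)"
  by (auto simp: flat_pairs_def)

lemma occ_iff: "occ T p \<longleftrightarrow> p \<in> occupied (std_config T)"
  by (auto simp: occ_def occupied_def selected_edges_def std_config_def set_flat_pairs)

lemma distinct_flat_pairs:
  assumes "distinct (flat_pairs T)"
  shows "(p, q) \<in> set T \<Longrightarrow> p \<noteq> q"
    and "(p, q) \<in> set T \<Longrightarrow> (p', q') \<in> set T \<Longrightarrow> {p, q} \<inter> {p', q'} \<noteq> {} \<Longrightarrow> p = p' \<and> q = q'"
    and "distinct (map (\<lambda>(p, q). {p, q}) T)"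
  using assms
proof (induction T)
  case (Cons a T)
  obtain x y where a: "a = (x, y)" by (cases a)
  have fp: "flat_pairs (a # T) = x # y # flat_pairs T" by (simp add: flat_pairs_def a)
  have mem: "p \<in> set (flat_pairs T) \<and> q \<in> set (flat_pairs T)" if "(p, q) \<in> set T" for p q
    using that by (force simp: set_flat_pairs)
  { case 1 then show ?case using Cons fp a by auto
  next
    case 2
    then show ?case using Cons.IH(2) fp a mem[of p q] mem[of p' q'] by auto
  next
    case 3
    have "{x, y} \<notin> (\<lambda>(p, q). {p, q}) ` set T"
      using 3 fp mem by (auto simp: doubleton_eq_iff)
    then show ?case using 3 Cons.IH(3) fp a by simp
  }
qed simp_all

lemma std_config_ok:
  assumes "well_formed T"
  shows "is_configuration 7 4 (std_config T)" "simple (std_config T)" "num_squares (std_config T) = 13 + length T"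
proof -
  have d: "distinct (std_ones @ flat_pairs T)"
    using assms by (simp add: well_formed_def)
  have r: "set (std_ones @ flat_pairs T) \<subseteq> cells 7 4"
  proof
    fix p assume "p \<in> set (std_ones @ flat_pairs T)"
    with assms have "(\<lambda>(i, j). 1 \<le> i \<and> i \<le> 7 \<and> 1 \<le> j \<and> j \<le> 4) p"
      unfolding well_formed_def list_all_iff by blast
    then show "p \<in> cells 7 4" by (cases p) (simp add: cells_def)
  qed
  note pairs = distinct_flat_pairs[of T]
  have dT: "distinct (flat_pairs T)" using d by simp
  show conf: "is_configuration 7 4 (std_config T)"
    unfolding is_configuration_def
  proof (intro conjI ballI)
    show "one_edges (std_config T) \<subseteq> cells 7 4" using r by (simp add: std_config_def)
    fix e assume "e \<in> two_edges (std_config T)"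
    then obtain p q where e: "(p, q) \<in> set T" "e = {p, q}" by (auto simp: std_config_def)
    then show "e \<subseteq> cells 7 4" using r by (force simp: set_flat_pairs)
    show "card e = 2" using e pairs(1)[OF dT] by auto
  qed
  have edges: "e = {p} \<and> p \<in> set std_ones \<or> (\<exists>q q'. e = {q, q'} \<and> (q, q') \<in> set T \<and> p \<in> {q, q'} \<and> p \<in> set (flat_pairs T))"
    if "e \<in> selected_edges (std_config T)" "p \<in> e" for e p
    using that by (fastforce simp: selected_edges_def std_config_def set_flat_pairs)
  show "simple (std_config T)"
    unfolding simple_def
  proof (intro ballI impI)
    fix e f assume ef: "e \<in> selected_edges (std_config T)" "f \<in> selected_edges (std_config T)" "e \<noteq> f"
    show "e \<inter> f = {}"
    proof (rule ccontr)
      assume "e \<inter> f \<noteq> {}"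
      then obtain p where p: "p \<in> e" "p \<in> f" by blast
      have "\<not> (p \<in> set std_ones \<and> p \<in> set (flat_pairs T))" using d by auto
      with edges[OF ef(1) p(1)] edges[OF ef(2) p(2)] have "e = f"
        using pairs(2)[OF dT] by blast
      then show False using ef(3) by simp
    qed
  qed
  have "card (two_edges (std_config T)) = length T"
    using distinct_card[OF pairs(3)[OF dT]] by (simp add: std_config_def)
  moreover have "card (set std_ones) = 13"
    using d distinct_card[of std_ones] by (simp add: std_ones_def)
  ultimately show "num_squares (std_config T) = 13 + length T"
    by (simp add: num_squares_def std_config_def)
qed

text \<open>The invariant is that all entries of \<open>E\<close> and \<open>Q\<close> are
  derivable. At the end \<open>sorted_wrt\<close> compares each chosen cell of an edge with the
  later ones only; symmetry of \<open>\<perp>\<^sub>R\<close> gives the other order.\<close>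

lemma derivation_sound:
  assumes "\<And>p q. (p, q) \<in> set E \<Longrightarrow> rw_eq (std_config T) p q"
    and "\<And>p q. (p, q) \<in> set Q \<Longrightarrow> rw_perp (std_config T) p q"
    and "derivation T E Q S"
  shows "(\<forall>(p, q) \<in> set T. rw_eq (std_config T) p q) \<and>
    (\<forall>p\<in>set (std_ones @ map fst T). \<forall>q\<in>set (std_ones @ map fst T). p \<noteq> q \<longrightarrow> rw_perp (std_config T) p q)"
  using assms
proof (induction T E Q S rule: derivation.induct)
  have eqv: "rw_eq (std_config T) p q"
    if "\<And>p q. (p, q) \<in> set E \<Longrightarrow> rw_eq (std_config T) p q" "eqv T E p q" "occ T p" for T E p q
  proof (cases "p = q")
    case True
    then show ?thesis using that eq_refl by (simp add: occ_iff)
  next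
    case False
    then have "paired T p q" "same_line p q \<or> paired E p q" using that by (auto simp: eqv_def)
    moreover have "occ T q" using \<open>paired T p q\<close> by (force simp: paired_def occ_def set_flat_pairs)
    moreover have "rw_eq (std_config T) p q" if "paired E p q"
      using that \<open>\<And>p q. (p, q) \<in> set E \<Longrightarrow> rw_eq (std_config T) p q\<close> eq_sym unfolding paired_def by blast
    moreover have "rw_eq (std_config T) p q" if "same_line p q"
      by (rule line_eq) (use calculation \<open>occ T p\<close> False that in \<open>simp_all add: paired_iff[symmetric] occ_iff[symmetric]\<close>)
    ultimately show ?thesis by blast
  qed
  have perp: "rw_perp (std_config T) p q"
    if E: "\<And>p q. (p, q) \<in> set E \<Longrightarrow> rw_eq (std_config T) p q"
      and Q: "\<And>p q. (p, q) \<in> set Q \<Longrightarrow> rw_perp (std_config T) p q"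
      and K: "knows_perp T E Q p q" "occ T p" "occ T q" for T E Q p q
  proof -
    from K(1) obtain a b where "a \<in> set (eq_class T E p)" "b \<in> set (eq_class T E q)"
      and or: "a \<noteq> b \<and> same_line a b \<and> \<not> paired T a b \<or> paired Q a b"
      unfolding knows_perp_def list_ex_iff by blast
    then have ab: "eqv T E p a" "eqv T E q b" by (simp_all only: eq_class_def set_filter mem_Collect_eq)
    have "rw_eq (std_config T) p a" "rw_eq (std_config T) q b" using eqv[OF E] ab K by blast+
    moreover have "occ T c" if "eqv T E d c" "occ T d" for c d
      using that by (force simp: eqv_def paired_def occ_def set_flat_pairs)
    then have "occ T a" "occ T b" using ab K by blast+
    then have "rw_perp (std_config T) a b"
      using or
    proof (elim disjE conjE)
      assume "paired Q a b"
      then show ?thesis using Q perp_sym unfolding paired_def by blast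
    next
      assume "a \<noteq> b" "same_line a b" "\<not> paired T a b"
      then show ?thesis using \<open>occ T a\<close> \<open>occ T b\<close> line_perp by (simp add: paired_iff occ_iff)
    qed
    ultimately show ?thesis by (rule saturation)
  qed
  {
    case (1 T E Q)
    let ?R = "set (std_ones @ map fst T)"
    have occ: "occ T p" if "p \<in> ?R" for p
      using that by (force simp: occ_def set_flat_pairs)
    have eqs: "\<forall>(a, b)\<in>set T. eqv T E a b" and sorted: "sorted_wrt (knows_perp T E Q) (std_ones @ map fst T)"
      using 1(3) unfolding derivation.simps list_all_iff by blast+
    have perps: "knows_perp T E Q p q \<or> knows_perp T E Q q p" if "p \<in> ?R" "q \<in> ?R" "p \<noteq> q" for p q
      using that sorted by (metis in_set_conv_nth nat_neq_iff sorted_wrt_iff_nth_less)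
    have "rw_eq (std_config T) p q" if "(p, q) \<in> set T" for p q
    proof (rule eqv[OF 1(1)])
      show "eqv T E p q" using eqs that by blast
      show "occ T p" using that by (intro occ) force
    qed
    moreover have "rw_perp (std_config T) p q" if "p \<in> ?R" "q \<in> ?R" "p \<noteq> q" for p q
      using perps[OF that] perp[OF 1(1,2)] occ that perp_sym by blast
    ultimately show ?case by blast
  next
    case (2 T E Q p q S)
    obtain i j k l where pq: "p = (i, j)" "q = (k, l)" by (cases p, cases q)
    define r s where "r = (i, l)" and "s = (k, j)"
    have R: "rect_diagonals p q r s" "occ T p" "occ T q"
      and cert: "if paired T r s then eqv T E r s \<or> paired T p q else \<not> occ T r \<or> \<not> occ T s \<or> knows_perp T E Q r s"
      and rest: "if paired T p q then derivation T ((p, q) # E) Q S else derivation T E ((p, q) # Q) S"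
      using "2.prems"(3) unfolding derivation.simps Let_def pq r_def s_def rect_diagonals_def fst_conv snd_conv
      by blast+
    have occ: "occ T a" if "paired T a b" for a b
      using that by (force simp: paired_def occ_def set_flat_pairs)
    \<comment> \<open>If both diagonals are two-edges, the rule for complementary pairs applies and
      nothing has to be certified. In all other cases the check certifies the diagonal
      \<open>{r, s}\<close>.\<close>
    have C: "({r, s} \<notin> two_edges (std_config T) \<and> (r \<notin> occupied (std_config T) \<or> s \<notin> occupied (std_config T) \<or>
        r \<in> occupied (std_config T) \<and> s \<in> occupied (std_config T) \<and> rw_perp (std_config T) r s)) \<or>
        ({r, s} \<in> two_edges (std_config T) \<and> rw_eq (std_config T) r s)"
      if "\<not> (paired T r s \<and> paired T p q)"
    proof (cases "paired T r s")
      case True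
      then have "rw_eq (std_config T) r s"
        using cert that occ by (intro eqv[OF "2.prems"(1)]) auto
      then show ?thesis using True by (simp add: paired_iff)
    next
      case False
      then have "rw_perp (std_config T) r s" if "occ T r" "occ T s"
        using cert that by (intro perp[OF "2.prems"(1,2)]) auto
      then show ?thesis using False by (auto simp: paired_iff occ_iff)
    qed
    show ?case
    proof (cases "paired T p q")
      case True
      have "rw_eq (std_config T) p q"
      proof (cases "paired T r s")
        case True
        then show ?thesis using complementary[OF R(1)] \<open>paired T p q\<close> by (simp add: paired_iff)
      next
        case False
        then show ?thesis using transfer_eq[OF R(1) C] R \<open>paired T p q\<close> by (simp add: paired_iff occ_iff)
      qed
      show ?thesis
      proof (rule "2.IH"(1)[OF refl refl True])
        show "rw_eq (std_config T) a b" if "(a, b) \<in> set ((p, q) # E)" for a b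
          using that "2.prems"(1)[of a b] \<open>rw_eq (std_config T) p q\<close> by (cases "(a, b) = (p, q)") auto
        show "derivation T ((p, q) # E) Q S" using rest True by simp
      qed (rule "2.prems"(2))
    next
      case False
      have "rw_perp (std_config T) p q"
        using False transfer_perp[OF R(1) C] R by (simp add: paired_iff occ_iff)
      show ?thesis
      proof (rule "2.IH"(2)[OF refl refl False])
        show "rw_perp (std_config T) a b" if "(a, b) \<in> set ((p, q) # Q)" for a b
          using that "2.prems"(2)[of a b] \<open>rw_perp (std_config T) p q\<close> by (cases "(a, b) = (p, q)") auto
        show "derivation T E ((p, q) # Q) S" using rest False by simp
      qed (rule "2.prems"(1))
    qed
  }
qed

lemma derivation_imp_admissible:
  assumes wf: "well_formed T" and der: "derivation T [] [] S"
  shows "RW3_plus_admissible (std_config T)"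
proof -
  let ?G = "std_config T"
  note ok = std_config_ok[OF wf]
  have eq: "rw_eq ?G p q" if "(p, q) \<in> set T" for p q
    using derivation_sound[OF _ _ der] that by auto
  have perp: "rw_perp ?G p q" if "p \<in> set (std_ones @ map fst T)" "q \<in> set (std_ones @ map fst T)" "p \<noteq> q" for p q
    using derivation_sound[OF _ _ der] that by auto
  have rep: "\<exists>p\<in>e. p \<in> set (std_ones @ map fst T)" if "e \<in> selected_edges ?G" for e
    using that by (force simp: selected_edges_def std_config_def)
  show ?thesis
    unfolding RW3_plus_admissible_def
  proof (intro conjI ballI impI)
    fix e p q assume e: "e \<in> two_edges ?G" "p \<in> e" "q \<in> e"
    then obtain a b where ab: "e = {a, b}" "(a, b) \<in> set T" by (auto simp: std_config_def)
    have "a \<in> occupied ?G" "b \<in> occupied ?G" using ab by (force simp: occ_iff[symmetric] occ_def set_flat_pairs)+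
    then show "rw_eq ?G p q" using e ab eq[OF ab(2)] by (auto intro: eq_refl eq_sym)
  next
    fix e f p q assume "e \<in> selected_edges ?G" "f \<in> selected_edges ?G" "e \<noteq> f" "p \<in> e" "q \<in> f"
    then show "\<not> rw_eq ?G p q"
      using rw_same_edge[OF ok(2), of p q] simple_edge_unique[OF ok(2)] by metis
  next
    fix e f assume ef: "e \<in> selected_edges ?G" "f \<in> selected_edges ?G" "e \<noteq> f"
    obtain p q where pq: "p \<in> e" "q \<in> f" "p \<in> set (std_ones @ map fst T)" "q \<in> set (std_ones @ map fst T)"
      using rep[OF ef(1)] rep[OF ef(2)] by blast
    moreover have "p \<noteq> q" using ef pq simple_edge_unique[OF ok(2), of e f p] by auto
    ultimately show "\<exists>p\<in>e. \<exists>q\<in>f. rw_perp ?G p q" using perp by blast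
  qed
qed

subsection \<open>Chains of two-edges in two columns\<close>

definition linear_comb :: "nat \<Rightarrow> ((nat \<Rightarrow> real) \<Rightarrow> real) \<Rightarrow> bool" where
  "linear_comb m U \<longleftrightarrow> (\<exists>c. U = (\<lambda>x. \<Sum>i\<in>{1..m}. c i * x i))"

lemma linear_comb_coord: "i \<in> {1..m} \<Longrightarrow> linear_comb m (\<lambda>x. x i)"
  unfolding linear_comb_def
  by (intro exI[of _ "\<lambda>k. if k = i then 1 else 0"]) (simp add: if_distrib[of "\<lambda>c. c * _"] cong: if_cong)

lemma linear_comb_add:
  assumes "linear_comb m U" "linear_comb m V"
  shows "linear_comb m (\<lambda>x. U x + V x)"
proof -
  obtain c d where "U = (\<lambda>x. \<Sum>i\<in>{1..m}. c i * x i)" "V = (\<lambda>x. \<Sum>i\<in>{1..m}. d i * x i)"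
    using assms unfolding linear_comb_def by blast
  then show ?thesis
    unfolding linear_comb_def by (intro exI[of _ "\<lambda>i. c i + d i"]) (simp add: distrib_right sum.distrib)
qed

lemma linear_comb_scale:
  assumes "linear_comb m U"
  shows "linear_comb m (\<lambda>x. a * U x)"
proof -
  obtain c where "U = (\<lambda>x. \<Sum>i\<in>{1..m}. c i * x i)"
    using assms unfolding linear_comb_def by blast
  then show ?thesis
    unfolding linear_comb_def by (intro exI[of _ "\<lambda>i. a * c i"]) (simp add: sum_distrib_left mult.assoc)
qed

lemma linear_comb_diff:
  assumes "linear_comb m U" "linear_comb m V"
  shows "linear_comb m (\<lambda>x. U x - V x)"
  using linear_comb_add[OF assms(1) linear_comb_scale[OF assms(2), of "-1"]] by simp

lemmas linear_comb_intros = linear_comb_coord linear_comb_add linear_comb_diff linear_comb_scale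

lemma bilinear_form_mult:
  assumes "linear_comb m U" "linear_comb n V"
  shows "bilinear_form m n (\<lambda>x y. U x * V y)"
proof -
  obtain c d where UV: "U = (\<lambda>x. \<Sum>i\<in>{1..m}. c i * x i)" "V = (\<lambda>x. \<Sum>i\<in>{1..n}. d i * x i)"
    using assms unfolding linear_comb_def by blast
  have "U x * V y = (\<Sum>(i, j)\<in>cells m n. c i * d j * (x i * y j))" for x y
    unfolding UV cells_def sum_product by (subst sum.cartesian_product) (intro sum.cong refl, auto)
  then show ?thesis
    unfolding bilinear_form_def by (intro exI[of _ "\<lambda>(i, j). c i * d j"]) simp
qed

lemma bilinear_form_transpose:
  assumes "bilinear_form n m B"
  shows "bilinear_form m n (\<lambda>x y. B y x)"
proof -
  obtain b where b: "B = (\<lambda>x y. \<Sum>(i, j)\<in>cells n m. b (i, j) * (x i * y j))"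
    using assms unfolding bilinear_form_def by blast
  have "B y x = (\<Sum>(i, j)\<in>cells m n. b (j, i) * (x i * y j))" for x y
  proof -
    have "B y x = (\<Sum>i\<in>{1..n}. \<Sum>j\<in>{1..m}. b (i, j) * (y i * x j))"
      unfolding b cells_def by (rule sum.cartesian_product[symmetric])
    also have "\<dots> = (\<Sum>j\<in>{1..m}. \<Sum>i\<in>{1..n}. b (i, j) * (y i * x j))"
      by (rule sum.swap)
    also have "\<dots> = (\<Sum>(i, j)\<in>cells m n. b (j, i) * (x i * y j))"
      unfolding cells_def sum.cartesian_product by (intro sum.cong refl) (auto simp: mult.commute)
    finally show ?thesis .
  qed
  then show ?thesis
    unfolding bilinear_form_def by (intro exI[of _ "\<lambda>(i, j). b (j, i)"]) simp
qed

lemma sos_representable_transpose: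
  assumes "sos_representable n m P r"
  shows "sos_representable m n (\<lambda>x y. P y x) r"
proof -
  obtain B where B: "\<forall>k<r. bilinear_form n m (B k)" "P = (\<lambda>x y. \<Sum>k<r. (B k x y)\<^sup>2)"
    using assms unfolding sos_representable_def by blast
  show ?thesis unfolding sos_representable_def B(2)
    using B(1) bilinear_form_transpose by (intro exI[of _ "\<lambda>k x y. B k y x"]) auto
qed

lemma sos_representable_square:
  assumes "bilinear_form m n B"
  shows "sos_representable m n (\<lambda>x y. (B x y)\<^sup>2) 1"
  unfolding sos_representable_def using assms by (intro exI[of _ "\<lambda>_. B"]) simp

text \<open>Both factors are sums of two squares, hence so is the product (Brahmagupta's identity).\<close>

lemma sos_representable_two_squares:
  assumes U: "linear_comb m U" and V: "linear_comb m V" and ab: "a \<in> {1..n}" "b \<in> {1..n}" and c: "c\<^sup>2 \<le> 1"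
  shows "sos_representable m n (\<lambda>x y. ((U x)\<^sup>2 + (V x)\<^sup>2) * ((y a)\<^sup>2 + 2 * c * (y a * y b) + (y b)\<^sup>2)) 2"
proof -
  define s where "s = sqrt (1 - c\<^sup>2)"
  have s: "s\<^sup>2 = 1 - c\<^sup>2" using c by (simp add: s_def)
  have "bilinear_form m n (\<lambda>x y. U x * (y a + c * y b) + V x * (s * y b))"
    "bilinear_form m n (\<lambda>x y. V x * (y a + c * y b) + (-1) * (U x * (s * y b)))"
    by (intro bilinear_form_add bilinear_form_scale bilinear_form_mult linear_comb_intros U V ab)+
  from sos_representable_add[OF this[THEN sos_representable_square]]
  have "sos_representable m n (\<lambda>x y. (U x * (y a + c * y b) + V x * (s * y b))\<^sup>2 +
      (V x * (y a + c * y b) + (-1) * (U x * (s * y b)))\<^sup>2) 2"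
    by (simp add: numeral_2_eq_2)
  moreover have "(u * (p + c * q) + v * (s * q))\<^sup>2 + (v * (p + c * q) + (-1) * (u * (s * q)))\<^sup>2 =
      (u\<^sup>2 + v\<^sup>2) * (p\<^sup>2 + 2 * c * (p * q) + q\<^sup>2)" for u v p q
    using s by algebra
  ultimately show ?thesis by simp
qed

fun chain_sum :: "real list \<Rightarrow> real" where
  "chain_sum (p # q # ps) = p * q + chain_sum (q # ps)"
| "chain_sum ps = 0"

text \<open>This is the sum of the squares of the two-edges along the chain, of the two loose cells
  at its ends and of both cells of row \<open>l\<close>. The mixed part is the adjacency form of a
  path. In an eigenvector \<open>z\<close> of eigenvalue \<open>v\<close> it contributes
  \<open>z\<^sup>2 * ((y a)\<^sup>2 + v * (y a * y b) + (y b)\<^sup>2)\<close>, and two such terms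
  with equal eigenvalue together cost two squares. Row \<open>l\<close> provides an additional
  vector of eigenvalue 0.\<close>

definition chain_form :: "nat \<Rightarrow> nat list \<Rightarrow> nat \<Rightarrow> nat \<Rightarrow> form" where
  "chain_form l ps a b = (\<lambda>x y. ((x l)\<^sup>2 + (\<Sum>p\<leftarrow>ps. (x p)\<^sup>2)) * ((y a)\<^sup>2 + (y b)\<^sup>2) +
     2 * (y a * y b) * chain_sum (map x ps))"

text \<open>The eigenvalues are 1 and -1. The square of \<open>x l\<close> is divided equally
  between the two planes; its mixed terms cancel.\<close>

lemma chain_form_2:
  assumes "l \<in> {1..m}" "p \<in> {1..m}" "q \<in> {1..m}" and ab: "a \<in> {1..n}" "b \<in> {1..n}"
  shows "sos_representable m n (chain_form l [p, q] a b) 4"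
proof -
  define h :: real where "h = 1 / sqrt 2"
  have h: "h\<^sup>2 = 1 / 2" by (simp add: h_def power_divide)
  have "sos_representable m n (\<lambda>x y. ((h * (x p + x q))\<^sup>2 + (h * x l)\<^sup>2) * ((y a)\<^sup>2 + 2 * (1/2) * (y a * y b) + (y b)\<^sup>2)) 2"
    by (rule sos_representable_two_squares) (intro linear_comb_intros assms | simp add: power2_eq_square)+
  moreover have "sos_representable m n (\<lambda>x y. ((h * (x p - x q))\<^sup>2 + (h * x l)\<^sup>2) * ((y a)\<^sup>2 + 2 * (-1/2) * (y a * y b) + (y b)\<^sup>2)) 2"
    by (rule sos_representable_two_squares) (intro linear_comb_intros assms | simp add: power2_eq_square)+
  ultimately have "sos_representable m n (\<lambda>x y.
       ((h * (x p + x q))\<^sup>2 + (h * x l)\<^sup>2) * ((y a)\<^sup>2 + 2 * (1/2) * (y a * y b) + (y b)\<^sup>2) +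
       ((h * (x p - x q))\<^sup>2 + (h * x l)\<^sup>2) * ((y a)\<^sup>2 + 2 * (-1/2) * (y a * y b) + (y b)\<^sup>2)) (2 + 2)"
    by (rule sos_representable_add)
  moreover have "((h * (P + Q))\<^sup>2 + (h * L)\<^sup>2) * (A\<^sup>2 + 2 * (1/2) * (A * B) + B\<^sup>2) +
       ((h * (P - Q))\<^sup>2 + (h * L)\<^sup>2) * (A\<^sup>2 + 2 * (-1/2) * (A * B) + B\<^sup>2) =
       (L\<^sup>2 + (P\<^sup>2 + Q\<^sup>2)) * (A\<^sup>2 + B\<^sup>2) + 2 * (A * B) * (P * Q)" for P Q L A B
    unfolding power_mult_distrib h by (simp add: power2_eq_square field_simps)
  ultimately show ?thesis by (simp add: chain_form_def)
qed

text \<open>The eigenvector \<open>w\<close> for 0 shares its plane with \<open>x l\<close>, at the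
  cost of two squares. The rest involves only \<open>x q\<close> and \<open>s\<close>, with mixed
  coefficient \<open>2 * sqrt 2\<close>: the first square produces 2 of it, and
  \<open>c = sqrt 2 - 1\<close> the remainder in the second. The third square, with
  \<open>d\<close>, restores the coefficient of \<open>s\<^sup>2\<close>.\<close>

lemma chain_form_3:
  assumes "l \<in> {1..m}" "p \<in> {1..m}" "q \<in> {1..m}" "r \<in> {1..m}" and ab: "a \<in> {1..n}" "b \<in> {1..n}"
  shows "sos_representable m n (chain_form l [p, q, r] a b) 5"
proof -
  define h c d :: real where "h = 1 / sqrt 2" and "c = sqrt 2 - 1" and "d = sqrt (1 - c\<^sup>2)"
  have h: "h\<^sup>2 = 1 / 2" by (simp add: h_def power_divide)
  have hc: "2 * (h * (1 + c)) = 2" by (simp add: h_def c_def field_simps)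
  have "1 \<le> sqrt 2" "sqrt 2 \<le> 2" by (auto intro: real_le_rsqrt real_le_lsqrt)
  then have "0 \<le> c" "c \<le> 1" by (simp_all add: c_def)
  then have d: "d\<^sup>2 = 1 - c\<^sup>2" by (simp add: d_def power_le_one)
  define s w where "s x = h * (x p + x r)" and "w x = h * (x p - x r)" for x :: "nat \<Rightarrow> real"
  have "linear_comb m s" "linear_comb m w"
    unfolding s_def w_def by (intro linear_comb_intros assms)+
  note lin = this linear_comb_intros assms
  have "sos_representable m n (\<lambda>x y. ((x l)\<^sup>2 + (w x)\<^sup>2) * ((y a)\<^sup>2 + 2 * 0 * (y a * y b) + (y b)\<^sup>2)) 2"
    by (rule sos_representable_two_squares) (intro lin | simp)+
  moreover have "bilinear_form m n (\<lambda>x y. x q * y a + s x * y b)"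
    "bilinear_form m n (\<lambda>x y. x q * y b + s x * (c * y a))"
    "bilinear_form m n (\<lambda>x y. s x * (d * y a))"
    by (intro bilinear_form_add bilinear_form_mult lin)+
  note this[THEN sos_representable_square]
  ultimately have "sos_representable m n (\<lambda>x y. ((x l)\<^sup>2 + (w x)\<^sup>2) * ((y a)\<^sup>2 + 2 * 0 * (y a * y b) + (y b)\<^sup>2) +
      ((x q * y a + s x * y b)\<^sup>2 + ((x q * y b + s x * (c * y a))\<^sup>2 + (s x * (d * y a))\<^sup>2))) (2 + (1 + (1 + 1)))"
    by (intro sos_representable_add)
  moreover have "((x l)\<^sup>2 + (w x)\<^sup>2) * ((y a)\<^sup>2 + 2 * 0 * (y a * y b) + (y b)\<^sup>2) +
      ((x q * y a + s x * y b)\<^sup>2 + ((x q * y b + s x * (c * y a))\<^sup>2 + (s x * (d * y a))\<^sup>2)) =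
      chain_form l [p, q, r] a b x y" for x y
  proof -
    have sw: "(s x)\<^sup>2 + (w x)\<^sup>2 = (x p)\<^sup>2 + (x r)\<^sup>2"
      unfolding s_def w_def power_mult_distrib h by (simp add: power2_eq_square field_simps)
    have "((x l)\<^sup>2 + (w x)\<^sup>2) * ((y a)\<^sup>2 + 2 * 0 * (y a * y b) + (y b)\<^sup>2) +
      ((x q * y a + s x * y b)\<^sup>2 + ((x q * y b + s x * (c * y a))\<^sup>2 + (s x * (d * y a))\<^sup>2)) =
      ((x l)\<^sup>2 + (x q)\<^sup>2 + ((s x)\<^sup>2 + (w x)\<^sup>2)) * ((y a)\<^sup>2 + (y b)\<^sup>2) + 2 * (y a * y b) * (x q * ((1 + c) * s x))"
      using d by algebra
    also have "(1 + c) * s x = x p + x r"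
    proof -
      have "h * (1 + c) = 1" using hc by simp
      then show ?thesis unfolding s_def by algebra
    qed
    finally show ?thesis unfolding sw by (simp add: chain_form_def algebra_simps)
  qed
  ultimately show ?thesis by (simp add: numeral_eq_Suc)
qed

text \<open>The eigenvalues of the path on four vertices are \<open>\<plusminus>\<phi>\<close> and \<open>\<plusminus>1/\<phi>\<close> for the golden ratio \<open>\<phi>\<close>.
  The eigenvectors of \<open>\<plusminus>1/\<phi>\<close> are distributed over the three planes that belong to \<open>\<phi>\<close>, \<open>0\<close> and \<open>-\<phi>\<close>.\<close>

lemma chain_form_4:
  assumes "l \<in> {1..m}" "p \<in> {1..m}" "q \<in> {1..m}" "r \<in> {1..m}" "t \<in> {1..m}" and ab: "a \<in> {1..n}" "b \<in> {1..n}"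
  shows "sos_representable m n (chain_form l [p, q, r, t] a b) 6"
proof -
  define f N h d :: real where "f = (1 + sqrt 5) / 2" and "N = 1 / sqrt (f + 2)" and "h = 1 / sqrt 2"
    and "d = sqrt ((3 * f - 4) / 2)"
  have f2: "f\<^sup>2 = f + 1" by (simp add: f_def power2_eq_square field_simps)
  have "2 \<le> sqrt 5" "sqrt 5 \<le> 3" by (auto intro: real_le_rsqrt real_le_lsqrt)
  then have f: "3 / 2 \<le> f" "f \<le> 2" by (simp_all add: f_def)
  have N: "N\<^sup>2 * (f + 2) = 1" using f by (simp add: N_def power_divide)
  have h: "h\<^sup>2 = 1 / 2" by (simp add: h_def power_divide)
  have d: "d\<^sup>2 = (3 * f - 4) / 2" using f by (simp add: d_def)
  define s1 s2 t1 t2 where "s1 x = h * (x p + x t)" and "s2 x = h * (x q + x r)"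
    and "t1 x = h * (x p - x t)" and "t2 x = h * (x q - x r)" for x :: "nat \<Rightarrow> real"
  have "linear_comb m s1" "linear_comb m s2" "linear_comb m t1" "linear_comb m t2"
    unfolding s1_def s2_def t1_def t2_def by (intro linear_comb_intros assms)+
  note lin1 = this linear_comb_intros assms
  \<comment> \<open>Coordinates along unit eigenvectors for \<open>f\<close>, \<open>-1/f\<close>,
    \<open>-f\<close> and \<open>1/f\<close>, in this order; \<open>N\<close> normalises them
    because \<open>1 + f\<^sup>2 = f + 2\<close>.\<close>
  define z1 z4 z5 z2 where "z1 x = N * (s1 x + f * s2 x)" and "z4 x = N * (f * s1 x - s2 x)"
    and "z5 x = N * (t1 x - f * t2 x)" and "z2 x = N * (f * t1 x + t2 x)" for x
  have "linear_comb m z1" "linear_comb m z2" "linear_comb m z4" "linear_comb m z5"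
    unfolding z1_def z2_def z4_def z5_def by (intro lin1)+
  note lin2 = this linear_comb_intros assms
  \<comment> \<open>The coefficients solve two conditions: the squares of \<open>e1\<close>,
    \<open>e5\<close>, \<open>e0\<close> must add up to those of \<open>z2\<close> and
    \<open>z4\<close>, and their mixed terms, weighted by \<open>f\<close>, \<open>-f\<close> and 0,
    must reproduce the eigenvalues \<open>1/f = f - 1\<close> and \<open>-1/f\<close>.\<close>
  define A B where "A = (3 - f) / 2" and "B = (f - 1) / 2"
  have AB: "2 * A = 3 - f" "2 * B = f - 1" and d': "2 * d\<^sup>2 = 3 * f - 4"
    by (simp_all add: A_def B_def d)
  define e1 e5 e0 where "e1 x = A * z2 x + B * z4 x" and "e5 x = B * z2 x + A * z4 x"
    and "e0 x = d * (z2 x - z4 x)" for x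
  have "linear_comb m e1" "linear_comb m e5" "linear_comb m e0"
    unfolding e1_def e5_def e0_def by (intro lin2)+
  note lin = this lin2
  have c: "(f / 2)\<^sup>2 \<le> 1" "(- f / 2)\<^sup>2 \<le> 1" using f f2 by (simp_all add: power_divide)
  have "sos_representable m n (\<lambda>x y. ((z1 x)\<^sup>2 + (e1 x)\<^sup>2) * ((y a)\<^sup>2 + 2 * (f/2) * (y a * y b) + (y b)\<^sup>2)) 2"
    "sos_representable m n (\<lambda>x y. ((z5 x)\<^sup>2 + (e5 x)\<^sup>2) * ((y a)\<^sup>2 + 2 * (-f/2) * (y a * y b) + (y b)\<^sup>2)) 2"
    "sos_representable m n (\<lambda>x y. ((x l)\<^sup>2 + (e0 x)\<^sup>2) * ((y a)\<^sup>2 + 2 * 0 * (y a * y b) + (y b)\<^sup>2)) 2"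
    by (rule sos_representable_two_squares; (intro lin c | simp))+
  then have "sos_representable m n (\<lambda>x y. ((z1 x)\<^sup>2 + (e1 x)\<^sup>2) * ((y a)\<^sup>2 + 2 * (f/2) * (y a * y b) + (y b)\<^sup>2) +
      (((z5 x)\<^sup>2 + (e5 x)\<^sup>2) * ((y a)\<^sup>2 + 2 * (-f/2) * (y a * y b) + (y b)\<^sup>2) +
      ((x l)\<^sup>2 + (e0 x)\<^sup>2) * ((y a)\<^sup>2 + 2 * 0 * (y a * y b) + (y b)\<^sup>2))) (2 + (2 + 2))"
    by (intro sos_representable_add)
  moreover have "((z1 x)\<^sup>2 + (e1 x)\<^sup>2) * ((y a)\<^sup>2 + 2 * (f/2) * (y a * y b) + (y b)\<^sup>2) +
      (((z5 x)\<^sup>2 + (e5 x)\<^sup>2) * ((y a)\<^sup>2 + 2 * (-f/2) * (y a * y b) + (y b)\<^sup>2) +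
      ((x l)\<^sup>2 + (e0 x)\<^sup>2) * ((y a)\<^sup>2 + 2 * 0 * (y a * y b) + (y b)\<^sup>2)) =
      chain_form l [p, q, r, t] a b x y" for x y
  proof -
    have st: "(s1 x)\<^sup>2 + (t1 x)\<^sup>2 = (x p)\<^sup>2 + (x t)\<^sup>2" "(s2 x)\<^sup>2 + (t2 x)\<^sup>2 = (x q)\<^sup>2 + (x r)\<^sup>2"
      "2 * (s1 x * s2 x) + 2 * (t1 x * t2 x) + (s2 x)\<^sup>2 - (t2 x)\<^sup>2 = 2 * (x p * x q + x q * x r + x r * x t)"
      using h unfolding s1_def s2_def t1_def t2_def power_mult_distrib by algebra+
    have e: "(e1 x)\<^sup>2 + (e5 x)\<^sup>2 + (e0 x)\<^sup>2 = (z2 x)\<^sup>2 + (z4 x)\<^sup>2"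
    proof -
      have "4 * ((e1 x)\<^sup>2 + (e5 x)\<^sup>2 + (e0 x)\<^sup>2) = 4 * ((z2 x)\<^sup>2 + (z4 x)\<^sup>2)"
        using AB d' f2 unfolding e1_def e5_def e0_def by algebra
      then show ?thesis by simp
    qed
    have e': "f * ((e1 x)\<^sup>2 - (e5 x)\<^sup>2) = (f - 1) * ((z2 x)\<^sup>2 - (z4 x)\<^sup>2)"
    proof -
      have "4 * (f * ((e1 x)\<^sup>2 - (e5 x)\<^sup>2)) = 4 * ((f - 1) * ((z2 x)\<^sup>2 - (z4 x)\<^sup>2))"
        using AB f2 unfolding e1_def e5_def by algebra
      then show ?thesis by simp
    qed
    have z: "(z1 x)\<^sup>2 + (z4 x)\<^sup>2 = (s1 x)\<^sup>2 + (s2 x)\<^sup>2" "(z5 x)\<^sup>2 + (z2 x)\<^sup>2 = (t1 x)\<^sup>2 + (t2 x)\<^sup>2"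
      using N f2 unfolding z1_def z2_def z4_def z5_def by algebra+
    have z': "f * (z1 x)\<^sup>2 - (f - 1) * (z4 x)\<^sup>2 = 2 * (s1 x * s2 x) + (s2 x)\<^sup>2"
      "f * (z5 x)\<^sup>2 - (f - 1) * (z2 x)\<^sup>2 = - (2 * (t1 x * t2 x)) + (t2 x)\<^sup>2"
      using N f2 unfolding z1_def z2_def z4_def z5_def by algebra+
    have "((z1 x)\<^sup>2 + (e1 x)\<^sup>2) * ((y a)\<^sup>2 + 2 * (f/2) * (y a * y b) + (y b)\<^sup>2) +
      (((z5 x)\<^sup>2 + (e5 x)\<^sup>2) * ((y a)\<^sup>2 + 2 * (-f/2) * (y a * y b) + (y b)\<^sup>2) +
      ((x l)\<^sup>2 + (e0 x)\<^sup>2) * ((y a)\<^sup>2 + 2 * 0 * (y a * y b) + (y b)\<^sup>2)) =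
      ((x l)\<^sup>2 + (z1 x)\<^sup>2 + (z5 x)\<^sup>2 + ((e1 x)\<^sup>2 + (e5 x)\<^sup>2 + (e0 x)\<^sup>2)) * ((y a)\<^sup>2 + (y b)\<^sup>2) +
      (y a * y b) * (f * (z1 x)\<^sup>2 - f * (z5 x)\<^sup>2 + f * ((e1 x)\<^sup>2 - (e5 x)\<^sup>2))"
      by (simp add: field_simps)
    also have "(x l)\<^sup>2 + (z1 x)\<^sup>2 + (z5 x)\<^sup>2 + ((e1 x)\<^sup>2 + (e5 x)\<^sup>2 + (e0 x)\<^sup>2) =
        (x l)\<^sup>2 + ((x p)\<^sup>2 + (x q)\<^sup>2 + (x r)\<^sup>2 + (x t)\<^sup>2)"
      using e z st by linarith
    also have "f * (z1 x)\<^sup>2 - f * (z5 x)\<^sup>2 + f * ((e1 x)\<^sup>2 - (e5 x)\<^sup>2) = 2 * (x p * x q + x q * x r + x r * x t)"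
      using e' z' st(3) by (simp add: algebra_simps)
    finally show ?thesis by (simp add: chain_form_def algebra_simps)
  qed
  ultimately show ?thesis by (simp add: numeral_eq_Suc)
qed

subsection \<open>Reducibility certificates\<close>

text \<open>\<open>Regroup K Ls\<close>: the squares of the two-edges \<open>K\<close> and of the remaining cells of \<open>Ls\<close>, which are
  one-edges, sum up to the squares of the fewer linear combinations \<open>Ls\<close> of cells.
  \<open>Relation R\<close>: the sum of \<open>c F\<^sub>e F\<^sub>f\<close> over all \<open>(e, f, c)\<close> in \<open>R\<close> vanishes, where \<open>F\<^sub>e\<close> is the form of the
  edge with the list \<open>e\<close> of cells.
  \<open>Chain t ps l a b\<close>: the two-edges join the cell of each row in \<open>ps\<close> in column \<open>a\<close> to the cell of the next
  row in column \<open>b\<close>, the two unused cells of these rows are one-edges, and so are both cells of row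
  \<open>l\<close>; rows and columns are exchanged if \<open>t\<close> is true.\<close>

datatype certificate =
    Regroup "(cell \<times> cell) list" "(cell \<times> int) list list"
  | Relation "(cell list \<times> cell list \<times> int) list"
  | Chain bool "nat list" nat nat nat

text \<open>The indices are sorted, so that equal monomials have equal names; in particular the two
  diagonals of a rectangle yield the same one.\<close>

fun cell_monomial :: "cell \<Rightarrow> cell \<Rightarrow> (nat \<times> nat) \<times> nat \<times> nat" where
  "cell_monomial (i, j) (k, l) = ((min i k, max i k), (min j l, max j l))"

fun square_terms :: "int \<Rightarrow> (cell \<times> int) list \<Rightarrow> (((nat \<times> nat) \<times> nat \<times> nat) \<times> int) list" where
  "square_terms s [] = []"
| "square_terms s ((p, a) # L) = (cell_monomial p p, s * a * a) #
     map (\<lambda>(q, b). (cell_monomial p q, 2 * s * a * b)) L @ square_terms s L"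

definition product_terms :: "int \<Rightarrow> cell list \<Rightarrow> cell list \<Rightarrow> (((nat \<times> nat) \<times> nat \<times> nat) \<times> int) list" where
  "product_terms c e f = concat (map (\<lambda>p. map (\<lambda>q. (cell_monomial p q, c)) f) e)"

fun vanishing :: "('a \<times> int) list \<Rightarrow> bool" where
  "vanishing [] \<longleftrightarrow> True"
| "vanishing ((m, a) # ts) \<longleftrightarrow> a + sum_list (map snd (filter (\<lambda>t. fst t = m) ts)) = 0 \<and>
     vanishing (filter (\<lambda>t. fst t \<noteq> m) ts)"

definition orient :: "bool \<Rightarrow> nat \<Rightarrow> nat \<Rightarrow> cell" where
  "orient t i j = (if t then (j, i) else (i, j))"

fun chain_edges :: "bool \<Rightarrow> nat list \<Rightarrow> nat \<Rightarrow> nat \<Rightarrow> (cell \<times> cell) list" where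
  "chain_edges t (p # q # ps) a b = (orient t p a, orient t q b) # chain_edges t (q # ps) a b"
| "chain_edges t ps a b = []"

fun pattern :: "certificate \<Rightarrow> (cell \<times> cell) list" where
  "pattern (Regroup K Ls) = K"
| "pattern (Relation R) = concat (map (\<lambda>(e, f, c). map (\<lambda>g. (hd g, hd (tl g))) (filter (\<lambda>g. length g = 2) [e, f])) R)"
| "pattern (Chain t ps l a b) = chain_edges t ps a b"

text \<open>The last clause for \<open>Relation\<close> ensures that the relation is nontrivial:
  every later product misses the first cell of \<open>e\<close> or the first cell of
  \<open>f\<close>, so none repeats the leading product. For \<open>Chain\<close> only the four
  one-edges are tested; the presence of the two-edges comes from \<open>pattern\<close>.\<close>

fun valid :: "certificate \<Rightarrow> bool" where
  "valid (Regroup K Ls) \<longleftrightarrow>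
    (let C = map fst (concat Ls); D = flat_pairs K; S = filter (\<lambda>p. p \<notin> set D) C in
     distinct C \<and> distinct D \<and> list_all (\<lambda>p. p \<in> set C) D \<and> list_all (\<lambda>p. p \<in> set std_ones) S \<and>
     length Ls < length K + length S \<and>
     vanishing (concat (map (square_terms 1) Ls) @ concat (map (\<lambda>(p, q). square_terms (-1) [(p, 1), (q, 1)]) K) @
        concat (map (\<lambda>p. square_terms (-1) [(p, 1)]) S)))"
| "valid (Relation R) \<longleftrightarrow>
    vanishing (concat (map (\<lambda>(e, f, c). product_terms c e f) R)) \<and>
    list_all (\<lambda>(e, f, c). list_all (\<lambda>g. length g = 1 \<and> hd g \<in> set std_ones \<or> length g = 2 \<and> hd g \<noteq> hd (tl g)) [e, f] \<and>
      list_all (\<lambda>p. p \<notin> set f) e) R \<and>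
    (case R of [] \<Rightarrow> False | (e, f, c) # R' \<Rightarrow> c \<noteq> 0 \<and>
      list_all (\<lambda>(e', f', c'). hd e \<notin> set (e' @ f') \<or> hd f \<notin> set (e' @ f')) R')"
| "valid (Chain t ps l a b) \<longleftrightarrow>
    2 \<le> length ps \<and> length ps \<le> 4 \<and> distinct (l # ps) \<and> a \<noteq> b \<and>
    list_all (\<lambda>p. p \<in> set std_ones) [orient t l a, orient t l b, orient t (hd ps) b, orient t (last ps) a]"

section \<open>Evaluating the terms and soundness of the certificates\<close>

fun cell_value :: "(nat \<Rightarrow> real) \<Rightarrow> (nat \<Rightarrow> real) \<Rightarrow> cell \<Rightarrow> real" where
  "cell_value x y (i, j) = x i * y j"

definition terms_value :: "(nat \<Rightarrow> real) \<Rightarrow> (nat \<Rightarrow> real) \<Rightarrow> (((nat \<times> nat) \<times> nat \<times> nat) \<times> int) list \<Rightarrow> real" where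
  "terms_value x y ts = (\<Sum>(((i, k), (j, l)), a)\<leftarrow>ts. of_int a * (x i * x k * (y j * y l)))"

definition lin_value :: "(nat \<Rightarrow> real) \<Rightarrow> (nat \<Rightarrow> real) \<Rightarrow> (cell \<times> int) list \<Rightarrow> real" where
  "lin_value x y L = (\<Sum>(p, a)\<leftarrow>L. of_int a * cell_value x y p)"

lemma terms_value_Nil [simp]: "terms_value x y [] = 0"
  by (simp add: terms_value_def)

lemma terms_value_Cons [simp]:
  "terms_value x y ((cell_monomial p q, a) # ts) = of_int a * (cell_value x y p * cell_value x y q) + terms_value x y ts"
proof -
  obtain i j k l where pq: "p = (i, j)" "q = (k, l)" by (cases p, cases q)
  have "x (min i k) * x (max i k) = x i * x k" "y (min j l) * y (max j l) = y j * y l"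
    by (simp_all add: min_def max_def)
  then show ?thesis by (simp add: terms_value_def pq mult_ac)
qed

lemma terms_value_append [simp]: "terms_value x y (ts @ us) = terms_value x y ts + terms_value x y us"
  by (simp add: terms_value_def)

lemma terms_value_concat: "terms_value x y (concat tss) = (\<Sum>ts\<leftarrow>tss. terms_value x y ts)"
  by (induction tss) simp_all

lemma terms_value_filter:
  "terms_value x y ts = of_int (sum_list (map snd (filter (\<lambda>t. fst t = m) ts))) *
     (x (fst (fst m)) * x (snd (fst m)) * (y (fst (snd m)) * y (snd (snd m)))) +
     terms_value x y (filter (\<lambda>t. fst t \<noteq> m) ts)"
  by (induction ts) (auto simp: terms_value_def algebra_simps)

lemma vanishing_terms_value: "vanishing ts \<Longrightarrow> terms_value x y ts = 0"
proof (induction ts rule: vanishing.induct)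
  case (2 m a ts)
  obtain i k j l where m: "m = ((i, k), (j, l))" by (cases m) auto
  have "terms_value x y ((m, a) # ts) = of_int (a + sum_list (map snd (filter (\<lambda>t. fst t = m) ts))) *
     (x i * x k * (y j * y l)) + terms_value x y (filter (\<lambda>t. fst t \<noteq> m) ts)"
    using terms_value_filter[of x y ts m] by (simp add: terms_value_def m algebra_simps)
  then show ?case using 2 by (simp only: vanishing.simps)
qed simp

lemma terms_value_square: "terms_value x y (square_terms s L) = of_int s * (lin_value x y L)\<^sup>2"
proof (induction s L rule: square_terms.induct)
  case (2 s p a L)
  have "terms_value x y (map (\<lambda>(q, b). (cell_monomial p q, 2 * s * a * b)) L) =
      of_int (2 * s * a) * cell_value x y p * lin_value x y L"
    by (induction L) (auto simp: lin_value_def algebra_simps)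
  then show ?case using 2 by (simp add: lin_value_def power2_eq_square algebra_simps)
qed (simp add: lin_value_def)

lemma terms_value_product:
  "terms_value x y (product_terms c e f) = of_int c * ((\<Sum>p\<leftarrow>e. cell_value x y p) * (\<Sum>q\<leftarrow>f. cell_value x y q))"
proof -
  have "terms_value x y (map (\<lambda>q. (cell_monomial p q, c)) f) = of_int c * (cell_value x y p * (\<Sum>q\<leftarrow>f. cell_value x y q))" for p
    by (induction f) (simp_all add: algebra_simps)
  then show ?thesis
    unfolding product_terms_def terms_value_concat by (induction e) (simp_all add: algebra_simps)
qed

lemma edge_form_distinct: "distinct e \<Longrightarrow> edge_form (set e) x y = (\<Sum>p\<leftarrow>e. cell_value x y p)"
proof -
  have "cell_value x y = (\<lambda>(i, j). x i * y j)" by auto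
  then show "distinct e \<Longrightarrow> ?thesis"
    by (simp add: edge_form_def sum_list_distinct_conv_sum_set)
qed

definition reducible :: "configuration \<Rightarrow> bool" where
  "reducible G \<longleftrightarrow> sos_representable 7 4 (config_form G) (num_squares G - 1)"

lemma pattern_Relation:
  assumes "(e, f, c) \<in> set R" "e = [p, q] \<or> f = [p, q]"
  shows "(p, q) \<in> set (pattern (Relation R))"
proof -
  have "(p, q) \<in> (\<lambda>g. (hd g, hd (tl g))) ` set (filter (\<lambda>g. length g = 2) [e, f])"
    by (rule image_eqI[of _ _ "[p, q]"]) (use assms(2) in auto)
  then show ?thesis
    unfolding pattern.simps set_concat set_map image_image using assms(1)
    by (intro UN_I[of "(e, f, c)"]) (simp_all del: filter.simps)
qed

locale standard =
  fixes G :: configuration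
  assumes conf: "is_configuration 7 4 G" and simple: "simple G" and ones: "one_edges G = set std_ones"
begin

lemma ones_cells: "p \<in> set std_ones \<Longrightarrow> p \<in> cells 7 4"
  using conf ones by (auto simp: is_configuration_def)

lemma two_edge_cells: "{p, q} \<in> two_edges G \<Longrightarrow> p \<in> cells 7 4 \<and> q \<in> cells 7 4"
  using conf by (auto simp: is_configuration_def)

lemma sos_lin_values:
  assumes "\<And>L. L \<in> set Ls \<Longrightarrow> set (map fst L) \<subseteq> cells 7 4"
  shows "sos_representable 7 4 (\<lambda>x y. \<Sum>L\<leftarrow>Ls. (lin_value x y L)\<^sup>2) (length Ls)"
proof -
  have "bilinear_form 7 4 (\<lambda>x y. lin_value x y L)" if "set (map fst L) \<subseteq> cells 7 4" for L
    using that
  proof (induction L)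
    case (Cons t L)
    obtain i j a where t: "t = ((i, j), a)" by (cases t) auto
    have "bilinear_form 7 4 (\<lambda>x y. of_int a * (x i * y j) + lin_value x y L)"
      using Cons by (intro bilinear_form_add bilinear_form_scale bilinear_form_cell) (auto simp: t)
    then show ?case by (simp add: t lin_value_def)
  qed (simp add: lin_value_def bilinear_form_0)
  then show ?thesis
    unfolding sos_representable_def using assms
    by (intro exI[of _ "\<lambda>k x y. lin_value x y (Ls ! k)"])
       (simp add: sum_list_sum_nth atLeast0LessThan)
qed

text \<open>Translates from the lists of a certificate, \<open>S\<close> for one-edges and
  \<open>K\<close> for two-edges, to the sets of edges in
  \<open>sos_representable_replace\<close>.\<close>

lemma reducible_replace:
  assumes dS: "distinct S" and S: "set S \<subseteq> set std_ones" and dK: "distinct (flat_pairs K)"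
    and K: "\<And>p q. (p, q) \<in> set K \<Longrightarrow> {p, q} \<in> two_edges G"
    and sos: "sos_representable 7 4 (\<lambda>x y. (\<Sum>p\<leftarrow>S. (cell_value x y p)\<^sup>2) +
      (\<Sum>(p, q)\<leftarrow>K. (cell_value x y p + cell_value x y q)\<^sup>2)) r" and r: "r < length K + length S"
  shows "reducible G"
proof -
  define H2 where "H2 = (\<lambda>(p, q). {p, q}) ` set K"
  define H1 where "H1 = (\<lambda>p. {p}) ` set S"
  note pairs = distinct_flat_pairs[OF dK]
  have sub: "H1 \<union> H2 \<subseteq> selected_edges G"
    using S K by (auto simp: H1_def H2_def selected_edges_def ones)
  have "e \<noteq> {p}" if "e \<in> H2" for e p
  proof -
    obtain q q' where "(q, q') \<in> set K" "e = {q, q'}" using \<open>e \<in> H2\<close> by (auto simp: H2_def)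
    then show ?thesis using pairs(1)[of q q'] by auto
  qed
  then have disj: "H1 \<inter> H2 = {}" by (auto simp: H1_def)
  have fin: "finite H1" "finite H2" by (simp_all add: H1_def H2_def)
  have "card H2 = length K"
    using distinct_card[OF pairs(3)] by (simp add: H2_def)
  moreover have "card H1 = length S"
    using dS by (simp add: H1_def card_image distinct_card)
  ultimately have card: "card (H1 \<union> H2) = length K + length S"
    using disj fin by (simp add: card_Un_disjoint)
  have "(\<Sum>e\<in>H1 \<union> H2. (edge_form e x y)\<^sup>2) =
      (\<Sum>p\<leftarrow>S. (cell_value x y p)\<^sup>2) + (\<Sum>(p, q)\<leftarrow>K. (cell_value x y p + cell_value x y q)\<^sup>2)" for x y
  proof -
    have "(\<Sum>e\<in>H1 \<union> H2. (edge_form e x y)\<^sup>2) = (\<Sum>e\<in>H1. (edge_form e x y)\<^sup>2) + (\<Sum>e\<in>H2. (edge_form e x y)\<^sup>2)"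
      using fin disj by (rule sum.union_disjoint)
    also have "(\<Sum>e\<in>H1. (edge_form e x y)\<^sup>2) = (\<Sum>p\<leftarrow>S. (cell_value x y p)\<^sup>2)"
    proof -
      have "(\<Sum>e\<in>H1. (edge_form e x y)\<^sup>2) = (\<Sum>p\<in>set S. (cell_value x y p)\<^sup>2)"
        unfolding H1_def by (subst sum.reindex) (auto simp: edge_form_def intro!: sum.cong)
      then show ?thesis using dS by (simp add: sum_list_distinct_conv_sum_set)
    qed
    also have "(\<Sum>e\<in>H2. (edge_form e x y)\<^sup>2) = (\<Sum>(p, q)\<leftarrow>K. (cell_value x y p + cell_value x y q)\<^sup>2)"
    proof -
      have inj: "inj_on (\<lambda>(p, q). {p, q}) (set K)" and dK: "distinct K"
        using pairs(3) by (simp_all add: distinct_map)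
      have "(\<Sum>e\<in>H2. (edge_form e x y)\<^sup>2) = (\<Sum>(p, q)\<in>set K. (cell_value x y p + cell_value x y q)\<^sup>2)"
        unfolding H2_def
      proof (subst sum.reindex[OF inj], intro sum.cong refl)
        fix z assume z: "z \<in> set K"
        obtain p q where pq: "z = (p, q)" by (cases z)
        have "p \<noteq> q" using pairs(1) z pq by blast
        then show "((\<lambda>e. (edge_form e x y)\<^sup>2) \<circ> (\<lambda>(p, q). {p, q})) z = (case z of (p, q) \<Rightarrow> (cell_value x y p + cell_value x y q)\<^sup>2)"
          using edge_form_distinct[of "[p, q]" x y] by (simp add: pq)
      qed
      then show ?thesis using dK by (simp add: sum_list_distinct_conv_sum_set)
    qed
    finally show ?thesis .
  qed
  with sos have "sos_representable 7 4 (\<lambda>x y. \<Sum>e\<in>H1 \<union> H2. (edge_form e x y)\<^sup>2) r" by simp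
  then show ?thesis
    unfolding reducible_def by (rule sos_representable_replace[OF conf sub]) (simp add: card r)
qed

lemma reducible_Regroup:
  assumes valid: "valid (Regroup K Ls)" and K: "\<And>p q. (p, q) \<in> set K \<Longrightarrow> {p, q} \<in> two_edges G"
  shows "reducible G"
proof -
  define C where "C = map fst (concat Ls)"
  define D where "D = flat_pairs K"
  define S where "S = filter (\<lambda>p. p \<notin> set D) C"
  have v: "distinct C" "distinct D" "set D \<subseteq> set C" "set S \<subseteq> set std_ones" "length Ls < length K + length S"
    "vanishing (concat (map (square_terms 1) Ls) @ concat (map (\<lambda>(p, q). square_terms (-1) [(p, 1), (q, 1)]) K) @
        concat (map (\<lambda>p. square_terms (-1) [(p, 1)]) S))"
    using valid unfolding valid.simps Let_def C_def[symmetric] D_def[symmetric] S_def[symmetric] list_all_iff by blast+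
  have eq: "(\<Sum>p\<leftarrow>S. (cell_value x y p)\<^sup>2) + (\<Sum>(p, q)\<leftarrow>K. (cell_value x y p + cell_value x y q)\<^sup>2) =
      (\<Sum>L\<leftarrow>Ls. (lin_value x y L)\<^sup>2)" for x y
  proof -
    have 1: "terms_value x y (concat (map (square_terms 1) Ls)) = (\<Sum>L\<leftarrow>Ls. (lin_value x y L)\<^sup>2)"
      by (simp add: terms_value_concat terms_value_square o_def)
    have 2: "terms_value x y (concat (map (\<lambda>p. square_terms (-1) [(p, 1)]) S)) = - (\<Sum>p\<leftarrow>S. (cell_value x y p)\<^sup>2)" for S
      by (induction S) (simp_all add: terms_value_square lin_value_def del: square_terms.simps)
    have 3: "terms_value x y (concat (map (\<lambda>(p, q). square_terms (-1) [(p, 1), (q, 1)]) K)) =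
        - (\<Sum>(p, q)\<leftarrow>K. (cell_value x y p + cell_value x y q)\<^sup>2)" for K
      by (induction K) (auto simp: terms_value_square lin_value_def simp del: square_terms.simps)
    show ?thesis
      using vanishing_terms_value[OF v(6), of x y] unfolding terms_value_append 1 2 3 by simp
  qed
  have "set (map fst L) \<subseteq> cells 7 4" if "L \<in> set Ls" for L
  proof
    fix p assume "p \<in> set (map fst L)"
    then have "p \<in> set C" using that by (force simp: C_def)
    then consider "p \<in> set S" | "p \<in> set D" by (auto simp: S_def)
    then show "p \<in> cells 7 4"
    proof cases
      case 1
      then show ?thesis using v(4) ones_cells by blast
    next
      case 2
      then show ?thesis using K two_edge_cells by (force simp: D_def set_flat_pairs)
    qed
  qed
  then have "sos_representable 7 4 (\<lambda>x y. \<Sum>L\<leftarrow>Ls. (lin_value x y L)\<^sup>2) (length Ls)"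
    by (rule sos_lin_values)
  then have "sos_representable 7 4 (\<lambda>x y. (\<Sum>p\<leftarrow>S. (cell_value x y p)\<^sup>2) +
      (\<Sum>(p, q)\<leftarrow>K. (cell_value x y p + cell_value x y q)\<^sup>2)) (length Ls)"
    unfolding eq .
  moreover have "distinct S" using v(1) by (simp add: S_def)
  ultimately show ?thesis
    using v K unfolding D_def by (intro reducible_replace[of S K "length Ls"])
qed

lemma reducible_Relation:
  assumes valid: "valid (Relation R)" and K: "\<And>p q. (p, q) \<in> set (pattern (Relation R)) \<Longrightarrow> {p, q} \<in> two_edges G"
  shows "reducible G"
proof -
  let ?A = "selected_edges G"
  have fin: "finite ?A" using finite_configuration[OF conf] by simp
  obtain e0 f0 c0 R' where R: "R = (e0, f0, c0) # R'"
    using valid by (cases R) auto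
  have van: "vanishing (concat (map (\<lambda>(e, f, c). product_terms c e f) R))"
    and shape: "\<forall>(e, f, c)\<in>set R. (\<forall>g\<in>{e, f}. length g = 1 \<and> hd g \<in> set std_ones \<or> length g = 2 \<and> hd g \<noteq> hd (tl g)) \<and> set e \<inter> set f = {}"
    and c0: "c0 \<noteq> 0" and other: "\<forall>(e', f', c')\<in>set R'. hd e0 \<notin> set (e' @ f') \<or> hd f0 \<notin> set (e' @ f')"
    using valid by (auto simp: R list_all_iff)
  have edge: "set g \<in> ?A" "distinct g" "g \<noteq> []" if "(e, f, c) \<in> set R" "g = e \<or> g = f" for e f c g
  proof -
    have g: "length g = 1 \<and> hd g \<in> set std_ones \<or> length g = 2 \<and> hd g \<noteq> hd (tl g)"
      using shape that by fastforce
    then show "g \<noteq> []" "distinct g" by (auto simp: length_Suc_conv numeral_2_eq_2)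
    show "set g \<in> ?A"
      using g
    proof
      assume "length g = 1 \<and> hd g \<in> set std_ones"
      then show ?thesis by (auto simp: length_Suc_conv selected_edges_def ones)
    next
      assume g2: "length g = 2 \<and> hd g \<noteq> hd (tl g)"
      then obtain p q where pq: "g = [p, q]" by (auto simp: length_Suc_conv numeral_2_eq_2)
      have "(p, q) \<in> set (pattern (Relation R))"
        using pattern_Relation[OF that(1)] that(2) pq by blast
      then show ?thesis using K pq by (simp add: selected_edges_def)
    qed
  qed
  \<comment> \<open>The symmetric matrix, indexed by edges, of the quadratic relation; each product
    is entered in both orders, which accounts for the factor 2 below.\<close>
  define S :: "cell set \<Rightarrow> cell set \<Rightarrow> real" where
    "S a b = (\<Sum>(e, f, c)\<leftarrow>R. of_int c * (of_bool (a = set e \<and> b = set f) + of_bool (a = set f \<and> b = set e)))"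
    for a b
  have sym: "S a b = S b a" for a b
    unfolding S_def by (intro arg_cong[where f = sum_list] map_cong refl) (auto simp: add.commute conj_commute)
  have quad: "quad ?A S v = (\<Sum>(e, f, c)\<leftarrow>R. 2 * of_int c * (v (set e) * v (set f)))" for v
  proof -
    have "(\<Sum>a\<in>?A. \<Sum>b\<in>?A. (\<Sum>(e, f, c)\<leftarrow>Q. of_int c * (of_bool (a = set e \<and> b = set f) + of_bool (a = set f \<and> b = set e))) * v a * v b) =
        (\<Sum>(e, f, c)\<leftarrow>Q. 2 * of_int c * (v (set e) * v (set f)))" if "set Q \<subseteq> set R" for Q
      using that
    proof (induction Q)
      case (Cons t Q)
      obtain e f c where t: "t = (e, f, c)" by (cases t)
      have ef: "set e \<in> ?A" "set f \<in> ?A" using Cons.prems edge(1)[of e f c] by (auto simp: t)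
      have one: "(\<Sum>a\<in>?A. \<Sum>b\<in>?A. of_bool (a = g \<and> b = h) * v a * v b) = v g * v h" if "g \<in> ?A" "h \<in> ?A" for g h
      proof -
        have "(\<Sum>a\<in>?A. \<Sum>b\<in>?A. of_bool (a = g \<and> b = h) * v a * v b) = (\<Sum>a\<in>?A. if a = g then (\<Sum>b\<in>?A. if b = h then v g * v h else 0) else 0)"
          by (intro sum.cong refl) (auto intro!: sum.cong)
        then show ?thesis using that fin by simp
      qed
      have "(\<Sum>a\<in>?A. \<Sum>b\<in>?A. of_int c * (of_bool (a = set e \<and> b = set f) + of_bool (a = set f \<and> b = set e)) * v a * v b) =
         of_int c * ((\<Sum>a\<in>?A. \<Sum>b\<in>?A. of_bool (a = set e \<and> b = set f) * v a * v b) + (\<Sum>a\<in>?A. \<Sum>b\<in>?A. of_bool (a = set f \<and> b = set e) * v a * v b))"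
        by (simp only: sum_distrib_left distrib_left distrib_right sum.distrib mult.assoc)
      also have "\<dots> = 2 * of_int c * (v (set e) * v (set f))"
        unfolding one[OF ef] one[OF ef(2,1)] by (simp add: mult_ac)
      finally show ?case
        using Cons by (simp add: t distrib_right sum.distrib)
    qed simp
    then show ?thesis unfolding quad_def S_def by blast
  qed
  \<comment> \<open>The indicator of the two edges of the leading product. Every other product
    vanishes there: its two disjoint edges would have to be these two, but one of the leading cells
    is missing.\<close>
  define w where "w a = (if a = set e0 \<or> a = set f0 then 1 else 0 :: real)" for a
  have "quad ?A S w = 2 * of_int c0 + (\<Sum>(e, f, c)\<leftarrow>R'. 2 * of_int c * (w (set e) * w (set f)))"
    unfolding quad by (simp add: R w_def)
  also have "(\<Sum>(e, f, c)\<leftarrow>R'. 2 * of_int c * (w (set e) * w (set f))) = (\<Sum>t\<leftarrow>R'. 0)"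
  proof (intro arg_cong[where f = sum_list] map_cong refl)
    fix t assume t: "t \<in> set R'"
    obtain e f c where efc: "t = (e, f, c)" by (cases t)
    have ne: "hd e0 \<in> set e0" "hd f0 \<in> set f0" using edge(3)[of e0 f0 c0] by (auto simp: R)
    have "w (set e) * w (set f) = 0"
    proof (rule ccontr)
      assume "w (set e) * w (set f) \<noteq> 0"
      then have "set e = set e0 \<or> set e = set f0" "set f = set e0 \<or> set f = set f0"
        by (auto simp: w_def split: if_splits)
      moreover have "set e \<inter> set f = {}" "set e \<noteq> {}"
        using shape t edge(3)[of e f c e] by (auto simp: R efc)
      ultimately have "set e \<union> set f = set e0 \<union> set f0" by auto
      moreover have "hd e0 \<notin> set e \<union> set f \<or> hd f0 \<notin> set e \<union> set f"
        using other t by (auto simp: efc)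
      ultimately show False using ne by blast
    qed
    then show "(case t of (e, f, c) \<Rightarrow> 2 * of_int c * (w (set e) * w (set f))) = 0" by (simp add: efc)
  qed
  finally have nz: "quad ?A S w \<noteq> 0" using c0 by simp
  have rel: "quad ?A S (\<lambda>e. edge_form e x y) = 0" for x y
  proof -
    have "quad ?A S (\<lambda>e. edge_form e x y) = (\<Sum>(e, f, c)\<leftarrow>R. 2 * terms_value x y (product_terms c e f))"
      unfolding quad
    proof (intro arg_cong[where f = sum_list] map_cong refl)
      fix t assume t: "t \<in> set R"
      obtain e f c where efc: "t = (e, f, c)" by (cases t)
      show "(case t of (e, f, c) \<Rightarrow> 2 * of_int c * (edge_form (set e) x y * edge_form (set f) x y)) =
         (case t of (e, f, c) \<Rightarrow> 2 * terms_value x y (product_terms c e f))"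
        using edge(2)[of e f c] t by (simp add: efc terms_value_product edge_form_distinct)
    qed
    also have "\<dots> = 2 * terms_value x y (concat (map (\<lambda>(e, f, c). product_terms c e f) R))"
    proof -
      have "(\<Sum>(e, f, c)\<leftarrow>Q. 2 * terms_value x y (product_terms c e f)) =
          2 * terms_value x y (concat (map (\<lambda>(e, f, c). product_terms c e f) Q))" for Q
        by (induction Q) auto
      then show ?thesis .
    qed
    finally show ?thesis using vanishing_terms_value[OF van] by simp
  qed
  show ?thesis
    unfolding reducible_def by (rule sos_representable_relation[OF conf sym nz rel])
qed

text \<open>Places every line of the chain inside the grid, since the cells of two-edges lie
  there.\<close>

lemma chain_edges_vertex:
  assumes "i \<in> set ps" "2 \<le> length ps"
  shows "\<exists>c q. (orient t i c, q) \<in> set (chain_edges t ps a b) \<or> (q, orient t i c) \<in> set (chain_edges t ps a b)"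
  using assms
proof (induction t ps a b rule: chain_edges.induct)
  case (1 t p q ps a b)
  consider "i = p" | "i = q" | "i \<in> set ps" using 1(2) by auto
  then show ?case
  proof cases
    case 1
    then show ?thesis by (intro exI[of _ a] exI[of _ "orient t q b"]) simp
  next
    case 2
    then show ?thesis by (intro exI[of _ b] exI[of _ "orient t p a"]) simp
  next
    case 3
    then show ?thesis using 1(1) by (cases ps) auto
  qed
qed auto

text \<open>A chain on \<open>length ps\<close> lines has one two-edge fewer than lines, and four
  one-edges are added: \<open>length ps + 3\<close> squares are replaced by
  \<open>length ps + 2\<close>.\<close>

lemma reducible_Chain:
  assumes valid: "valid (Chain t ps l a b)" and K: "\<And>p q. (p, q) \<in> set (chain_edges t ps a b) \<Longrightarrow> {p, q} \<in> two_edges G"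
  shows "reducible G"
proof -
  have len: "length ps \<in> {2, 3, 4}" and ds: "distinct (l # ps)" and ab: "a \<noteq> b"
    and O: "orient t l a \<in> set std_ones" "orient t l b \<in> set std_ones" "orient t (hd ps) b \<in> set std_ones" "orient t (last ps) a \<in> set std_ones"
    using valid by auto
  define M N :: nat where "M = (if t then 4 else 7)" and "N = (if t then 7 else 4)"
  have cell: "i \<in> {1..M} \<and> j \<in> {1..N}" if "orient t i j \<in> cells 7 4" for i j
    using that by (auto simp: orient_def cells_def M_def N_def split: if_splits)
  have l: "l \<in> {1..M}" "a \<in> {1..N}" "b \<in> {1..N}"
    using O(1,2)[THEN ones_cells, THEN cell] by auto
  have edges: "i \<in> {1..M}" if "(orient t i c, q) \<in> set (chain_edges t ps a b) \<or> (q, orient t i c) \<in> set (chain_edges t ps a b)" for i c q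
    using that K two_edge_cells cell by blast
  define S where "S = [orient t l a, orient t l b, orient t (hd ps) b, orient t (last ps) a]"
  define X Y where "X x y = (if t then y else x :: nat \<Rightarrow> real)" and "Y x y = (if t then x else y :: nat \<Rightarrow> real)" for x y
  have val: "cell_value x y (orient t i j) = X x y i * Y x y j" for x y i j
    by (simp add: orient_def X_def Y_def)
  have neq: "orient t i j = orient t i' j' \<longleftrightarrow> i = i' \<and> j = j'" for i j i' j'
    by (auto simp: orient_def)
  have sos: "sos_representable M N (chain_form l ps a b) (length ps + 2)"
  proof -
    have "set ps \<subseteq> {1..M}"
      using chain_edges_vertex[of _ ps t a b] edges len by fastforce
    then show ?thesis
      using len l chain_form_2[of l M _ _ a N b] chain_form_3[of l M _ _ _ a N b] chain_form_4[of l M _ _ _ _ a N b]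
      by (auto simp: length_Suc_conv numeral_eq_Suc)
  qed
  have sos': "sos_representable 7 4 (\<lambda>x y. chain_form l ps a b (X x y) (Y x y)) (length ps + 2)"
    using sos sos_representable_transpose[of 4 7 "chain_form l ps a b"]
    by (cases t) (simp_all add: M_def N_def X_def Y_def)
  have form: "chain_form l ps a b (X x y) (Y x y) = (\<Sum>p\<leftarrow>S. (cell_value x y p)\<^sup>2) +
      (\<Sum>(p, q)\<leftarrow>chain_edges t ps a b. (cell_value x y p + cell_value x y q)\<^sup>2)" for x y
    using len
    by (auto simp: length_Suc_conv numeral_eq_Suc chain_form_def S_def val power2_eq_square algebra_simps)
  have "distinct S" "distinct (flat_pairs (chain_edges t ps a b))" "length (chain_edges t ps a b) = length ps - 1"
    using len ds ab by (auto simp: length_Suc_conv numeral_eq_Suc S_def neq flat_pairs_def)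
  moreover have "set S \<subseteq> set std_ones" using O by (simp add: S_def)
  ultimately show ?thesis
    using sos' K len by (intro reducible_replace[of S "chain_edges t ps a b" "length ps + 2"]) (auto simp: form S_def)
qed

theorem reducible_if_pattern:
  assumes "valid c" "\<And>p q. (p, q) \<in> set (pattern c) \<Longrightarrow> {p, q} \<in> two_edges G"
  shows "reducible G"
  using assms by (cases c) (auto intro: reducible_Regroup reducible_Relation reducible_Chain simp del: valid.simps)

end

subsection \<open>Relabelling and case distinction\<close>

definition map_config :: "(nat \<Rightarrow> nat) \<Rightarrow> (nat \<Rightarrow> nat) \<Rightarrow> configuration \<Rightarrow> configuration" where
  "map_config r s G = \<lparr>one_edges = map_prod r s ` one_edges G, two_edges = (`) (map_prod r s) ` two_edges G\<rparr>"

lemma selected_edges_map: "selected_edges (map_config r s G) = (`) (map_prod r s) ` selected_edges G"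
  by (simp add: selected_edges_def map_config_def image_Un image_image)

locale relabelling =
  fixes m n :: nat and r s :: "nat \<Rightarrow> nat" and G :: configuration
  assumes r: "bij_betw r {1..m} {1..m}" and s: "bij_betw s {1..n} {1..n}" and conf: "is_configuration m n G"
begin

lemma inj: "inj_on (map_prod r s) (cells m n)"
  using r s unfolding cells_def bij_betw_def by (blast intro: map_prod_inj_on)

lemma image_cells: "map_prod r s ` cells m n = cells m n"
  using r s by (simp add: cells_def map_prod_surj_on bij_betw_def)

lemma inj_edges: "inj_on ((`) (map_prod r s)) (selected_edges G)"
proof (rule inj_onI)
  fix e f assume "e \<in> selected_edges G" "f \<in> selected_edges G" "map_prod r s ` e = map_prod r s ` f"
  then show "e = f"
    using inj_on_image_eq_iff[OF inj] selected_edges_subset[OF conf] by blast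
qed

lemma configuration_map: "is_configuration m n (map_config r s G)"
  unfolding is_configuration_def
proof (intro conjI ballI)
  show "one_edges (map_config r s G) \<subseteq> cells m n"
    using conf image_cells by (auto simp: is_configuration_def map_config_def)
  fix e assume "e \<in> two_edges (map_config r s G)"
  then obtain f where f: "f \<in> two_edges G" "e = map_prod r s ` f" by (auto simp: map_config_def)
  then have sub: "f \<subseteq> cells m n" and "card f = 2" using conf by (auto simp: is_configuration_def)
  then show "e \<subseteq> cells m n" "card e = 2"
    using f image_cells card_image[OF inj_on_subset[OF inj sub]] by auto
qed

lemma simple_map:
  assumes "simple G"
  shows "simple (map_config r s G)"
  unfolding simple_def selected_edges_map
proof (intro ballI impI)
  fix e' f' assume "e' \<in> (`) (map_prod r s) ` selected_edges G" "f' \<in> (`) (map_prod r s) ` selected_edges G" "e' \<noteq> f'"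
  then obtain e f where ef: "e \<in> selected_edges G" "f \<in> selected_edges G" "e' = map_prod r s ` e" "f' = map_prod r s ` f" "e \<noteq> f"
    by blast
  then have "e \<inter> f = {}" using assms by (auto simp: simple_def)
  moreover have "map_prod r s ` (e \<inter> f) = e' \<inter> f'"
    using ef inj_on_image_Int[OF inj] selected_edges_subset[OF conf] by auto
  ultimately show "e' \<inter> f' = {}" by auto
qed

lemma num_squares_map: "num_squares (map_config r s G) = num_squares G"
  using card_image[OF inj_edges]
  by (simp add: num_squares_eq_card[OF conf] num_squares_eq_card[OF configuration_map] selected_edges_map)

lemma config_form_map: "config_form (map_config r s G) = (\<lambda>x y. config_form G (x \<circ> r) (y \<circ> s))"
proof (intro ext)
  fix x y
  have "edge_form (map_prod r s ` e) x y = edge_form e (x \<circ> r) (y \<circ> s)" if "e \<in> selected_edges G" for e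
    using inj_on_subset[OF inj selected_edges_subset[OF conf that]]
    by (simp add: edge_form_def sum.reindex case_prod_beta)
  then show "config_form (map_config r s G) x y = config_form G (x \<circ> r) (y \<circ> s)"
    unfolding config_form_eq_sum[OF conf] config_form_eq_sum[OF configuration_map] selected_edges_map
    by (simp add: sum.reindex[OF inj_edges])
qed

end

lemma reducible_map:
  assumes "relabelling 7 4 r s G" "reducible G"
  shows "reducible (map_config r s G)"
proof -
  interpret relabelling 7 4 r s G by fact
  have "r ` {1..7} \<subseteq> {1..7}" "s ` {1..4} \<subseteq> {1..4}" using r s by (auto simp: bij_betw_def)
  from sos_representable_permute[OF assms(2)[unfolded reducible_def] this]
  show ?thesis unfolding reducible_def config_form_map num_squares_map .
qed

lemma map_config_inverse:
  assumes conf: "is_configuration m n G" and r: "\<And>i. i \<in> {1..m} \<Longrightarrow> r (r' i) = i" and s: "\<And>j. j \<in> {1..n} \<Longrightarrow> s (s' j) = j"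
  shows "map_config r s (map_config r' s' G) = G"
proof -
  have id: "map_prod r s (map_prod r' s' p) = p" if "p \<in> cells m n" for p
    using that r s by (cases p) (simp add: cells_def)
  have im: "map_prod r s ` map_prod r' s' ` A = A" if "A \<subseteq> cells m n" for A
    using that id by (force simp: image_image)
  have "(`) (map_prod r s) ` (`) (map_prod r' s') ` two_edges G = (\<lambda>e. e) ` two_edges G"
    unfolding image_image[of _ _ "two_edges G"] by (rule image_cong) (use im conf in \<open>auto simp: is_configuration_def\<close>)
  moreover have "map_prod r s ` map_prod r' s' ` one_edges G = one_edges G"
    using conf by (intro im) (simp add: is_configuration_def)
  ultimately show ?thesis by (simp add: map_config_def)
qed

text \<open>The inverse relabelling gives a standard configuration, and a shorter representation
  found there is carried back. It serves twice: for an arbitrary extremal set of one-edges, and for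
  the column permutations that preserve the standard one.\<close>

lemma reducible_pullback:
  assumes conf: "is_configuration 7 4 G" and simple: "simple G"
    and r: "bij_betw r {1..7} {1..7}" and s: "bij_betw s {1..4} {1..4}"
    and ones: "one_edges G = map_prod r s ` set std_ones"
    and reducible: "\<And>G'. standard G' \<Longrightarrow> card (two_edges G') = card (two_edges G) \<Longrightarrow>
      (\<And>p q. p \<in> cells 7 4 \<Longrightarrow> q \<in> cells 7 4 \<Longrightarrow> {map_prod r s p, map_prod r s q} \<in> two_edges G \<Longrightarrow> {p, q} \<in> two_edges G') \<Longrightarrow>
      reducible G'"
  shows "reducible G"
proof -
  define r' s' where "r' = inv_into {1..7} r" and "s' = inv_into {1..4} s"
  define G' where "G' = map_config r' s' G"
  have r': "bij_betw r' {1..7} {1..7}" and s': "bij_betw s' {1..4} {1..4}"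
    unfolding r'_def s'_def using r s by (auto intro: bij_betw_inv_into)
  interpret I: relabelling 7 4 r' s' G using r' s' conf by unfold_locales
  have inv: "map_prod r' s' (map_prod r s p) = p" if "p \<in> cells 7 4" for p
    using that r s by (cases p) (simp add: cells_def r'_def s'_def bij_betw_inv_into_left)
  have std: "set std_ones \<subseteq> cells 7 4"
    by (auto simp: std_ones_def cells_def)
  have "one_edges G' = (\<lambda>p. p) ` set std_ones"
    unfolding G'_def map_config_def ones by (auto simp: image_image inv subsetD[OF std] intro!: image_cong)
  then have "one_edges G' = set std_ones" by simp
  moreover have "is_configuration 7 4 G'" "simple G'"
    using I.configuration_map I.simple_map simple by (simp_all add: G'_def)
  ultimately have st: "standard G'" by unfold_locales
  have "card (two_edges G') = card (two_edges G)"
    unfolding G'_def map_config_def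
    by (simp add: card_image inj_on_subset[OF I.inj_edges] selected_edges_def)
  then have "reducible G'"
  proof (rule reducible[OF st])
    fix p q assume pq: "p \<in> cells 7 4" "q \<in> cells 7 4" "{map_prod r s p, map_prod r s q} \<in> two_edges G"
    then have "map_prod r' s' ` {map_prod r s p, map_prod r s q} \<in> two_edges G'"
      by (simp only: G'_def map_config_def configuration.select_convs) (rule imageI)
    then show "{p, q} \<in> two_edges G'" using pq by (simp add: inv)
  qed
  moreover have "relabelling 7 4 r s G'"
    using r s \<open>is_configuration 7 4 G'\<close> by unfold_locales
  ultimately have "reducible (map_config r s G')" by (rule reducible_map[rotated])
  moreover have "map_config r s G' = G"
    unfolding G'_def
    by (rule map_config_inverse[OF conf]) (use r s in \<open>simp_all add: r'_def s'_def bij_betw_inv_into_right\<close>)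
  ultimately show ?thesis by simp
qed

text \<open>\<open>Branch c ts\<close> distinguishes the possible partners of the cell \<open>c\<close> in the order in which they are
  listed, and finally the case that \<open>c\<close> is the one cell without a partner, unless that cell is already
  known.  \<open>Leaf n g\<close> refers to the image of the \<open>n\<close>-th pattern under the \<open>g\<close>-th column permutation.\<close>

datatype tree = Leaf nat nat | Branch cell "tree list"

fun covers :: "(cell \<times> cell) list list list \<Rightarrow> (cell \<times> cell) list \<Rightarrow> cell list \<Rightarrow> bool \<Rightarrow> tree \<Rightarrow> bool"
  and covers_all :: "(cell \<times> cell) list list list \<Rightarrow> (cell \<times> cell) list \<Rightarrow> cell \<Rightarrow> cell list \<Rightarrow> cell list \<Rightarrow> bool \<Rightarrow> tree list \<Rightarrow> bool"
where
  "covers P K U h (Leaf n g) \<longleftrightarrow> n < length P \<and> g < length (P ! n) \<and>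
     list_all (\<lambda>(p, q). (p, q) \<in> set K \<or> (q, p) \<in> set K) (P ! n ! g)"
| "covers P K U h (Branch c ts) \<longleftrightarrow> c \<in> set U \<and> covers_all P K c (remove1 c U) (remove1 c U) h ts"
| "covers_all P K c W V h [] \<longleftrightarrow> W = [] \<and> \<not> h"
| "covers_all P K c [] V h (t # ts) \<longleftrightarrow> h \<and> ts = [] \<and> covers P K V False t"
| "covers_all P K c (d # W) V h (t # ts) \<longleftrightarrow>
     covers P ((c, d) # K) (remove1 d V) h t \<and> covers_all P K c W V h ts"

section \<open>Soundness of the case distinction\<close>

context standard
begin

text \<open>The state of the case distinction: the cells in \<open>U\<close> are partnered among
  themselves, except possibly \<open>z\<close>; the flag \<open>h\<close> tells whether this
  exception is still open.\<close>

definition matched_in :: "cell \<Rightarrow> cell list \<Rightarrow> bool \<Rightarrow> bool" where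
  "matched_in z U h \<longleftrightarrow> distinct U \<and> (\<forall>c\<in>set U. (\<exists>d\<in>set U. d \<noteq> c \<and> {c, d} \<in> two_edges G) \<or> h \<and> c = z)"

lemma partner_unique:
  assumes "{c, d} \<in> two_edges G" "{c, d'} \<in> two_edges G"
  shows "d = d'"
  using simple_edge_unique[OF simple, of "{c, d}" "{c, d'}" c] assms
  by (auto simp: selected_edges_def doubleton_eq_iff)

lemma matched_in_partner:
  assumes m: "matched_in z U h" and c: "c \<in> set U" and d: "d \<in> set U" "d \<noteq> c" "{c, d} \<in> two_edges G"
  shows "matched_in z (remove1 d (remove1 c U)) h"
  unfolding matched_in_def
proof (intro conjI ballI)
  show "distinct (remove1 d (remove1 c U))" using m by (simp add: matched_in_def)
  have set: "set (remove1 d (remove1 c U)) = set U - {c, d}" using m by (auto simp: matched_in_def)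
  fix a assume a: "a \<in> set (remove1 d (remove1 c U))"
  then have "(\<exists>b\<in>set U. b \<noteq> a \<and> {a, b} \<in> two_edges G) \<or> h \<and> a = z"
    using m set by (auto simp: matched_in_def)
  then show "(\<exists>b\<in>set (remove1 d (remove1 c U)). b \<noteq> a \<and> {a, b} \<in> two_edges G) \<or> h \<and> a = z"
  proof (elim disjE bexE conjE)
    fix b assume b: "b \<in> set U" "b \<noteq> a" "{a, b} \<in> two_edges G"
    have "b \<noteq> c" using partner_unique[of c a d] b a d set by (auto simp: insert_commute)
    moreover have "b \<noteq> d" using partner_unique[of d a c] b a d set by (auto simp: insert_commute)
    ultimately show ?thesis using b set by blast
  qed blast
qed

lemma matched_in_hole:
  assumes m: "matched_in z U h" and c: "c \<in> set U" and none: "\<not> (\<exists>d\<in>set U. d \<noteq> c \<and> {c, d} \<in> two_edges G)"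
  shows "h" "matched_in z (remove1 c U) False"
proof -
  have cz: "h \<and> c = z" using m c none by (auto simp: matched_in_def)
  then show h by simp
  have set: "set (remove1 c U) = set U - {c}" using m by (auto simp: matched_in_def)
  show "matched_in z (remove1 c U) False"
    unfolding matched_in_def
  proof (intro conjI ballI)
    show "distinct (remove1 c U)" using m by (simp add: matched_in_def)
    fix a assume a: "a \<in> set (remove1 c U)"
    then obtain b where b: "b \<in> set U" "b \<noteq> a" "{a, b} \<in> two_edges G"
      using m set cz by (auto simp: matched_in_def)
    have "b \<noteq> c" using none a b set by (auto simp: insert_commute)
    then show "(\<exists>b\<in>set (remove1 c U). b \<noteq> a \<and> {a, b} \<in> two_edges G) \<or> False \<and> a = z"
      using b set by blast
  qed
qed

text \<open>In the second statement \<open>V\<close> holds the remaining cells other than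
  \<open>c\<close>, and \<open>W\<close> the part of them still to be tried. The partner of
  \<open>c\<close> is in \<open>W\<close>, or \<open>c\<close> is the uncovered cell; once
  \<open>W\<close> is exhausted, the final subtree treats the latter.\<close>

lemma covers_sound:
  "covers P K U h t \<Longrightarrow> matched_in z U h \<Longrightarrow> \<forall>(p, q)\<in>set K. {p, q} \<in> two_edges G \<Longrightarrow>
     \<exists>n g. n < length P \<and> g < length (P ! n) \<and> (\<forall>(p, q)\<in>set (P ! n ! g). {p, q} \<in> two_edges G)"
  "covers_all P K c W V h ts \<Longrightarrow> (\<exists>d\<in>set W. {c, d} \<in> two_edges G \<and> matched_in z (remove1 d V) h) \<or> h \<and> matched_in z V False \<Longrightarrow>
     \<forall>(p, q)\<in>set K. {p, q} \<in> two_edges G \<Longrightarrow>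
     \<exists>n g. n < length P \<and> g < length (P ! n) \<and> (\<forall>(p, q)\<in>set (P ! n ! g). {p, q} \<in> two_edges G)"
proof (induction P K U h t and P K c W V h ts rule: covers_covers_all.induct)
  case (1 P K U h n g)
  then have "\<forall>(p, q)\<in>set (P ! n ! g). {p, q} \<in> two_edges G"
    by (fastforce simp: list_all_iff insert_commute)
  then show ?case using 1(1) unfolding covers.simps by blast
next
  case (2 P K U h c ts)
  have c: "c \<in> set U" and cov: "covers_all P K c (remove1 c U) (remove1 c U) h ts" using 2(2) by auto
  show ?case
  proof (cases "\<exists>d\<in>set U. d \<noteq> c \<and> {c, d} \<in> two_edges G")
    case True
    then obtain d where d: "d \<in> set U" "d \<noteq> c" "{c, d} \<in> two_edges G" by blast
    then have "d \<in> set (remove1 c U)" by simp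
    then show ?thesis using 2(1)[OF cov _ 2(4)] matched_in_partner[OF 2(3) c d] d by blast
  next
    case False
    then show ?thesis using 2(1)[OF cov _ 2(4)] matched_in_hole[OF 2(3) c] by blast
  qed
next
  case (4 P K c V h t ts)
  then show ?case by simp
next
  case (5 P K c d W V h t ts)
  have cov: "covers P ((c, d) # K) (remove1 d V) h t" "covers_all P K c W V h ts" using 5(3) by auto
  show ?case
  proof (cases "{c, d} \<in> two_edges G \<and> matched_in z (remove1 d V) h")
    case True
    then show ?thesis using 5(1)[OF cov(1)] 5(5) by auto
  next
    case False
    then show ?thesis using 5(2)[OF cov(2) _ 5(5)] 5(4) by auto
  qed
qed simp_all

end

subsection \<open>Extremal sets of one-edges\<close>

text \<open>The difference of the two sides is \<open>(d - 1) * (d - 2) / 2\<close>, which vanishes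
  exactly for 1 and 2.\<close>

lemma choose_two_ge:
  assumes "d \<le> (4 :: nat)"
  shows "d \<le> (d choose 2) + 1" "d = (d choose 2) + 1 \<Longrightarrow> d = 1 \<or> d = 2"
proof -
  have "d = 0 \<or> d = 1 \<or> d = 2 \<or> d = 3 \<or> d = 4" using assms by linarith
  then show "d \<le> (d choose 2) + 1" "d = (d choose 2) + 1 \<Longrightarrow> d = 1 \<or> d = 2"
    by (elim disjE; simp add: choose_two)+
qed

locale C4_free_7_4 =
  fixes E :: "cell set"
  assumes E: "E \<subseteq> cells 7 4" and free: "C4_free E"
begin

definition row :: "nat \<Rightarrow> nat set" where
  "row i = {j. (i, j) \<in> E}"

lemma row_subset: "row i \<subseteq> {1..4}"
  using E by (auto simp: row_def cells_def)

lemma finite_row: "finite (row i)"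
  using row_subset finite_subset by blast

lemma card_row: "card (row i) \<le> 4"
  using card_mono[OF _ row_subset[of i]] by simp

lemma card_E: "card E = (\<Sum>i\<in>{1..7}. card (row i))"
proof -
  have "E = Sigma {1..7} row" using E by (auto simp: row_def cells_def)
  then have "card E = card (Sigma {1..7} row)" by (rule arg_cong)
  also have "\<dots> = (\<Sum>i\<in>{1..7}. card (row i))"
    by (rule card_SigmaI) (simp_all add: finite_row)
  finally show ?thesis .
qed

definition col_pairs :: "nat set \<Rightarrow> nat set set" where
  "col_pairs A = {B. B \<subseteq> A \<and> card B = 2}"

lemma card_col_pairs: "finite A \<Longrightarrow> card (col_pairs A) = card A choose 2"
  unfolding col_pairs_def by (rule n_subsets)

text \<open>A pair of columns used by two rows gives the four corners of a rectangle.\<close>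

lemma col_pairs_disjoint:
  assumes "i \<noteq> k"
  shows "col_pairs (row i) \<inter> col_pairs (row k) = {}"
proof (rule ccontr)
  assume "col_pairs (row i) \<inter> col_pairs (row k) \<noteq> {}"
  then obtain B where B: "B \<subseteq> row i" "B \<subseteq> row k" "card B = 2" by (auto simp: col_pairs_def)
  then obtain j l where "B = {j, l}" "j \<noteq> l" by (auto simp: card_2_iff)
  then have "(i, j) \<in> E" "(i, l) \<in> E" "(k, j) \<in> E" "(k, l) \<in> E" using B by (auto simp: row_def)
  then show False using free assms \<open>j \<noteq> l\<close> unfolding C4_free_def by blast
qed

lemma sum_choose_two: "(\<Sum>i\<in>{1..7}. card (row i) choose 2) \<le> 6"
proof -
  have "(\<Sum>i\<in>{1..7}. card (row i) choose 2) = (\<Sum>i\<in>{1..7}. card (col_pairs (row i)))"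
    by (simp add: card_col_pairs finite_row)
  also have "\<dots> = card (\<Union>i\<in>{1..7}. col_pairs (row i))"
    using col_pairs_disjoint finite_row by (intro card_UN_disjoint[symmetric]) (auto simp: col_pairs_def)
  also have "\<dots> \<le> card (col_pairs {1..4})"
    using row_subset by (intro card_mono) (auto simp: col_pairs_def)
  also have "\<dots> = 6" by (simp add: card_col_pairs choose_two)
  finally show ?thesis .
qed

lemma card_le: "card E \<le> 13"
proof -
  have "card E \<le> (\<Sum>i\<in>{1..7}. (card (row i) choose 2) + 1)"
    unfolding card_E by (intro sum_mono choose_two_ge card_row)
  then show ?thesis using sum_choose_two unfolding sum.distrib by simp
qed

text \<open>Equality must hold in \<open>choose_two_ge\<close> for every row, so each row has one or
  two cells. As 13 = 7 + 6, six rows have two, and they use up all six pairs of columns.\<close>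

lemma normal_form:
  assumes c13: "card E = 13"
  obtains r s where "bij_betw r {1..7} {1..7}" "bij_betw s {1..4} {1..4}" "E = map_prod r s ` set std_ones"
proof -
  have d12: "card (row i) = 1 \<or> card (row i) = 2" if i: "i \<in> {1..7}" for i
  proof (rule ccontr)
    assume "\<not> ?thesis"
    then have "card (row i) < (card (row i) choose 2) + 1"
      using choose_two_ge[OF card_row[of i]] by fastforce
    then have "(\<Sum>i\<in>{1..7}. card (row i)) < (\<Sum>i\<in>{1..7}. (card (row i) choose 2) + 1)"
      using i choose_two_ge(1)[OF card_row] by (intro sum_strict_mono_ex1) auto
    then show False using sum_choose_two c13 unfolding card_E sum.distrib by simp
  qed
  define T where "T = {i \<in> {1..7}. card (row i) = 2}"
  have T: "T \<subseteq> {1..7}" "finite T" by (auto simp: T_def)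
  have "(13 :: nat) = (\<Sum>i\<in>{1..7}. 1 + of_bool (card (row i) = 2))"
    unfolding c13[symmetric] card_E
  proof (rule sum.cong)
    show "card (row i) = 1 + of_bool (card (row i) = 2)" if "i \<in> {1..7}" for i
      using d12[OF that] by auto
  qed simp
  also have "\<dots> = 7 + card T"
  proof -
    have "card T = (\<Sum>i\<in>{1..7}. if card (row i) = 2 then 1 else 0)"
      unfolding T_def card_eq_sum by (rule sum.inter_filter) simp
    then show ?thesis unfolding sum.distrib of_bool_def by simp
  qed
  finally have cT: "card T = 6" by simp
  have "card ({1..7} - T) = 1" using card_Diff_subset[OF T(2,1)] cT by simp
  then obtain i0 where i0: "{1..7} - T = {i0}" by (rule card_1_singletonE)
  then have "i0 \<in> {1..7}" "i0 \<notin> T" by blast+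
  then have "card (row i0) = 1" using d12[of i0] by (simp add: T_def)
  then obtain c where c: "row i0 = {c}" by (rule card_1_singletonE)
  have c4: "c \<in> {1..4}" using row_subset[of i0] unfolding c by simp
  have inj: "inj_on row T"
  proof (rule inj_onI, rule ccontr)
    fix i k assume ik: "i \<in> T" "k \<in> T" "row i = row k" "i \<noteq> k"
    then have "row i \<in> col_pairs (row i) \<inter> col_pairs (row k)" by (auto simp: col_pairs_def T_def)
    then show False using col_pairs_disjoint[OF ik(4)] by simp
  qed
  have rowT: "row ` T = col_pairs {1..4}"
  proof (rule card_subset_eq)
    show "finite (col_pairs {1..4})" by (simp add: col_pairs_def)
    show "row ` T \<subseteq> col_pairs {1..4}" using row_subset by (auto simp: col_pairs_def T_def)
    show "card (row ` T) = card (col_pairs {1..4})"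
      by (simp add: card_image[OF inj] cT card_col_pairs choose_two)
  qed
  \<comment> \<open>Only \<open>s 1 = c\<close> matters: any permutation of the columns permutes the
    six pairs among themselves.\<close>
  define s where "s = Transposition.transpose 1 c"
  have sb: "bij_betw s {1..4} {1..4}"
    unfolding s_def using c4 by (intro permutes_imp_bij permutes_swap_id) auto
  define S where "S i = {j. (i, j) \<in> set std_ones}" for i
  have "S 1 = {1, 2}" "S 2 = {1, 3}" "S 3 = {1, 4}" "S 4 = {2, 3}" "S 5 = {2, 4}" "S 6 = {3, 4}" "S 7 = {1}"
    by (auto simp: S_def std_ones_def)
  \<comment> \<open>The simplifier turns the index 1 into \<open>Suc 0\<close>; the additional
    instance matches that form.\<close>
  note S = this this(1)[unfolded One_nat_def]
  have seven: "i = 1 \<or> i = 2 \<or> i = 3 \<or> i = 4 \<or> i = 5 \<or> i = 6 \<or> i = 7" if "i \<in> {1..7}" for i :: nat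
    using that by (simp add: atLeastAtMost_iff) linarith
  have sub: "S i \<subseteq> {1..4}" if "i \<in> {1..7}" for i
    using seven[OF that] by (elim disjE) (simp_all add: S)
  have image: "s ` S i \<in> row ` {1..7}" if i: "i \<in> {1..7}" for i
  proof (cases "i = 7")
    case True
    then have "s ` S i = row i0" by (simp add: S c s_def)
    then show ?thesis using \<open>i0 \<in> {1..7}\<close> by blast
  next
    case False
    have "card (S i) = 2" using seven[OF i] False by (elim disjE) (simp_all add: S)
    then have "card (s ` S i) = 2"
      using card_image[OF inj_on_subset[OF bij_betw_imp_inj_on[OF sb] sub[OF i]]] by simp
    moreover have "s ` S i \<subseteq> {1..4}" using sub[OF i] sb by (auto simp: bij_betw_def)
    ultimately have "s ` S i \<in> row ` T" unfolding rowT col_pairs_def by simp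
    then show ?thesis using T by blast
  qed
  \<comment> \<open>The row of \<open>E\<close> whose columns are the image of row \<open>i\<close>
    of the standard set.\<close>
  define r where "r i = inv_into {1..7} row (s ` S i)" for i
  have r: "r i \<in> {1..7}" "row (r i) = s ` S i" if "i \<in> {1..7}" for i
    unfolding r_def using inv_into_into[OF image[OF that]] f_inv_into_f[OF image[OF that]] by auto
  have S_inj: "i = k" if "i \<in> {1..7}" "k \<in> {1..7}" "S i = S k" for i k
    using seven[OF that(1)] seven[OF that(2)] that(3) by (elim disjE) (simp_all add: S doubleton_eq_iff)
  have "inj_on r {1..7}"
  proof (rule inj_onI)
    fix i k assume ik: "i \<in> {1..7}" "k \<in> {1..7}" "r i = r k"
    then have "s ` S i = s ` S k" using r(2) by metis
    then have "S i = S k"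
      using inj_on_image_eq_iff[OF bij_betw_imp_inj_on[OF sb] sub[OF ik(1)] sub[OF ik(2)]] by simp
    then show "i = k" using S_inj ik by simp
  qed
  moreover have "r ` {1..7} = {1..7}"
  proof (rule endo_inj_surj)
    show "r ` {1..7} \<subseteq> {1..7}" using r(1) by blast
  qed (use calculation in simp_all)
  ultimately have rb: "bij_betw r {1..7} {1..7}" by (simp add: bij_betw_def)
  have "map_prod r s ` set std_ones = E"
  proof (rule card_subset_eq)
    show "finite E" using E finite_subset finite_cells by blast
    show "map_prod r s ` set std_ones \<subseteq> E"
    proof
      fix p assume "p \<in> map_prod r s ` set std_ones"
      then obtain i j where ij: "(i, j) \<in> set std_ones" "p = (r i, s j)" by auto
      then have "i \<in> {1..7}" "s j \<in> s ` S i" by (auto simp: std_ones_def S_def)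
      then show "p \<in> E" using r(2)[of i] ij(2) by (auto simp: row_def)
    qed
    have "inj_on (map_prod r s) ({1..7} \<times> {1..4})"
      using rb sb by (intro map_prod_inj_on) (auto simp: bij_betw_def)
    moreover have "set std_ones \<subseteq> {1..7} \<times> {1..4}" by (auto simp: std_ones_def)
    ultimately have "card (map_prod r s ` set std_ones) = card (set std_ones)"
      by (intro card_image) (rule inj_on_subset)
    then show "card (map_prod r s ` set std_ones) = card E" by (simp add: c13 std_ones_def)
  qed
  then show ?thesis using that[OF rb sb] by simp
qed

end

lemma C4_free_std_ones: "C4_free (set std_ones)"
proof -
  have "list_all (\<lambda>(i, j). list_all (\<lambda>(i', l). i = i' \<and> j \<noteq> l \<longrightarrow>
      list_all (\<lambda>(k, j'). i \<noteq> k \<and> j = j' \<longrightarrow> (k, l) \<notin> set std_ones) std_ones) std_ones) std_ones"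
    by (simp add: std_ones_def)
  then show ?thesis
    unfolding C4_free_def list_all_iff by fastforce
qed

lemma zarankiewicz_7_4: "zarankiewicz 7 4 = 13"
  unfolding zarankiewicz_def
proof (rule Max_eqI)
  let ?A = "{card E |E. E \<subseteq> cells 7 4 \<and> C4_free E}"
  have le: "y \<le> 13" if "y \<in> ?A" for y
    using that C4_free_7_4.card_le C4_free_7_4.intro by blast
  have "?A \<subseteq> {..13}" using le by blast
  then show "finite ?A" by (rule finite_subset) simp
  show "y \<le> 13" if "y \<in> ?A" for y by (rule le[OF that])
  have "card (set std_ones) = 13" by (simp add: std_ones_def)
  moreover have "set std_ones \<subseteq> cells 7 4" by (simp add: std_ones_def cells_def)
  ultimately show "13 \<in> ?A"
    using C4_free_std_ones by (intro CollectI exI[of _ "set std_ones"]) simp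
qed

subsection \<open>The parameters for the 7 by 4 grid\<close>

definition permute :: "nat list \<times> nat list \<Rightarrow> cell \<Rightarrow> cell" where
  "permute g p = (fst g ! (fst p - 1), snd g ! (snd p - 1))"

text \<open>The permutations of the last three columns, together with the permutations of the rows that they
  induce on the standard one-edges.\<close>

definition column_perms :: "(nat list \<times> nat list) list" where
  "column_perms =
    [([1,2,3,4,5,6,7], [1,2,3,4]), ([1,3,2,5,4,6,7], [1,2,4,3]), ([2,1,3,4,6,5,7], [1,3,2,4]),
     ([2,3,1,6,4,5,7], [1,3,4,2]), ([3,1,2,5,6,4,7], [1,4,2,3]), ([3,2,1,6,5,4,7], [1,4,3,2])]"

definition images :: "(cell \<times> cell) list \<Rightarrow> (cell \<times> cell) list list" where
  "images K = map (\<lambda>g. map (map_prod (permute g) (permute g)) K) column_perms"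

definition free_cells :: "cell list" where
  "free_cells = filter (\<lambda>p. p \<notin> set std_ones) (List.product [1..<8] [1..<5])"

lemma set_free_cells: "set free_cells = cells 7 4 - set std_ones"
  by (auto simp: free_cells_def cells_def)

lemma free_cells_eq:
  "free_cells = [(1,3), (1,4), (2,2), (2,4), (3,2), (3,3), (4,1), (4,4), (5,1), (5,3), (6,1), (6,2), (7,2), (7,3), (7,4)]"
  by code_simp

text \<open>The certificates, the case distinction and the derivation for the lower bound were found by a
  computer search.\<close>

definition certificates :: "certificate list" where
  "certificates = [
   Chain False [6, 1] 5 2 4,
   Relation [([(2,2), (6,2)], [(4,3)], -1), ([(2,3)], [(4,2)], 1), ([(4,2)], [(6,3)], 1)],
   Relation [([(1,4), (7,4)], [(3,1)], -1), ([(1,1)], [(3,4)], 1), ([(3,4)], [(7,1)], 1)],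
   Chain False [5, 1] 3 1 4,
   Chain False [6, 1] 3 1 4,
   Chain False [3, 2] 6 3 4,
   Chain False [4, 7] 1 1 2,
   Relation [([(2,2), (3,2)], [(1,1)], -1), ([(1,2)], [(2,1)], 1), ([(1,2)], [(3,1)], 1)],
   Chain True [2, 4, 1] 3 2 4,
   Chain False [5, 4] 6 3 4,
   Regroup [((1,4), (7,3)), ((2,4), (3,2))] [[((1,1), 1), ((2,4), 1), ((3,2), 1)], [((1,2), 1),
     ((3,1), -1)], [((1,4), 1), ((2,1), -1), ((7,3), 1)], [((2,3), 1), ((7,1), 1)]],
   Regroup [((2,2), (3,3)), ((2,4), (6,2))] [[((2,2), 1), ((3,3), 1), ((6,4), 1)], [((2,4), 1)],
     [((3,4), 1), ((6,3), -1)], [((6,2), 1)]],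
   Regroup [((1,4), (5,3)), ((3,3), (5,1))] [[((1,1), 1), ((3,4), -1)], [((1,4), 1), ((3,1), 1),
     ((5,3), 1)], [((3,3), 1)], [((5,1), 1)]],
   Chain False [6, 2, 4] 5 2 4,
   Chain False [3, 1, 2] 6 3 4,
   Relation [([(1,3), (2,4)], [(3,1)], 1), ([(2,2), (3,3)], [(1,1)], -1), ([(1,2)], [(2,1)], 1),
     ([(2,1)], [(3,4)], -1)],
   Chain True [4, 2, 3] 1 2 3,
   Relation [([(1,3), (1,4)], [(3,1)], 1), ([(2,2), (3,3)], [(1,1)], -1), ([(1,1)], [(3,4)], -1),
     ([(1,2)], [(2,1)], 1)],
   Chain False [5, 6, 2] 1 1 2,
   Chain False [4, 6, 2] 1 1 2,
   Regroup [((1,4), (7,2)), ((4,1), (7,4))] [[((1,1), 1), ((4,2), -1)], [((1,2), 1), ((4,1), 1),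
     ((7,4), 1)], [((1,4), 1)], [((7,2), 1)]],
   Chain False [6, 7, 1] 5 2 4,
   Chain False [2, 3, 5] 4 2 3,
   Regroup [((1,4), (7,3)), ((5,3), (7,2))] [[((1,2), 1), ((5,4), -1)], [((1,4), 1), ((5,2), 1),
     ((7,3), 1)], [((5,3), 1)], [((7,2), 1)]],
   Regroup [((2,2), (6,1)), ((6,2), (7,2))] [[((2,1), 1), ((6,2), 1), ((7,2), 1)], [((2,2), 1),
     ((7,1), -1)], [((6,1), 1)]],
   Relation [([(2,2), (6,1)], [(4,3)], -1), ([(4,1), (4,4)], [(6,3)], 1), ([(2,3)], [(4,2)], 1),
     ([(4,3)], [(6,4)], -1)],
   Regroup [((2,2), (6,1)), ((6,2), (7,3))] [[((2,1), 1), ((6,2), 1), ((7,3), 1)], [((2,2), 1)],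
     [((2,3), 1), ((7,1), -1)], [((6,1), 1)]],
   Relation [([(1,4), (5,3)], [(4,2)], -1), ([(4,4), (5,1)], [(1,2)], 1), ([(1,1)], [(5,2)], -1),
     ([(4,3)], [(5,2)], 1)],
   Relation [([(1,4), (7,3)], [(2,1)], -1), ([(2,2), (2,4)], [(1,1)], 1), ([(1,2)], [(2,1)], -1),
     ([(2,3)], [(7,1)], 1)],
   Relation [([(2,2), (6,1)], [(4,3)], -1), ([(2,4), (4,1)], [(6,3)], 1), ([(2,3)], [(4,2)], 1),
     ([(2,3)], [(6,4)], -1)],
   Relation [([(4,1), (5,1)], [(1,2)], 1), ([(1,1)], [(4,2)], -1), ([(1,1)], [(5,2)], -1)],
   Relation [([(1,4), (7,3)], [(2,1)], -1), ([(2,4), (7,2)], [(1,1)], 1), ([(1,2)], [(7,1)], -1),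
     ([(2,3)], [(7,1)], 1)],
   Regroup [((2,2), (3,3)), ((3,2), (6,1))] [[((2,1), 1), ((6,3), -1)], [((2,2), 1)], [((2,3), 1),
     ((3,2), 1), ((6,1), 1)], [((3,3), 1)]],
   Regroup [((1,4), (7,2)), ((4,4), (7,4))] [[((1,2), 1), ((4,4), 1), ((7,4), 1)], [((1,4), 1),
     ((4,2), -1)], [((7,2), 1)]],
   Regroup [((2,2), (3,3)), ((2,4), (7,3)), ((3,2), (7,4))] [[((2,2), 1), ((5,4), 1)], [((2,3),
     1), ((3,2), 1), ((7,4), 1)], [((2,4), 1), ((5,2), -1)], [((3,3), 1)], [((7,3), 1)]],
   Relation [([(1,4), (5,3)], [(4,2)], -1), ([(4,1), (4,4)], [(1,2)], 1), ([(1,1)], [(4,2)], -1),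
     ([(4,3)], [(5,2)], 1)],
   Chain False [3, 2, 7, 1] 5 2 4,
   Regroup [((4,4), (7,2)), ((5,3), (7,4))] [[((4,2), 1), ((5,3), 1), ((7,4), 1)], [((4,3), 1),
     ((5,2), -1)], [((4,4), 1)], [((7,2), 1)]],
   Chain False [4, 5, 7] 2 1 3,
   Regroup [((4,1), (7,4)), ((4,4), (7,2))] [[((2,1), 1), ((4,3), 1)], [((2,3), 1), ((4,1), -1)],
     [((4,2), 1), ((7,4), 1)], [((4,4), 1), ((7,1), 1)], [((7,2), 1)]],
   Chain False [6, 7, 4] 5 2 4,
   Chain False [3, 7, 1] 5 2 4,
   Relation [([(2,2), (2,4)], [(6,3)], -1), ([(4,1), (6,2)], [(2,3)], 1), ([(2,1)], [(4,3)], -1),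
     ([(2,3)], [(6,4)], 1)],
   Chain True [4, 1, 3] 2 4 5,
   Regroup [((4,1), (5,3)), ((4,4), (6,1))] [[((4,1), 1), ((5,3), 1), ((6,4), 1)], [((4,4), 1)],
     [((5,4), 1), ((6,3), -1)], [((6,1), 1)]],
   Regroup [((1,4), (7,2)), ((2,2), (7,3)), ((5,3), (7,4))] [[((1,1), 1), ((3,4), 1)], [((1,2),
     1), ((7,4), 1)], [((1,4), 1), ((3,1), -1)], [((2,2), 1)], [((2,3), 1), ((7,2), 1)], [((5,3),
     1)], [((5,4), 1), ((7,3), 1)]],
   Regroup [((2,2), (4,4)), ((2,4), (7,2)), ((4,1), (7,4))] [[((2,1), 1), ((4,3), 1)], [((2,2),
     1), ((7,4), 1)], [((2,3), 1), ((4,1), -1)], [((2,4), 1), ((4,2), 1)], [((4,4), 1), ((7,1),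
     1)], [((7,2), 1)]],
   Relation [([(1,3), (2,4)], [(7,1)], 1), ([(3,2), (7,3)], [(1,1)], -1), ([(3,3), (7,4)],
     [(2,1)], -1), ([(1,2)], [(3,1)], 1), ([(2,3)], [(3,1)], 1)],
   Regroup [((1,4), (7,3)), ((3,2), (6,1)), ((3,3), (7,2))] [[((1,1), 1), ((6,4), -1)], [((1,2),
     1), ((3,4), -1)], [((1,4), 1), ((3,2), 1), ((6,1), 1), ((7,3), 1)], [((3,3), 1)], [((6,3),
     1), ((7,1), -1)], [((7,2), 1)]],
   Regroup [((1,4), (5,3)), ((2,2), (7,4)), ((5,1), (7,3))] [[((1,1), 1), ((2,2), -1), ((7,4),
     -1)], [((1,2), 1), ((2,1), 1)], [((1,4), 1), ((5,3), 1), ((7,1), 1)], [((5,1), 1)], [((7,3),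
     1)]],
   Relation [([(2,2), (2,4)], [(3,1)], 1), ([(3,2), (3,3)], [(2,1)], -1), ([(2,1)], [(3,4)], -1),
     ([(2,3)], [(3,1)], 1)],
   Relation [([(2,2), (2,4)], [(4,3)], -1), ([(4,1), (4,4)], [(2,3)], 1), ([(2,1)], [(4,3)], -1),
     ([(2,3)], [(4,2)], 1)],
   Regroup [((2,2), (4,4)), ((2,4), (7,2)), ((3,2), (7,3)), ((3,3), (7,4))] [[((1,1), 1), ((3,2),
     1)], [((1,2), 1), ((3,1), -1)], [((2,2), 1), ((7,4), 1)], [((2,4), 1), ((4,2), 1)], [((3,3),
     1), ((7,2), 1)], [((3,4), 1), ((7,3), 1)], [((4,4), 1)]],
   Relation [([(1,4), (7,3)], [(4,2)], -1), ([(4,1), (4,4)], [(1,2)], 1), ([(6,2), (7,2)],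
     [(4,3)], 1), ([(1,1)], [(4,2)], -1), ([(4,2)], [(6,3)], -1)],
   Relation [([(1,4), (7,3)], [(6,1), (6,2)], -1), ([(4,4), (7,2)], [(6,3)], 1), ([(1,1)],
     [(6,4)], 1), ([(1,2)], [(6,4)], 1), ([(4,3)], [(6,4)], -1), ([(6,3)], [(7,1)], 1)],
   Regroup [((2,2), (3,3)), ((2,4), (7,2)), ((3,2), (7,3)), ((4,1), (7,4))] [[((2,1), 1), ((4,2),
     -1)], [((2,2), 1), ((4,1), 1), ((7,4), 1)], [((2,3), 1), ((3,2), 1)], [((2,4), 1)], [((3,3),
     1), ((7,2), 1)], [((7,3), 1)]],
   Relation [([(4,1), (4,4)], [(5,2)], 1), ([(5,1), (5,3)], [(4,2)], -1), ([(4,2)], [(5,4)], -1),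
     ([(4,3)], [(5,2)], 1)],
   Relation [([(1,4), (5,3)], [(2,1)], -1), ([(2,2), (2,4)], [(1,1)], 1), ([(2,2), (2,4)],
     [(6,3)], -1), ([(5,1), (6,2)], [(2,3)], 1), ([(1,2)], [(2,1)], -1), ([(2,3)], [(6,4)], 1)],
   Regroup [((1,4), (5,3)), ((3,2), (7,4)), ((5,1), (7,3))] [[((1,1), 1), ((3,2), -1), ((7,4),
     -1)], [((1,2), 1), ((3,1), 1)], [((1,4), 1), ((5,3), 1), ((7,1), 1)], [((5,1), 1)], [((7,3),
     1)]],
   Relation [([(1,4), (7,2)], [(3,1)], -1), ([(2,4), (3,2)], [(7,1)], 1), ([(7,3), (7,4)],
     [(2,1)], -1), ([(1,1)], [(3,4)], 1), ([(2,3)], [(7,1)], 1)],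
   Regroup [((1,4), (7,3)), ((2,2), (3,3)), ((2,4), (4,1)), ((4,4), (7,2))] [[((1,1), 1), ((3,4),
     -1)], [((1,4), 1), ((3,1), 1), ((7,3), 1)], [((2,1), 1), ((4,4), 1), ((7,2), 1)], [((2,2),
     1), ((3,3), 1), ((7,1), -1)], [((2,4), 1)], [((4,1), 1)]],
   Regroup [((1,4), (7,3)), ((3,2), (5,3)), ((3,3), (7,2))] [[((1,2), 1), ((3,4), -1)], [((1,4),
     1), ((3,2), 1), ((7,3), 1)], [((3,3), 1), ((5,2), 1)], [((5,3), 1)], [((7,2), 1)]],
   Relation [([(1,4), (7,3)], [(4,1), (6,2)], -1), ([(4,4), (7,2)], [(1,1)], 1), ([(4,4), (7,2)],
     [(6,3)], 1), ([(1,2)], [(6,4)], 1), ([(1,2)], [(7,1)], -1), ([(4,3)], [(6,4)], -1), ([(4,3)],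
     [(7,1)], 1)],
   Relation [([(1,4), (7,3)], [(4,2)], -1), ([(4,4), (6,1)], [(1,2)], 1), ([(6,2), (7,2)],
     [(1,1)], -1), ([(6,2), (7,2)], [(4,3)], 1), ([(1,2)], [(7,1)], 1), ([(4,2)], [(6,3)], -1)],
   Relation [([(2,2), (2,4)], [(3,1)], 1), ([(2,2), (2,4)], [(7,1)], 1), ([(3,2), (7,4)], [(2,1)],
     -1), ([(3,3), (7,2)], [(2,1)], -1), ([(2,1)], [(3,4)], -1), ([(2,3)], [(3,1)], 1)],
   Regroup [((2,2), (3,3)), ((2,4), (7,2)), ((3,2), (7,3)), ((4,4), (7,4))] [[((2,2), 1), ((4,4),
     1), ((7,4), 1)], [((2,3), 1), ((3,2), 1)], [((2,4), 1), ((4,2), -1)], [((3,3), 1), ((7,2),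
     1)], [((7,3), 1)]],
   Regroup [((2,2), (3,3)), ((2,4), (7,2)), ((3,2), (7,3)), ((6,2), (7,4))] [[((2,2), 1), ((7,4),
     1)], [((2,3), 1), ((3,2), 1)], [((2,4), 1)], [((3,3), 1), ((6,4), 1), ((7,2), 1)], [((3,4),
     1), ((6,3), -1)], [((6,2), 1)], [((7,3), 1)]],
   Regroup [((2,2), (3,3)), ((3,2), (7,3)), ((4,4), (7,2))] [[((2,2), 1)], [((2,3), 1), ((3,2),
     1)], [((3,3), 1), ((4,4), 1), ((7,2), 1)], [((3,4), 1), ((4,3), -1)], [((7,3), 1)]],
   Chain False [2, 3, 7, 5] 4 2 3,
   Regroup [((2,2), (3,3)), ((3,2), (7,3)), ((6,1), (7,2))] [[((2,2), 1)], [((2,3), 1), ((3,2),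
     1)], [((3,1), 1), ((6,3), -1)], [((3,3), 1), ((6,1), 1), ((7,2), 1)], [((7,3), 1)]],
   Regroup [((2,2), (4,4)), ((2,4), (7,2)), ((5,3), (7,4))] [[((2,2), 1), ((5,3), 1), ((7,4), 1)],
     [((2,3), 1), ((5,2), -1)], [((2,4), 1), ((4,2), 1)], [((4,4), 1)], [((7,2), 1)]],
   Regroup [((2,2), (4,4)), ((2,4), (7,3)), ((3,2), (7,4)), ((3,3), (7,2))] [[((1,1), 1), ((2,2),
     1)], [((1,2), 1), ((2,1), -1)], [((2,3), 1), ((7,4), 1)], [((2,4), 1), ((4,2), 1)], [((3,2),
     1), ((7,3), 1)], [((3,3), 1)], [((3,4), 1), ((7,2), 1)], [((4,4), 1)]],
   Regroup [((2,2), (4,4)), ((2,4), (7,3)), ((6,2), (7,4))] [[((2,2), 1), ((6,3), -1)], [((2,3),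
     1), ((6,2), 1), ((7,4), 1)], [((2,4), 1), ((4,2), 1)], [((4,4), 1)], [((7,3), 1)]],
   Regroup [((2,2), (6,1)), ((2,4), (7,3)), ((3,3), (5,1)), ((5,3), (7,2))] [[((2,2), 1), ((5,4),
     -1), ((6,1), 1)], [((2,4), 1), ((5,2), 1), ((7,3), 1)], [((3,1), 1), ((5,3), 1)], [((3,3),
     1)], [((5,1), 1), ((6,4), 1)], [((7,2), 1)]],
   Regroup [((2,2), (7,3)), ((2,4), (6,2)), ((3,2), (7,4)), ((3,3), (7,2))] [[((2,2), 1), ((6,4),
     1)], [((2,3), 1), ((3,4), 1), ((7,2), 1)], [((2,4), 1), ((3,3), -1)], [((3,2), 1), ((7,3),
     1)], [((6,2), 1)], [((7,4), 1)]],
   Relation [([(4,1), (4,4)], [(5,2)], 1), ([(4,1), (4,4)], [(6,3)], -1), ([(5,1), (7,3)],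
     [(4,2)], -1), ([(6,1), (7,2)], [(4,3)], 1), ([(4,2)], [(5,4)], -1), ([(4,3)], [(6,4)], 1)],
   Regroup [((1,4), (5,3)), ((2,2), (4,4)), ((2,4), (7,2)), ((5,1), (6,2))] [[((1,1), 1), ((2,4),
     1), ((7,2), 1)], [((1,2), 1), ((7,1), -1)], [((1,4), 1), ((2,1), -1), ((5,3), 1)], [((2,2),
     1), ((4,4), 1), ((6,3), -1)], [((2,3), 1), ((5,1), 1), ((6,2), 1)], [((4,3), 1), ((6,4), 1)]],
   Relation [([(1,4), (7,2)], [(2,1)], -1), ([(2,2), (2,4)], [(1,1)], 1), ([(2,2), (2,4)],
     [(7,1)], 1), ([(3,3), (7,4)], [(2,1)], -1), ([(1,2)], [(2,1)], -1), ([(2,3)], [(3,1)], 1)],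
   Relation [([(1,4), (7,2)], [(2,1)], -1), ([(2,2), (2,4)], [(1,1)], 1), ([(2,2), (2,4)],
     [(4,3)], -1), ([(2,2), (2,4)], [(7,1)], 1), ([(4,4), (5,1)], [(2,3)], 1), ([(5,3), (7,4)],
     [(2,1)], -1), ([(1,2)], [(2,1)], -1), ([(2,3)], [(4,2)], 1)],
   Relation [([(1,4), (7,2)], [(2,1)], -1), ([(2,2), (2,4)], [(1,1)], 1), ([(2,2), (2,4)],
     [(7,1)], 1), ([(7,3), (7,4)], [(2,1)], -1), ([(1,2)], [(2,1)], -1), ([(2,3)], [(7,1)], 1)],
   Regroup [((1,4), (7,2)), ((2,2), (7,3)), ((2,4), (6,2)), ((3,3), (7,4))] [[((1,1), 1), ((2,4),
     1)], [((1,2), 1), ((7,4), 1)], [((1,4), 1), ((2,1), -1)], [((2,2), 1), ((6,4), 1)], [((2,3),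
     1), ((7,2), 1)], [((3,3), 1)], [((3,4), 1), ((7,3), 1)], [((6,2), 1)]],
   Chain False [6, 2, 7, 1] 5 2 4,
   Regroup [((2,2), (4,4)), ((2,4), (7,3)), ((7,2), (7,4))] [[((2,2), 1), ((7,3), -1)], [((2,3),
     1), ((7,2), 1), ((7,4), 1)], [((2,4), 1), ((4,2), 1)], [((4,4), 1)]],
   Regroup [((2,2), (7,3)), ((2,4), (4,1)), ((3,2), (7,4)), ((3,3), (7,2))] [[((2,2), 1)],
     [((2,3), 1), ((3,4), 1), ((7,2), 1)], [((2,4), 1), ((3,3), -1), ((4,1), 1)], [((3,1), 1),
     ((4,3), 1)], [((3,2), 1), ((7,3), 1)], [((7,4), 1)]],
   Regroup [((2,2), (7,3)), ((2,4), (7,2)), ((4,1), (7,4))] [[((2,1), 1), ((4,2), -1)], [((2,2),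
     1), ((4,1), 1), ((7,4), 1)], [((2,3), 1), ((7,2), 1)], [((2,4), 1)], [((7,3), 1)]]
  ]"

text \<open>The children of a node follow the order of the free cells still available. For instance,
  the first child at the root pairs (4,1) with (1,3); exchanging columns 3 and 4 maps pattern 3, the
  single two-edge of (5,1) and (1,4), to this pair.\<close>

definition case_tree :: tree where
  "case_tree =
    Branch (4,1) [Leaf 3 1, Branch (4,4) [Leaf 8 2, Leaf 12 3, Leaf 1 5, Leaf 0 5, Leaf 0 4, Leaf
    19 4, Leaf 9 0, Leaf 18 4, Leaf 9 2, Leaf 26 4, Branch (5,1) [Leaf 29 2, Leaf 4 3, Leaf 4 2,
    Leaf 3 5, Branch (5,3) [Leaf 1 2, Leaf 0 3, Leaf 0 2, Leaf 8 1, Leaf 19 3, Leaf 9 4, Leaf 37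
    1, Leaf 26 3, Branch (3,2) [Leaf 32 2, Leaf 7 0, Branch (2,2) [Leaf 5 4, Leaf 32 1, Leaf 1 0,
    Leaf 2 3, Leaf 23 3], Leaf 29 1, Leaf 1 1, Leaf 2 5, Leaf 73 3]], Leaf 25 4, Leaf 30 4, Branch
    (5,3) [Leaf 1 2, Leaf 0 3, Leaf 0 2, Leaf 27 5, Leaf 1 3, Leaf 43 4, Leaf 37 1, Leaf 40 2,
    Branch (6,1) [Leaf 4 1, Leaf 18 0, Leaf 3 2, Leaf 19 1, Leaf 3 4, Leaf 38 4, Leaf 6 5]], Leaf
    6 1, Leaf 6 4, Branch (5,3) [Leaf 1 2, Leaf 0 3, Leaf 0 2, Branch (3,3) [Leaf 7 2, Leaf 22 0,
    Leaf 5 0, Leaf 3 4, Leaf 13 1, Leaf 70 1, Leaf 21 4], Leaf 1 3, Branch (2,2) [Leaf 5 4, Branch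
    (3,2) [Leaf 17 2, Leaf 42 3, Leaf 1 1, Leaf 2 5, Branch (1,3) [Leaf 7 2, Leaf 0 1, Leaf 45
    1]], Leaf 7 0, Branch (1,3) [Leaf 15 0, Leaf 14 4, Leaf 0 1, Branch (2,4) [Leaf 16 0, Leaf 11
    0, Leaf 2 2], Leaf 10 1], Leaf 1 0, Leaf 2 3, Leaf 23 3], Leaf 9 4, Leaf 37 1, Leaf 40 2]],
    Leaf 24 4, Branch (1,3) [Leaf 5 4, Leaf 32 5, Branch (2,2) [Leaf 17 2, Leaf 14 4, Leaf 4 3,
    Leaf 0 3, Branch (5,1) [Leaf 4 2, Leaf 32 2, Leaf 25 4, Leaf 18 0, Leaf 6 1, Branch (3,3)
    [Leaf 5 0, Leaf 1 3, Leaf 12 4, Leaf 69 2, Leaf 20 4], Leaf 6 4], Leaf 1 0, Leaf 2 3, Branch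
    (7,2) [Leaf 47 4, Leaf 36 3, Leaf 6 1, Leaf 21 3, Leaf 20 3, Leaf 33 3, Leaf 59 3], Leaf 10
    3], Leaf 7 2, Leaf 29 2, Leaf 1 2, Leaf 4 1, Leaf 0 1, Branch (5,1) [Leaf 4 3, Leaf 4 2, Leaf
    3 5, Branch (5,3) [Leaf 0 3, Leaf 0 2, Leaf 8 1, Leaf 19 3, Leaf 9 4, Leaf 24 3, Leaf 26 3],
    Leaf 25 4, Leaf 30 4, Branch (6,1) [Leaf 18 0, Leaf 3 2, Leaf 19 1, Leaf 3 4, Leaf 43 4, Leaf
    6 3, Leaf 6 5], Leaf 20 1, Leaf 6 4], Leaf 2 1, Branch (3,3) [Leaf 10 1, Leaf 5 0, Leaf 28 1,
    Branch (3,2) [Leaf 7 0, Branch (5,3) [Leaf 0 3, Leaf 19 3, Leaf 9 4, Leaf 60 1, Leaf 24 3],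
    Leaf 8 1, Leaf 29 1, Leaf 1 1, Leaf 2 5, Leaf 48 5], Leaf 1 3, Leaf 3 4, Branch (3,2) [Leaf 7
    0, Leaf 11 1, Leaf 3 5, Leaf 13 1, Leaf 8 3, Leaf 2 5, Leaf 48 5], Leaf 31 1, Leaf 2 4]]],
    Leaf 3 3, Branch (4,4) [Leaf 12 1, Leaf 1 4, Leaf 8 0, Leaf 0 5, Leaf 0 4, Leaf 18 5, Leaf 9
    0, Leaf 19 5, Leaf 9 2, Branch (6,1) [Leaf 4 1, Leaf 4 0, Leaf 29 0, Branch (6,2) [Leaf 0 1,
    Leaf 0 0, Leaf 1 0, Leaf 8 3, Leaf 19 1, Leaf 9 4, Leaf 37 3, Leaf 26 1, Branch (3,3) [Leaf 7
    2, Branch (1,3) [Leaf 5 4, Leaf 32 3, Leaf 1 2, Leaf 2 1, Leaf 23 1], Leaf 32 0, Leaf 29 1,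
    Leaf 1 3, Leaf 2 4, Leaf 73 1]], Leaf 3 4, Leaf 30 4, Branch (5,1) [Leaf 18 2, Leaf 3 0, Leaf
    4 3, Leaf 3 5, Leaf 19 3, Leaf 43 4, Leaf 38 5, Leaf 6 4, Branch (6,2) [Leaf 0 1, Leaf 0 0,
    Leaf 1 0, Leaf 1 1, Leaf 27 4, Leaf 37 3, Leaf 40 0]], Leaf 25 5, Leaf 6 3, Leaf 6 5, Branch
    (6,2) [Leaf 0 1, Leaf 0 0, Leaf 1 0, Leaf 1 1, Branch (3,2) [Leaf 22 2, Leaf 5 2, Leaf 7 0,
    Leaf 3 5, Leaf 13 1, Leaf 70 3, Leaf 21 5], Branch (1,3) [Branch (3,2) [Leaf 7 0, Leaf 42 1,
    Leaf 27 5, Branch (2,2) [Leaf 17 0, Leaf 0 3, Leaf 31 3], Leaf 21 5], Leaf 5 4, Branch (1,4)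
    [Leaf 15 2, Leaf 16 2, Leaf 11 2, Branch (2,2) [Leaf 14 4, Leaf 0 3, Leaf 10 3], Leaf 2 0],
    Leaf 7 2, Leaf 1 2, Leaf 2 1, Leaf 23 1], Leaf 9 4, Leaf 37 3, Leaf 40 0]], Leaf 26 5, Leaf 24
    5, Branch (2,2) [Leaf 5 4, Leaf 32 4, Leaf 7 0, Branch (1,3) [Leaf 17 0, Leaf 14 4, Branch
    (5,3) [Leaf 8 4, Leaf 12 5, Leaf 18 2, Leaf 9 4, Leaf 26 2, Leaf 24 2, Branch (3,2) [Leaf 5 2,
    Leaf 32 0, Leaf 1 1, Leaf 2 5, Leaf 23 5]], Leaf 1 2, Leaf 4 1, Leaf 0 1, Branch (7,3) [Leaf
    47 5, Leaf 36 1, Leaf 20 1, Leaf 33 1, Leaf 6 3, Leaf 21 1, Leaf 59 1], Leaf 2 1, Leaf 10 1],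
    Leaf 4 3, Leaf 0 3, Leaf 29 0, Leaf 1 0, Leaf 2 3, Branch (6,1) [Leaf 4 1, Leaf 4 0, Branch
    (6,2) [Leaf 0 1, Leaf 0 0, Leaf 8 3, Leaf 19 1, Leaf 9 4, Leaf 24 1, Leaf 26 1], Leaf 3 4,
    Leaf 30 4, Branch (5,1) [Leaf 18 2, Leaf 3 0, Leaf 3 5, Leaf 19 3, Leaf 43 4, Leaf 6 1, Leaf 6
    4], Leaf 25 5, Leaf 20 3, Leaf 6 5], Branch (3,2) [Leaf 10 3, Leaf 5 2, Leaf 28 3, Leaf 3 5,
    Branch (3,3) [Leaf 7 2, Leaf 11 3, Leaf 8 1, Leaf 3 4, Leaf 13 1, Leaf 48 4, Leaf 2 4], Branch
    (3,3) [Leaf 7 2, Branch (6,2) [Leaf 0 1, Leaf 19 1, Leaf 9 4, Leaf 24 1, Leaf 60 3], Leaf 29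
    1, Leaf 1 3, Leaf 8 3, Leaf 48 4, Leaf 2 4], Leaf 1 1, Leaf 2 5, Leaf 31 3]]], Leaf 4 5, Leaf
    4 4, Branch (5,1) [Leaf 25 2, Leaf 3 0, Leaf 4 3, Leaf 4 2, Leaf 3 5, Branch (5,3) [Leaf 1 2,
    Leaf 12 0, Leaf 0 3, Leaf 0 2, Leaf 8 1, Leaf 19 3, Leaf 9 4, Branch (6,1) [Leaf 4 1, Leaf 4
    0, Leaf 25 0, Leaf 3 2, Leaf 29 1, Leaf 25 3, Leaf 6 3, Leaf 6 5, Branch (6,2) [Leaf 0 1, Leaf
    0 0, Leaf 1 0, Leaf 35 2, Leaf 1 1, Leaf 40 1, Leaf 37 5]], Leaf 24 3, Leaf 26 3, Branch (6,1)
    [Leaf 4 1, Leaf 4 0, Leaf 25 0, Leaf 3 2, Leaf 29 1, Leaf 25 3, Branch (6,2) [Leaf 0 1, Leaf 0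
    0, Leaf 1 0, Leaf 35 2, Leaf 1 1, Leaf 39 3, Leaf 39 5], Leaf 6 3, Leaf 6 5]], Leaf 56 0, Leaf
    30 4, Branch (6,1) [Leaf 4 1, Leaf 4 0, Leaf 18 0, Leaf 3 2, Leaf 19 1, Leaf 3 4, Leaf 43 4,
    Leaf 38 4, Leaf 6 3, Leaf 6 5, Branch (5,3) [Leaf 1 2, Leaf 35 0, Leaf 0 3, Leaf 0 2, Leaf 27
    5, Leaf 1 3, Branch (1,3) [Leaf 51 2, Leaf 5 4, Branch (1,4) [Leaf 16 4, Leaf 5 2, Leaf 14 0,
    Leaf 23 0, Leaf 2 0], Branch (1,4) [Leaf 15 2, Leaf 7 4, Leaf 16 2, Leaf 23 0, Leaf 2 0], Leaf
    7 2, Leaf 2 1, Leaf 62 1], Branch (2,2) [Leaf 5 4, Branch (2,4) [Leaf 16 4, Leaf 14 2, Leaf 5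
    0, Leaf 53 2, Leaf 2 2], Leaf 51 0, Leaf 7 0, Branch (1,3) [Leaf 17 0, Leaf 15 0, Leaf 14 4,
    Leaf 33 1, Leaf 10 1], Leaf 2 3, Leaf 63 3], Branch (3,2) [Branch (3,3) [Leaf 16 2, Leaf 14 4,
    Leaf 5 0, Leaf 54 4, Leaf 2 4], Leaf 5 2, Leaf 7 0, Branch (3,3) [Leaf 7 2, Leaf 15 1, Leaf 16
    0, Leaf 54 4, Leaf 2 4], Leaf 42 1, Leaf 2 5, Leaf 23 5]]], Leaf 6 1, Branch (5,3) [Leaf 1 2,
    Leaf 35 0, Leaf 0 3, Leaf 0 2, Branch (3,3) [Leaf 7 2, Leaf 11 3, Leaf 22 0, Leaf 5 0, Leaf 3
    4, Leaf 13 1, Leaf 46 1, Leaf 20 4, Branch (6,1) [Leaf 4 1, Leaf 4 0, Leaf 25 0, Leaf 3 2,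
    Leaf 35 5, Leaf 75 0, Leaf 6 5]], Leaf 1 3, Leaf 38 5, Leaf 9 4, Leaf 39 1, Leaf 39 4, Branch
    (6,1) [Leaf 4 1, Leaf 4 0, Leaf 25 0, Leaf 3 2, Branch (6,2) [Leaf 0 1, Leaf 0 0, Leaf 1 0,
    Leaf 12 2, Leaf 8 3, Leaf 24 1, Leaf 26 1], Leaf 3 4, Leaf 56 2, Leaf 75 0, Leaf 6 5]], Leaf 6
    4, Branch (6,1) [Leaf 4 1, Leaf 4 0, Leaf 25 0, Leaf 3 2, Branch (6,2) [Leaf 0 1, Leaf 0 0,
    Leaf 1 0, Leaf 12 2, Leaf 8 3, Leaf 9 4, Leaf 24 1, Branch (5,3) [Leaf 1 2, Leaf 35 0, Leaf 0
    3, Leaf 0 2, Leaf 1 3, Leaf 40 1, Leaf 37 4], Leaf 26 1], Leaf 3 4, Branch (6,2) [Leaf 0 1,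
    Leaf 0 0, Leaf 1 0, Leaf 35 2, Leaf 1 1, Leaf 27 4, Branch (1,3) [Leaf 51 2, Leaf 5 4, Branch
    (1,4) [Leaf 16 4, Leaf 5 2, Leaf 14 0, Leaf 53 0, Leaf 2 0], Branch (1,4) [Leaf 15 2, Leaf 7
    4, Leaf 16 2, Leaf 53 0, Leaf 2 0], Leaf 7 2, Leaf 2 1, Leaf 63 1], Branch (2,2) [Leaf 5 4,
    Branch (2,4) [Leaf 16 4, Leaf 14 2, Leaf 5 0, Leaf 23 2, Leaf 2 2], Leaf 51 0, Leaf 7 0,
    Branch (1,3) [Leaf 17 0, Leaf 15 0, Leaf 14 4, Leaf 21 1, Leaf 10 1], Leaf 2 3, Leaf 62 3],
    Branch (3,2) [Branch (3,3) [Leaf 16 2, Leaf 14 4, Leaf 5 0, Leaf 23 4, Leaf 2 4], Leaf 5 2,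
    Leaf 7 0, Branch (1,4) [Leaf 17 1, Leaf 14 2, Leaf 15 1, Leaf 21 0, Leaf 10 0], Leaf 42 3,
    Leaf 2 5, Leaf 54 5]], Leaf 56 2, Branch (6,2) [Leaf 0 1, Leaf 0 0, Leaf 1 0, Leaf 35 2, Leaf
    1 1, Branch (3,2) [Leaf 22 2, Leaf 5 2, Leaf 7 0, Leaf 11 1, Leaf 13 1, Leaf 46 3, Leaf 20 5],
    Leaf 9 4, Leaf 39 3, Leaf 39 5], Leaf 6 3, Leaf 6 5]], Leaf 30 0, Branch (5,1) [Leaf 19 2,
    Leaf 3 0, Leaf 4 3, Leaf 4 2, Leaf 3 5, Leaf 18 3, Leaf 43 0, Leaf 30 4, Leaf 44 4, Leaf 6 1,
    Leaf 38 0, Leaf 6 4, Branch (1,3) [Leaf 42 2, Leaf 5 4, Branch (1,4) [Leaf 16 4, Leaf 5 2,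
    Leaf 14 0, Leaf 1 4, Leaf 4 0, Leaf 0 0, Branch (4,4) [Leaf 11 5, Leaf 0 5, Leaf 0 4, Leaf 44
    0, Leaf 9 2, Branch (7,4) [Leaf 23 3, Leaf 41 0, Leaf 21 4, Leaf 6 5, Leaf 21 0], Leaf 33 0],
    Branch (3,3) [Leaf 15 0, Leaf 17 5, Leaf 0 4, Leaf 3 4, Branch (6,1) [Leaf 12 4, Leaf 8 3,
    Leaf 44 0, Leaf 49 4, Leaf 6 5], Leaf 10 4, Leaf 36 4], Leaf 2 0], Branch (1,4) [Leaf 15 2,
    Leaf 7 4, Leaf 16 2, Leaf 1 4, Leaf 4 0, Leaf 0 0, Branch (3,3) [Leaf 14 4, Leaf 5 0, Leaf 0
    4, Leaf 3 4, Leaf 22 2, Leaf 2 4, Leaf 34 2], Branch (2,4) [Leaf 17 2, Leaf 5 0, Leaf 1 5,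
    Leaf 3 2, Branch (2,2) [Leaf 11 0, Leaf 13 0, Leaf 8 5, Leaf 2 3, Leaf 10 3], Leaf 31 0, Leaf
    2 2], Leaf 2 0], Leaf 7 2, Leaf 27 1, Leaf 4 1, Leaf 0 1, Branch (1,4) [Branch (2,4) [Leaf 14
    2, Leaf 5 0, Leaf 1 5, Leaf 3 2, Leaf 22 4, Leaf 34 4, Leaf 2 2], Leaf 7 4, Leaf 5 2, Branch
    (2,4) [Leaf 17 3, Leaf 15 1, Leaf 1 5, Leaf 3 2, Branch (6,1) [Leaf 8 5, Leaf 12 2, Leaf 27 2,
    Leaf 6 3, Leaf 6 5], Branch (7,4) [Leaf 47 1, Leaf 34 3, Leaf 33 2, Leaf 6 5, Leaf 45 2], Leaf
    2 2], Leaf 1 4, Leaf 4 0, Leaf 0 0, Branch (2,4) [Leaf 28 0, Leaf 10 0, Leaf 5 0, Leaf 1 5,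
    Leaf 3 2, Branch (2,2) [Leaf 7 0, Leaf 11 0, Leaf 13 0, Leaf 8 5, Leaf 52 5], Leaf 2 2], Leaf
    2 0], Leaf 2 1, Branch (3,3) [Branch (2,4) [Leaf 17 3, Leaf 15 1, Leaf 1 5, Leaf 3 2, Branch
    (4,4) [Leaf 13 0, Leaf 0 5, Leaf 27 2, Leaf 23 1, Leaf 68 3], Leaf 10 2, Leaf 36 2], Leaf 10
    1, Leaf 5 0, Leaf 28 1, Leaf 0 4, Leaf 3 4, Branch (3,2) [Leaf 5 2, Leaf 7 0, Leaf 11 1, Leaf
    0 5, Leaf 8 3, Leaf 2 5, Branch (1,4) [Leaf 10 5, Leaf 7 4, Leaf 1 4, Leaf 4 0, Leaf 52 3]],
    Leaf 31 1, Leaf 2 4]]], Leaf 30 2, Branch (6,1) [Leaf 4 1, Leaf 4 0, Leaf 19 0, Leaf 3 2, Leaf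
    18 1, Leaf 3 4, Leaf 43 2, Leaf 30 4, Leaf 44 5, Leaf 38 2, Leaf 6 3, Leaf 6 5, Branch (2,2)
    [Leaf 5 4, Branch (2,4) [Leaf 16 4, Leaf 14 2, Leaf 5 0, Leaf 1 5, Leaf 4 2, Leaf 0 2, Branch
    (3,2) [Leaf 15 2, Leaf 17 4, Leaf 0 5, Leaf 3 5, Branch (5,1) [Leaf 12 5, Leaf 8 1, Leaf 44 2,
    Leaf 49 5, Leaf 6 4], Leaf 10 5, Leaf 36 5], Branch (4,4) [Leaf 11 4, Leaf 0 5, Leaf 0 4, Leaf
    44 2, Leaf 9 0, Branch (7,4) [Leaf 23 1, Leaf 21 5, Leaf 41 2, Leaf 6 4, Leaf 21 2], Leaf 33
    2], Leaf 2 2], Leaf 42 0, Leaf 7 0, Branch (2,4) [Leaf 15 0, Leaf 7 4, Leaf 16 0, Leaf 1 5,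
    Leaf 4 2, Leaf 0 2, Branch (1,4) [Leaf 17 0, Leaf 5 2, Leaf 1 4, Leaf 3 0, Branch (1,3) [Leaf
    11 2, Leaf 13 2, Leaf 8 4, Leaf 2 1, Leaf 10 1], Leaf 31 0, Leaf 2 0], Branch (3,2) [Leaf 14
    4, Leaf 5 2, Leaf 0 5, Leaf 3 5, Leaf 22 0, Leaf 2 5, Leaf 34 0], Leaf 2 2], Leaf 27 3, Leaf 4
    3, Leaf 0 3, Leaf 2 3, Branch (2,4) [Branch (1,4) [Leaf 5 2, Leaf 14 0, Leaf 1 4, Leaf 3 0,
    Leaf 22 5, Leaf 34 5, Leaf 2 0], Leaf 7 4, Branch (1,4) [Leaf 17 1, Leaf 15 1, Leaf 1 4, Leaf
    3 0, Branch (5,1) [Leaf 8 4, Leaf 12 0, Leaf 27 0, Leaf 6 1, Leaf 6 4], Branch (7,4) [Leaf 47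
    3, Leaf 34 1, Leaf 33 0, Leaf 6 4, Leaf 45 0], Leaf 2 0], Leaf 5 0, Leaf 1 5, Leaf 4 2, Leaf 0
    2, Branch (1,4) [Leaf 28 2, Leaf 5 2, Leaf 10 2, Leaf 1 4, Leaf 3 0, Branch (1,3) [Leaf 11 2,
    Leaf 7 2, Leaf 13 2, Leaf 8 4, Leaf 52 4], Leaf 2 0], Leaf 2 2], Branch (3,2) [Leaf 10 3, Leaf
    5 2, Branch (1,4) [Leaf 17 1, Leaf 15 1, Leaf 1 4, Leaf 3 0, Branch (4,4) [Leaf 13 2, Leaf 0
    4, Leaf 27 0, Leaf 68 1, Leaf 23 3], Leaf 36 0, Leaf 10 0], Leaf 28 3, Leaf 0 5, Leaf 3 5,
    Branch (3,3) [Leaf 7 2, Leaf 11 3, Leaf 5 0, Leaf 0 4, Leaf 8 1, Branch (1,3) [Leaf 28 4, Leaf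
    10 4, Leaf 76 1, Leaf 12 5, Leaf 2 1], Leaf 2 4], Leaf 2 5, Leaf 31 3]]], Leaf 6 0, Leaf 6 2,
    Branch (4,4) [Branch (1,4) [Leaf 11 4, Leaf 7 4, Leaf 5 2, Leaf 22 3, Leaf 3 0, Leaf 13 2,
    Leaf 4 0, Leaf 0 0, Leaf 20 0, Leaf 46 2, Branch (2,2) [Branch (3,2) [Leaf 50 0, Leaf 3 5,
    Branch (3,3) [Leaf 8 1, Leaf 3 4, Leaf 13 1, Branch (5,1) [Leaf 30 4, Leaf 27 5, Leaf 46 1],
    Leaf 2 4], Branch (3,3) [Leaf 29 1, Leaf 1 3, Leaf 8 3, Branch (5,1) [Leaf 25 1, Leaf 19 1,
    Branch (5,3) [Leaf 9 4]], Leaf 2 4], Leaf 1 1, Leaf 2 5, Leaf 28 5], Leaf 7 0, Branch (3,2)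
    [Leaf 16 0, Leaf 3 5, Leaf 22 0, Leaf 32 0, Leaf 1 1, Leaf 2 5, Leaf 49 1], Leaf 4 3, Leaf 0
    3, Branch (6,2) [Leaf 8 5, Leaf 1 1, Leaf 12 4, Leaf 18 0, Leaf 9 4, Leaf 24 0, Leaf 26 0],
    Leaf 1 0, Leaf 2 3, Leaf 58 1]], Leaf 1 4, Branch (2,4) [Leaf 11 5, Leaf 7 4, Leaf 22 1, Leaf
    5 0, Leaf 4 2, Leaf 0 2, Leaf 3 2, Leaf 13 0, Leaf 46 0, Leaf 20 2, Branch (1,3) [Branch (3,3)
    [Leaf 50 2, Branch (3,2) [Leaf 8 1, Leaf 29 1, Leaf 1 1, Leaf 2 5, Branch (5,3) [Leaf 19 3,
    Leaf 9 4, Branch (6,1) [Leaf 25 3]]], Leaf 1 3, Leaf 3 4, Branch (3,2) [Leaf 3 5, Leaf 13 1,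
    Leaf 8 3, Leaf 2 5, Branch (5,1) [Leaf 35 4, Leaf 30 4, Leaf 6 1]], Leaf 28 4, Leaf 2 4],
    Branch (3,3) [Leaf 16 2, Leaf 32 2, Leaf 1 3, Leaf 3 4, Leaf 22 2, Leaf 49 3, Leaf 2 4], Leaf
    7 2, Branch (5,3) [Leaf 8 4, Leaf 12 5, Leaf 1 3, Leaf 18 2, Leaf 9 4, Leaf 26 2, Leaf 24 2],
    Leaf 1 2, Leaf 4 1, Leaf 0 1, Leaf 58 3, Leaf 2 1]], Leaf 1 5, Leaf 0 5, Leaf 0 4, Leaf 38 1,
    Leaf 9 0, Leaf 38 3, Leaf 9 2, Leaf 39 0, Leaf 39 2, Branch (1,3) [Branch (2,4) [Leaf 50 4,
    Leaf 17 1, Leaf 5 0, Leaf 4 2, Leaf 0 2, Leaf 3 2, Branch (2,2) [Leaf 7 0, Leaf 11 0, Leaf 4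
    3, Leaf 0 3, Leaf 8 5, Leaf 2 3, Branch (6,1) [Leaf 12 2, Leaf 3 4, Leaf 30 4, Leaf 57 2, Leaf
    20 3]], Leaf 28 2, Leaf 20 2], Leaf 5 4, Branch (1,4) [Leaf 16 4, Leaf 5 2, Leaf 14 0, Leaf 3
    0, Leaf 22 5, Leaf 4 0, Leaf 0 0, Leaf 20 0, Leaf 69 5], Branch (1,4) [Leaf 15 2, Leaf 7 4,
    Leaf 16 2, Leaf 3 0, Leaf 11 2, Leaf 4 0, Leaf 0 0, Leaf 20 0, Branch (3,3) [Leaf 14 4, Leaf 5
    0, Leaf 32 2, Leaf 1 3, Leaf 3 4, Leaf 22 2, Leaf 55 2]], Leaf 7 2, Branch (5,3) [Leaf 8 4,
    Leaf 0 3, Leaf 0 2, Leaf 12 5, Leaf 1 3, Leaf 18 2, Leaf 9 4, Leaf 26 2, Leaf 24 2], Leaf 1 2,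
    Leaf 4 1, Leaf 0 1, Branch (7,3) [Leaf 84 2, Leaf 41 1, Leaf 20 2, Branch (2,2) [Leaf 10 5,
    Leaf 28 5, Leaf 36 1, Leaf 4 3, Leaf 0 3, Branch (2,4) [Leaf 7 4, Leaf 5 0, Leaf 4 2, Leaf 0
    2, Leaf 8 5], Leaf 1 0], Leaf 2 4, Leaf 20 1, Leaf 33 1, Leaf 6 3, Leaf 21 1], Leaf 2 1]],
    Branch (1,4) [Branch (2,4) [Leaf 50 4, Leaf 17 1, Leaf 5 0, Leaf 1 5, Leaf 4 2, Leaf 0 2, Leaf
    3 2, Branch (6,1) [Leaf 8 5, Leaf 12 2, Leaf 3 4, Leaf 27 2, Leaf 30 4, Leaf 57 2, Branch
    (2,2) [Leaf 7 0, Leaf 11 0, Leaf 13 0, Leaf 4 3, Leaf 0 3, Leaf 20 3, Leaf 46 5], Leaf 6 3,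
    Leaf 6 5], Leaf 28 2, Branch (7,4) [Leaf 64 4, Leaf 77 2, Leaf 41 2, Leaf 33 2, Leaf 6 4, Leaf
    21 2, Leaf 6 5, Branch (4,4) [Leaf 72 0, Leaf 0 5, Leaf 0 4, Leaf 42 4, Leaf 9 0, Leaf 78 2,
    Leaf 40 0], Leaf 79 2], Leaf 2 2], Branch (2,4) [Leaf 16 4, Leaf 14 2, Leaf 5 0, Leaf 1 5,
    Leaf 4 2, Leaf 0 2, Leaf 3 2, Leaf 22 4, Branch (1,3) [Leaf 15 2, Leaf 7 2, Leaf 11 4, Branch
    (5,3) [Leaf 12 5, Leaf 1 3, Leaf 9 0, Leaf 18 2, Leaf 9 4, Leaf 24 2, Leaf 67 4], Leaf 1 2,
    Leaf 4 1, Leaf 0 1, Leaf 2 1, Branch (7,3) [Leaf 10 5, Leaf 2 4, Leaf 66 4, Leaf 55 4, Leaf 65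
    4, Leaf 6 3, Leaf 23 2]], Branch (1,3) [Leaf 15 2, Leaf 7 2, Leaf 11 4, Branch (5,3) [Leaf 12
    5, Leaf 1 3, Leaf 9 0, Leaf 18 2, Leaf 9 4, Leaf 26 2, Leaf 21 2], Leaf 1 2, Leaf 4 1, Leaf 0
    1, Leaf 34 4, Branch (3,2) [Leaf 17 4, Leaf 0 5, Leaf 3 5, Branch (3,3) [Leaf 0 4, Leaf 8 1,
    Leaf 3 4, Leaf 13 1, Leaf 31 1], Branch (3,3) [Leaf 0 4, Leaf 29 1, Leaf 1 3, Leaf 8 3, Leaf
    31 1], Leaf 1 1, Leaf 2 5]], Leaf 2 2], Leaf 7 4, Leaf 5 2, Branch (1,3) [Leaf 5 4, Leaf 14 0,
    Leaf 16 2, Leaf 22 3, Leaf 32 3, Leaf 1 2, Leaf 4 1, Leaf 0 1, Branch (2,4) [Leaf 17 3, Leaf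
    15 1, Leaf 1 5, Leaf 4 2, Leaf 0 2, Leaf 3 2, Branch (2,2) [Leaf 7 0, Leaf 13 0, Leaf 4 3,
    Leaf 0 3, Leaf 8 5, Leaf 41 1, Branch (3,2) [Leaf 0 5, Leaf 3 5, Leaf 11 3, Leaf 12 2, Leaf 31
    3]], Branch (7,4) [Leaf 47 1, Leaf 34 3, Leaf 33 2, Leaf 6 4, Leaf 21 2, Leaf 6 5, Leaf 45 2],
    Leaf 2 2], Leaf 2 1, Branch (2,4) [Leaf 17 3, Leaf 15 1, Leaf 1 5, Leaf 4 2, Leaf 0 2, Leaf 3
    2, Branch (2,2) [Leaf 7 0, Leaf 13 0, Leaf 4 3, Leaf 0 3, Leaf 8 5, Leaf 2 3, Branch (3,2)
    [Leaf 0 5, Leaf 3 5, Leaf 11 3, Leaf 12 2, Leaf 2 5]], Leaf 10 2, Leaf 36 2]], Leaf 1 4, Leaf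
    3 0, Branch (1,3) [Leaf 5 4, Leaf 22 5, Leaf 11 2, Leaf 7 2, Leaf 13 2, Leaf 8 4, Leaf 4 1,
    Leaf 0 1, Branch (5,1) [Leaf 4 3, Leaf 4 2, Leaf 3 5, Leaf 12 0, Leaf 27 0, Leaf 30 4, Branch
    (6,1) [Leaf 18 0, Leaf 3 2, Leaf 19 1, Leaf 3 4, Leaf 44 3, Leaf 6 3, Leaf 6 5], Leaf 20 1,
    Leaf 6 4], Leaf 2 1, Branch (3,3) [Leaf 10 1, Leaf 5 0, Leaf 28 1, Leaf 0 4, Leaf 12 0, Leaf 3
    4, Branch (3,2) [Leaf 7 0, Leaf 11 1, Leaf 0 5, Leaf 3 5, Leaf 8 3, Leaf 2 5, Leaf 61 5], Leaf
    31 1, Leaf 2 4]], Leaf 4 0, Leaf 0 0, Branch (1,3) [Leaf 5 4, Branch (2,2) [Leaf 7 0, Leaf 15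
    0, Leaf 11 5, Leaf 4 3, Leaf 0 3, Branch (6,2) [Leaf 1 1, Leaf 12 4, Leaf 9 2, Leaf 18 0, Leaf
    9 4, Leaf 26 0, Leaf 21 0], Leaf 1 0, Leaf 34 5, Branch (3,2) [Leaf 17 5, Leaf 0 5, Leaf 3 5,
    Branch (3,3) [Leaf 0 4, Leaf 8 1, Leaf 3 4, Leaf 13 1, Leaf 2 4], Branch (3,3) [Leaf 0 4, Leaf
    29 1, Leaf 1 3, Leaf 8 3, Leaf 2 4], Leaf 1 1, Leaf 31 3]], Branch (3,3) [Leaf 14 4, Leaf 5 0,
    Leaf 0 4, Leaf 32 2, Leaf 1 3, Leaf 3 4, Leaf 22 2, Leaf 2 4, Leaf 34 2], Leaf 7 2, Branch
    (7,4) [Branch (2,4) [Leaf 36 0, Leaf 5 0, Leaf 4 2, Leaf 0 2, Leaf 3 2, Leaf 81 0, Leaf 74 4],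
    Leaf 2 2, Leaf 41 0, Branch (7,3) [Leaf 80 4, Leaf 41 2, Leaf 71 2, Leaf 20 4, Leaf 33 4, Leaf
    6 3, Leaf 45 4], Leaf 6 4, Leaf 72 2, Leaf 6 5, Leaf 21 0, Leaf 82 2], Branch (5,3) [Leaf 0 3,
    Leaf 0 2, Leaf 12 5, Leaf 1 3, Leaf 9 0, Leaf 18 2, Leaf 9 4, Leaf 24 2, Branch (7,3) [Leaf 45
    0, Leaf 21 2, Leaf 23 5, Leaf 2 4, Leaf 40 2, Leaf 6 3, Leaf 37 4]], Leaf 1 2, Leaf 4 1, Leaf
    0 1, Leaf 2 1, Branch (2,4) [Leaf 64 5, Leaf 47 3, Leaf 5 0, Leaf 1 5, Leaf 4 2, Leaf 0 2,
    Leaf 3 2, Branch (2,2) [Leaf 7 0, Leaf 10 1, Leaf 13 0, Leaf 4 3, Leaf 0 3, Leaf 8 5, Leaf 71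
    5], Branch (2,2) [Leaf 7 0, Leaf 10 1, Leaf 74 5, Leaf 4 3, Leaf 0 3, Leaf 83 5, Leaf 1 0]]],
    Branch (2,4) [Branch (2,2) [Leaf 7 0, Leaf 15 0, Leaf 11 5, Leaf 4 3, Leaf 0 3, Branch (6,2)
    [Leaf 1 1, Leaf 12 4, Leaf 9 2, Leaf 18 0, Leaf 9 4, Leaf 24 0, Leaf 67 5], Leaf 1 0, Leaf 2
    3, Branch (7,2) [Leaf 2 5, Leaf 10 4, Leaf 66 5, Leaf 6 1, Leaf 23 0, Leaf 55 5, Leaf 65 5]],
    Leaf 28 0, Leaf 10 0, Leaf 5 0, Leaf 1 5, Leaf 4 2, Leaf 0 2, Leaf 3 2, Branch (2,2) [Leaf 5
    4, Leaf 7 0, Leaf 11 0, Leaf 13 0, Leaf 4 3, Leaf 0 3, Leaf 8 5, Leaf 2 3, Branch (1,3) [Leaf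
    10 3, Leaf 7 2, Leaf 61 3, Leaf 48 3, Leaf 1 2, Leaf 4 1, Leaf 52 5]], Leaf 31 0, Leaf 2 2],
    Leaf 2 0]]"

lemma certificates_valid: "list_all valid certificates"
  by code_simp

text \<open>Ensures that the cells of a pattern lie in the grid, where the relabelling can be
  undone.\<close>

lemma certificate_patterns: "list_all (\<lambda>c. list_all (\<lambda>(p, q). p \<in> set free_cells \<and> q \<in> set free_cells) (pattern c)) certificates"
  by code_simp

text \<open>The whole enumeration: however seven two-edges cover 14 of the free cells, they contain
  an image of some pattern.\<close>

lemma covers_case_tree: "covers (map (\<lambda>c. images (pattern c)) certificates) [] free_cells True case_tree"
  by code_simp

text \<open>The cells (2,4), (5,3) and (6,1) stay unoccupied. Every diagonal through one of them is
  certified from the outset, which is where the derivation starts.\<close>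

definition witness_twos :: "(cell \<times> cell) list" where
  "witness_twos =
    [((4,1), (7,4)), ((1,3), (1,4)), ((4,4), (2,2)), ((7,3), (3,2)), ((3,3), (5,1)), ((7,2),
     (6,2))]"

text \<open>The order matters: the diagonal opposite to an entry must be certified by what precedes.
  Four entries are the two-edges whose cells share no line; they give instances of
  \<open>\<sim>\<close>, all others instances of \<open>\<perp>\<^sub>R\<close>.\<close>

definition witness_steps :: "(cell \<times> cell) list" where
  "witness_steps =
    [((1,4), (2,1)), ((1,3), (5,1)), ((1,1), (5,4)), ((1,3), (5,2)), ((1,2), (5,4)), ((1,1),
     (6,2)), ((1,1), (6,3)), ((1,1), (6,4)), ((1,2), (7,1)), ((2,1), (3,4)), ((2,3), (3,4)),
     ((2,2), (4,4)), ((2,1), (5,4)), ((2,3), (5,2)), ((2,3), (5,4)), ((2,1), (6,2)), ((2,1),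
     (6,3)), ((2,1), (6,4)), ((2,3), (6,4)), ((2,2), (7,1)), ((2,3), (7,4)), ((3,4), (4,2)),
     ((3,3), (5,1)), ((3,1), (5,4)), ((3,1), (6,2)), ((3,1), (6,3)), ((3,1), (6,4)), ((4,3),
     (5,2)), ((4,2), (5,4)), ((4,3), (5,4)), ((4,1), (6,2)), ((4,1), (6,3)), ((4,2), (6,4)),
     ((4,2), (7,1)), ((4,1), (7,4)), ((4,4), (7,3)), ((5,1), (6,2)), ((5,1), (6,4)), ((5,2),
     (6,3)), ((5,4), (6,3)), ((5,2), (7,1)), ((5,4), (7,1)), ((5,4), (7,3)), ((6,3), (7,1)),
     ((6,4), (7,1)), ((6,4), (7,3)), ((1,1), (2,3)), ((1,2), (2,3)), ((1,3), (3,1)), ((1,1),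
     (3,4)), ((1,1), (4,3)), ((1,1), (4,4)), ((1,4), (4,2)), ((1,4), (7,1)), ((2,3), (3,1)),
     ((2,1), (4,2)), ((2,1), (4,3)), ((2,3), (4,2)), ((2,3), (7,2)), ((3,1), (4,3)), ((3,1),
     (4,4)), ((3,1), (5,2)), ((3,4), (6,3)), ((3,4), (7,1)), ((3,2), (7,3)), ((3,4), (7,2)),
     ((4,4), (5,1)), ((4,3), (7,1)), ((4,3), (7,2)), ((1,2), (2,1)), ((1,2), (3,3)), ((1,2),
     (3,4)), ((1,2), (4,3)), ((1,1), (5,2)), ((1,1), (7,3)), ((1,3), (7,2)), ((1,2), (7,4)),
     ((2,1), (3,2)), ((2,1), (5,2)), ((2,2), (6,3)), ((2,3), (7,1)), ((3,1), (4,2)), ((3,3),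
     (4,2)), ((3,4), (4,3)), ((3,4), (5,2)), ((4,1), (5,2)), ((4,2), (6,3)), ((4,3), (6,4)),
     ((5,4), (7,2)), ((1,2), (3,1)), ((1,1), (4,2)), ((1,2), (6,3)), ((1,2), (6,4)), ((5,2),
     (6,4))]"

lemma well_formed_witness: "well_formed witness_twos"
  by code_simp

lemma derivation_witness: "derivation witness_twos [] [] witness_steps"
  by code_simp


section \<open>The upper bound\<close>

lemma column_perms_std_ones: "list_all (\<lambda>g. distinct (map (permute g) std_ones) \<and>
    list_all (\<lambda>p. p \<in> set std_ones) (map (permute g) std_ones)) column_perms"
  by code_simp

lemma column_perm:
  assumes "g \<in> set column_perms"
  shows "bij_betw (\<lambda>i. fst g ! (i - 1)) {1..7} {1..7}" "bij_betw (\<lambda>j. snd g ! (j - 1)) {1..4} {1..4}"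
    "permute g ` set std_ones = set std_ones"
proof -
  have shift: "bij_betw (\<lambda>i. xs ! (i - 1)) {1..k} {1..k}" if "distinct xs" "length xs = k" "set xs = {1..k}" for xs :: "nat list" and k
  proof -
    have "bij_betw (\<lambda>i :: nat. i - 1) {1..k} {..<k}"
      by (rule bij_betw_byWitness[where f' = Suc]) auto
    moreover have "bij_betw ((!) xs) {..<k} {1..k}"
      using bij_betw_nth[of xs "{..<k}" "{1..k}"] that by simp
    ultimately show ?thesis using bij_betw_trans unfolding o_def by blast
  qed
  have r: "{1..7} = {1, 2, 3, 4, 5, 6, 7 :: nat}" and s: "{1..4} = {1, 2, 3, 4 :: nat}" by auto
  have "distinct (fst g) \<and> length (fst g) = 7 \<and> set (fst g) = {1, 2, 3, 4, 5, 6, 7}"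
    using assms unfolding column_perms_def by (auto simp: insert_commute)
  then show "bij_betw (\<lambda>i. fst g ! (i - 1)) {1..7} {1..7}" using r by (intro shift) simp_all
  have "distinct (snd g) \<and> length (snd g) = 4 \<and> set (snd g) = {1, 2, 3, 4}"
    using assms unfolding column_perms_def by (auto simp: insert_commute)
  then show "bij_betw (\<lambda>j. snd g ! (j - 1)) {1..4} {1..4}" using s by (intro shift) simp_all
  show "permute g ` set std_ones = set std_ones"
  proof (rule card_subset_eq)
    have d: "distinct (map (permute g) std_ones)" and sub: "\<forall>p\<in>set (map (permute g) std_ones). p \<in> set std_ones"
      using column_perms_std_ones assms unfolding list_all_iff by blast+
    show "permute g ` set std_ones \<subseteq> set std_ones" using sub by auto
    have "inj_on (permute g) (set std_ones)" using d by (simp add: distinct_map)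
    then show "card (permute g ` set std_ones) = card (set std_ones)" by (rule card_image)
  qed simp
qed

context standard
begin

lemma two_edges_free:
  assumes "e \<in> two_edges G"
  shows "e \<subseteq> set free_cells" "card e = 2"
proof -
  show "card e = 2" using assms conf by (simp add: is_configuration_def)
  have "e \<subseteq> cells 7 4" using assms conf by (simp add: is_configuration_def)
  moreover have "p \<notin> set std_ones" if "p \<in> e" for p
  proof
    assume "p \<in> set std_ones"
    then have "{p} = e" using that assms by (intro simple_edge_unique[OF simple]) (auto simp: selected_edges_def ones)
    then show False using \<open>card e = 2\<close> by auto
  qed
  ultimately show "e \<subseteq> set free_cells" unfolding set_free_cells by blast
qed

lemma card_two_edges: "card (\<Union> (two_edges G)) = 2 * card (two_edges G)"
proof -
  have "card (\<Union> (two_edges G)) = sum card (two_edges G)"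
  proof (rule card_Union_disjoint)
    show "pairwise disjnt (two_edges G)"
      using simple by (auto simp: pairwise_def disjnt_def simple_def selected_edges_def)
    show "finite e" if "e \<in> two_edges G" for e
      using two_edges_free[OF that] finite_subset by blast
  qed
  then show ?thesis using two_edges_free by simp
qed

text \<open>Disjoint two-edges cover an even number of the 15 free cells.\<close>

lemma card_two_edges_le: "card (two_edges G) \<le> 7"
proof -
  have "card (\<Union> (two_edges G)) \<le> card (set free_cells)"
    using two_edges_free by (intro card_mono) auto
  then show ?thesis unfolding card_two_edges by (simp add: free_cells_eq)
qed

text \<open>Exactly one free cell \<open>z\<close> is left over, so the case distinction starts with
  its exception open. The pattern it finds is moved back to its listed form by undoing a column
  permutation, where its certificate applies.\<close>

lemma reducible_seven:
  assumes seven: "card (two_edges G) = 7"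
  shows "reducible G"
proof -
  let ?U = "\<Union> (two_edges G)"
  have sub: "?U \<subseteq> set free_cells" using two_edges_free by blast
  have c15: "card (set free_cells) = 15" and dist: "distinct free_cells" by (simp_all add: free_cells_eq)
  have "card (set free_cells - ?U) = 1"
    using card_Diff_subset[OF finite_subset[OF sub] sub] c15 by (simp add: card_two_edges seven)
  then obtain z where z: "set free_cells - ?U = {z}" by (rule card_1_singletonE)
  have "matched_in z free_cells True"
    unfolding matched_in_def
  proof (intro conjI ballI dist)
    fix c assume c: "c \<in> set free_cells"
    show "(\<exists>d\<in>set free_cells. d \<noteq> c \<and> {c, d} \<in> two_edges G) \<or> True \<and> c = z"
    proof (cases "c = z")
      case False
      then obtain e where e: "e \<in> two_edges G" "c \<in> e" using z c by blast
      then obtain d where "e = {c, d}" "d \<noteq> c" using two_edges_free(2)[OF e(1)] by (auto simp: card_2_iff)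
      then show ?thesis using e two_edges_free(1)[OF e(1)] by blast
    qed simp
  qed
  from covers_sound(1)[OF covers_case_tree this] obtain n g
    where n: "n < length certificates" and g: "g < length column_perms"
      and pat: "\<forall>(p, q)\<in>set (images (pattern (certificates ! n)) ! g). {p, q} \<in> two_edges G"
    by (auto simp: images_def)
  define c where "c = certificates ! n"
  define h where "h = column_perms ! g"
  have h: "h \<in> set column_perms" using g by (simp add: h_def)
  have c: "c \<in> set certificates" using n by (simp add: c_def)
  have perm: "permute h = map_prod (\<lambda>i. fst h ! (i - 1)) (\<lambda>j. snd h ! (j - 1))"
    by (auto simp: permute_def)
  have pat': "{permute h p, permute h q} \<in> two_edges G" if "(p, q) \<in> set (pattern c)" for p q
    using pat that g by (force simp: images_def c_def h_def)
  show ?thesis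
  proof (rule reducible_pullback[OF conf simple column_perm(1,2)[OF h]])
    show "one_edges G = map_prod (\<lambda>i. fst h ! (i - 1)) (\<lambda>j. snd h ! (j - 1)) ` set std_ones"
      using column_perm(3)[OF h] by (simp add: ones perm)
    fix G' assume "standard G'"
      and edges: "\<And>p q. p \<in> cells 7 4 \<Longrightarrow> q \<in> cells 7 4 \<Longrightarrow>
        {map_prod (\<lambda>i. fst h ! (i - 1)) (\<lambda>j. snd h ! (j - 1)) p, map_prod (\<lambda>i. fst h ! (i - 1)) (\<lambda>j. snd h ! (j - 1)) q} \<in> two_edges G \<Longrightarrow>
        {p, q} \<in> two_edges G'"
    have "set free_cells \<subseteq> cells 7 4" by (auto simp: set_free_cells)
    then have cells: "p \<in> cells 7 4 \<and> q \<in> cells 7 4" if "(p, q) \<in> set (pattern c)" for p q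
      using that c certificate_patterns unfolding list_all_iff by blast
    show "reducible G'"
    proof (rule standard.reducible_if_pattern[OF \<open>standard G'\<close>])
      show "valid c" using certificates_valid c by (simp add: list_all_iff)
      fix p q assume pq: "(p, q) \<in> set (pattern c)"
      then show "{p, q} \<in> two_edges G'"
        using edges cells[OF pq] pat'[OF pq] unfolding perm by blast
    qed
  qed
qed

end

lemma limited_cases:
  assumes "limited 7 4 G"
  shows "num_squares G \<le> 20" "num_squares G = 20 \<Longrightarrow> reducible G"
proof -
  have conf: "is_configuration 7 4 G" and simple: "simple G" and free: "C4_free (one_edges G)"
    and c13: "card (one_edges G) = 13"
    using assms by (auto simp: limited_def zarankiewicz_7_4)
  interpret C4_free_7_4 "one_edges G"
    using conf free by unfold_locales (auto simp: is_configuration_def)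
  obtain r s where rs: "bij_betw r {1..7} {1..7}" "bij_betw s {1..4} {1..4}" "one_edges G = map_prod r s ` set std_ones"
    using normal_form[OF c13] .
  have num: "num_squares G = 13 + card (two_edges G)" by (simp add: num_squares_def c13)
  show "reducible G" if "num_squares G = 20"
    using reducible_pullback[OF conf simple rs] standard.reducible_seven that num by auto
  show "num_squares G \<le> 20"
  proof -
    \<comment> \<open>At most seven two-edges are known for standard configurations; the relabelling
      transports this bound, as it preserves the number of squares.\<close>
    define r' s' where "r' = inv_into {1..7} r" and "s' = inv_into {1..4} s"
    interpret I: relabelling 7 4 r' s' G
      using conf rs by unfold_locales (auto simp: r'_def s'_def intro: bij_betw_inv_into)
    let ?G' = "map_config r' s' G"
    have "map_prod r' s' (map_prod r s p) = p" if "p \<in> set std_ones" for p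
    proof -
      have "p \<in> cells 7 4" using that by (auto simp: std_ones_def cells_def)
      then show ?thesis using rs by (cases p) (simp add: cells_def r'_def s'_def bij_betw_inv_into_left)
    qed
    then have "one_edges ?G' = set std_ones"
      by (simp add: map_config_def rs(3) image_image)
    then have "standard ?G'"
      using I.configuration_map I.simple_map[OF simple] by unfold_locales
    then have "card (two_edges ?G') \<le> 7" by (rule standard.card_two_edges_le)
    moreover have "num_squares ?G' = card (one_edges ?G') + card (two_edges ?G')" by (simp add: num_squares_def)
    moreover have "card (one_edges ?G') = 13"
      unfolding \<open>one_edges ?G' = set std_ones\<close> by (simp add: std_ones_def)
    ultimately show ?thesis using I.num_squares_map by simp
  qed
qed

lemma limited_irreducible_le:
  assumes "limited 7 4 G" "irreducible_config 7 4 G"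
  shows "num_squares G \<le> 19"
proof (rule ccontr)
  assume "\<not> ?thesis"
  then have n: "num_squares G = 20" using limited_cases(1)[OF assms(1)] by simp
  then have "reducible G" using limited_cases(2)[OF assms(1)] by simp
  then show False using SOS_le assms(2) n by (fastforce simp: reducible_def irreducible_config_def)
qed

lemma witness:
  "limited 7 4 (std_config witness_twos)" "RW3_plus_admissible (std_config witness_twos)"
  "num_squares (std_config witness_twos) = 19"
proof -
  note ok = std_config_ok[OF well_formed_witness]
  show "limited 7 4 (std_config witness_twos)"
    using ok(1,2) C4_free_std_ones
    by (simp add: limited_def zarankiewicz_7_4 std_config_def) (simp add: std_ones_def)
  show "RW3_plus_admissible (std_config witness_twos)"
    by (rule derivation_imp_admissible[OF well_formed_witness derivation_witness])
  show "num_squares (std_config witness_twos) = 19"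
    unfolding ok(3) by (simp add: witness_twos_def)
qed

text \<open>The signed parameter enters only through the hierarchy, hence as an arbitrary integer
  between the other two.\<close>

theorem theorem4p2:
  "z2 7 4 = 19 \<and> z_RL 7 4 = 19 \<and>
   (\<forall>z_SL :: int. int (z_RL 7 4) \<le> z_SL \<and> z_SL \<le> int (z2 7 4) \<longrightarrow> z_SL = 19)"
proof -
  have irr: "irreducible_config 7 4 G" if "limited 7 4 G" "RW3_plus_admissible G" for G
    using that RW3_plus_admissible_imp_irreducible[of 7 4 G] by (simp add: limited_def)
  \<comment> \<open>Instantiated with irreducibility and with admissibility. The latter implies the
    former, so the same upper bound and the same witness serve both maxima.\<close>
  have max: "Max {num_squares G |G. limited 7 4 G \<and> P G} = 19"
    if le: "\<And>G. limited 7 4 G \<Longrightarrow> P G \<Longrightarrow> irreducible_config 7 4 G" and P: "P (std_config witness_twos)" for P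
  proof (rule Max_eqI)
    have sub: "{num_squares G |G. limited 7 4 G \<and> P G} \<subseteq> {..19}"
      using limited_irreducible_le le by blast
    then show "finite {num_squares G |G. limited 7 4 G \<and> P G}" by (rule finite_subset) simp
    show "y \<le> 19" if "y \<in> {num_squares G |G. limited 7 4 G \<and> P G}" for y
      using that sub by blast
    show "19 \<in> {num_squares G |G. limited 7 4 G \<and> P G}"
      using witness(1,3) P by (intro CollectI exI[of _ "std_config witness_twos"]) simp
  qed
  have "z2 7 4 = 19"
    unfolding z2_def by (rule max) (use irr witness in auto)
  moreover have "z_RL 7 4 = 19"
    unfolding z_RL_def by (rule max) (use irr witness in auto)
  ultimately show ?thesis by simp
qed

end
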